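(* For $r,s\in\mathbb N$, $a_1,\dots,a_r,b_1,\dots,b_s\in\mathfrak h$, $m_1,\dots,m_r,n_1,\dots,n_s\in\mathbb N$, $$\begin{aligned} &Y(a_1(-m_1-1/2)\cdots a_r(-m_r-1/2)\mathbf 1,x)\,Y(b_1(-n_1-1/2)\cdots b_s(-n_s-1/2)\mathbf 1,y)\\ &=\;:a_1^{(m_1)}(x)\cdots a_r^{(m_r)}(x)\,b_1^{(n_1)}(y)\cdots b_s^{(n_s)}(y):\\ &\quad+\sum_{\rho=1}^{\min(r,s)}\ \sum_{\substack{1\le i_1<\cdots<i_\rho\le r\\1\le j_1<\cdots<j_\rho\le s}}(-1)^{i_1+\cdots+i_\rho+j_1+\cdots+j_\rho}(-1)^{r\rho+\rho(\rho+1)/2}\ \det\Big((a_{i_k},b_{j_l})\,\iota_{xy}f_{m_{i_k}n_{j_l}}(x,y)\Big)_{1\le k,l\le\rho}\\ &\qquad\cdot:a_1^{(m_1)}(x)\cdots\widehat{a_{i_1}^{(m_{i_1})}(x)}\cdots\widehat{a_{i_\rho}^{(m_{i_\rho})}(x)}\cdots a_r^{(m_r)}(x)\ b_1^{(n_1)}(y)\cdots\widehat{b_{j_1}^{(n_{j_1})}(y)}\cdots\widehat{b_{j_\rho}^{(n_{j_\rho})}(y)}\cdots b_s^{(n_s)}(y): \end{aligned}$$ where hats denote omitted factors.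
   Context: $\mathbb N=\{0,1,2,\dots\}$. Let $\mathfrak h=\mathbb C^{2M}$ with a nondegenerate symmetric bilinear form $(\cdot,\cdot)$ and $\mathfrak h=\mathfrak p\oplus\mathfrak q$ a decomposition into maximal isotropic subspaces $\mathfrak p,\mathfrak q\simeq\mathbb C^M$. Put $\hat{\mathfrak h}_{\mathbb Z+1/2}=\mathfrak h\otimes t^{1/2}\mathbb C[t,t^{-1}]\oplus\mathbb C\mathbf k$ and $\hat{\mathfrak h}^{\pm}_{\mathbb Z+1/2}=\mathfrak h\otimes t^{\pm1/2}\mathbb C[t^{\pm1}]$. Let $N(\hat{\mathfrak h}_{\mathbb Z+1/2})$ be the quotient of the tensor algebra $T(\hat{\mathfrak h}_{\mathbb Z+1/2})$ by the two-sided ideal generated by $(a\otimes t^{m+\frac12})\otimes(b\otimes t^{n+\frac12})+(b\otimes t^{n+\frac12})\otimes(a\otimes t^{m+\frac12})-(a,b)\delta_{m+n+1,0}\mathbf k$ and $(a\otimes t^{k+\frac12})\otimes\mathbf k-\mathbf k\otimes(a\otimes t^{k+\frac12})$, for $a,b\in\mathfrak h$, integers $m\ge0$, $n\le-1$, $k\in\mathbb Z$. Let $\mathbb C\mathbf 1$ be the one-dimensional module of the subalgebra $T(\hat{\mathfrak h}^+_{\mathbb Z+1/2})\otimes T(\mathbb C\mathbf k)$ on which $\hat{\mathfrak h}^+_{\mathbb Z+1/2}$ acts by $0$ and $\mathbf k$ acts by $1$, and let $V=N(\hat{\mathfrak h}_{\mathbb Z+1/2})\otimes_{T(\hat{\mathfrak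 h}^+_{\mathbb Z+1/2})\otimes T(\mathbb C\mathbf k)}\mathbb C\mathbf 1$. As a vector space $V\cong T(\hat{\mathfrak h}^-_{\mathbb Z+1/2})\otimes\mathbb C\mathbf 1$. Write $h(m+1/2)$, $m\in\mathbb Z$, for the action of $h\otimes t^{m+1/2}$ on $V$ (a positive mode if $m\ge0$, a negative mode if $m<0$). $V$ is spanned by $h_1(-m_1-1/2)\cdots h_r(-m_r-1/2)\mathbf 1$ ($r\in\mathbb N$, $h_i\in\mathfrak h$, $m_i\in\mathbb N$). For $h\in\mathfrak h$, $m\in\mathbb N$, set $h^{(m)}(x)=\sum_{n\in\mathbb Z}\binom{-n-1}{m}h(n+1/2)x^{-n-m-1}$. The normal ordering of a product of modes is $:h_1(n_1+1/2)\cdots h_r(n_r+1/2):\;=(-1)^\sigma h_{\sigma(1)}(n_{\sigma(1)}+1/2)\cdots h_{\sigma(r)}(n_{\sigma(r)}+1/2)$, where $\sigma$ is the unique permutation of $\{1,\dots,r\}$ placing all negative modes to the left of all positive modes while preserving the relative order among the negative modes and among the positive modes, and $(-1)^\sigma$ is its sign. It is extended componentwise to products of series: $:h_1^{(m_1)}(x_1)\cdots h_r^{(m_r)}(x_r):\;=\sum_{n_1,\dots,n_r\in\mathbb Z}:h_1(n_1+1/2)\cdots h_r(n_r+1/2):\prod_i\binom{-n_i-1}{m_i}x_i^{-n_i-m_i-1}$, where variables may be set equal; an empty normal-ordered product is $1_V$. The linear map $Y:V\otimes V\to V((x))$ is defined by $Y(\mathbf 1,x)=1_V$ and $Y(h_1(-m_1-1/2)\cdots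 h_r(-m_r-1/2)\mathbf 1,x)=\;:h_1^{(m_1)}(x)\cdots h_r^{(m_r)}(x):$, extended linearly. $f_{mn}(x,y)=\frac1{m!n!}\frac{\partial^{m+n}}{\partial x^m\partial y^n}(x-y)^{-1}=\binom{-n-1}{m}(x-y)^{-m-n-1}$ for $m,n\ge0$, and $\iota_{xy}$ expands negative powers of $x-y$ as power series in $y$: $\iota_{xy}(x-y)^{-t}=\sum_{i\ge0}\binom{t+i-1}{i}x^{-t-i}y^i$. *)

theory Defs
  imports
    "HOL-Library.Poly_Mapping"
    "HOL-Library.Groups_Big_Fun"
    "HOL-Library.Product_Plus"
    "HOL-Combinatorics.Permutations"
    "HOL-Computational_Algebra.Formal_Laurent_Series"
    "Jordan_Normal_Form.Determinant"
begin

section \<open>Complex vector spaces\<close>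

class complex_vector = ab_group_add +
  fixes scaleC :: "complex \<Rightarrow> 'a \<Rightarrow> 'a"  (infixr \<open>*\<^sub>C\<close> 75)
  assumes scaleC_add_right: "c *\<^sub>C (x + y) = c *\<^sub>C x + c *\<^sub>C y"
    and scaleC_add_left: "(c + d) *\<^sub>C x = c *\<^sub>C x + d *\<^sub>C x"
    and scaleC_scaleC: "c *\<^sub>C d *\<^sub>C x = (c * d) *\<^sub>C x"
    and scaleC_one: "1 *\<^sub>C x = x"

global_interpretation complex_vector: vector_space "scaleC :: complex \<Rightarrow> 'a \<Rightarrow> 'a::complex_vector"
  by unfold_locales (rule scaleC_add_right scaleC_add_left scaleC_scaleC scaleC_one)+

abbreviation clinear :: "('a::complex_vector \<Rightarrow> 'b::complex_vector) \<Rightarrow> bool"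
  where "clinear \<equiv> Vector_Spaces.linear (*\<^sub>C) (*\<^sub>C)"

instantiation complex :: complex_vector
begin
definition scaleC_complex :: "complex \<Rightarrow> complex \<Rightarrow> complex" where "scaleC_complex = (*)"
instance by standard (simp_all add: scaleC_complex_def algebra_simps)
end

instantiation prod :: (complex_vector, complex_vector) complex_vector
begin
definition scaleC_prod :: "complex \<Rightarrow> 'a \<times> 'b \<Rightarrow> 'a \<times> 'b"
  where "scaleC_prod c x = (c *\<^sub>C fst x, c *\<^sub>C snd x)"
instance
  by standard (simp_all add: scaleC_prod_def plus_prod_def scaleC_add_right scaleC_add_left
      scaleC_scaleC scaleC_one)
end

instantiation poly_mapping :: (type, complex_vector) complex_vector
begin
definition scaleC_poly_mapping :: "complex \<Rightarrow> ('a \<Rightarrow>\<^sub>0 'b) \<Rightarrow> 'a \<Rightarrow>\<^sub>0 'b"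
  where "scaleC_poly_mapping c = Poly_Mapping.map ((*\<^sub>C) c)"
lemma lookup_scaleC [simp]: "Poly_Mapping.lookup (c *\<^sub>C p) k = c *\<^sub>C Poly_Mapping.lookup p k"
  by (auto simp: scaleC_poly_mapping_def map.rep_eq when_def)
instance
  by standard (rule poly_mapping_eqI; simp add: lookup_add scaleC_add_right scaleC_add_left
      scaleC_scaleC scaleC_one)+
end

text \<open>A complex vector space with a nondegenerate symmetric bilinear form. Finite dimension and
  the decomposition into maximal isotropic subspaces are hypotheses of the theorem.\<close>

class complex_bilinear_space = complex_vector +
  fixes form :: "'a \<Rightarrow> 'a \<Rightarrow> complex"
  assumes form_sym: "form x y = form y x"
    and form_add_left: "form (x + y) z = form x z + form y z"
    and form_scaleC_left: "form (c *\<^sub>C x) y = c * form x y"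
    and form_nondegenerate: "(\<And>y. form x y = 0) \<Longrightarrow> x = 0"

definition isotropic :: "'h::complex_bilinear_space set \<Rightarrow> bool"
  where "isotropic S \<longleftrightarrow> (\<forall>a\<in>S. \<forall>b\<in>S. form a b = 0)"

definition maximal_isotropic :: "'h::complex_bilinear_space set \<Rightarrow> bool"
  where "maximal_isotropic S \<longleftrightarrow> complex_vector.subspace S \<and> isotropic S \<and>
    (\<forall>T. complex_vector.subspace T \<and> isotropic T \<and> S \<subseteq> T \<longrightarrow> T = S)"


section \<open>Tensor algebras\<close>

definition two_sided_ideal :: "'a::{ring, monoid_mult} set \<Rightarrow> bool"
  where "two_sided_ideal I \<longleftrightarrow> 0 \<in> I \<and> (\<forall>x\<in>I. \<forall>y\<in>I. x + y \<in> I) \<and>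
    (\<forall>x\<in>I. \<forall>a. a * x \<in> I \<and> x * a \<in> I)"

abbreviation ideal_generated :: "'a::{ring, monoid_mult} set \<Rightarrow> 'a set"
  where "ideal_generated S \<equiv> two_sided_ideal hull S"

lemma two_sided_ideal_generated: "two_sided_ideal (ideal_generated S)"
  by (rule hull_in) (auto simp: two_sided_ideal_def)

lemma two_sided_idealD:
  assumes "two_sided_ideal I"
  shows "0 \<in> I" "x \<in> I \<Longrightarrow> y \<in> I \<Longrightarrow> x + y \<in> I" "x \<in> I \<Longrightarrow> a * x \<in> I" "x \<in> I \<Longrightarrow> x * a \<in> I"
    "x \<in> I \<Longrightarrow> - x \<in> I" "x \<in> I \<Longrightarrow> y \<in> I \<Longrightarrow> x - y \<in> I"
proof -
  show *: "0 \<in> I" "\<And>x y. x \<in> I \<Longrightarrow> y \<in> I \<Longrightarrow> x + y \<in> I" "\<And>x a. x \<in> I \<Longrightarrow> a * x \<in> I"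
    "\<And>x a. x \<in> I \<Longrightarrow> x * a \<in> I"
    using assms by (auto simp: two_sided_ideal_def)
  show m: "- x \<in> I" if "x \<in> I" for x
    using *(3)[OF that, of "- 1"] by simp
  show "x \<in> I \<Longrightarrow> y \<in> I \<Longrightarrow> x - y \<in> I"
    using *(2)[of x "- y"] m[of y] by simp
qed

lemma ideal_eq_cong: "two_sided_ideal I \<Longrightarrow> x = y \<Longrightarrow> x - y \<in> I"
  by (simp add: two_sided_idealD)

lemma equivp_ideal:
  assumes "two_sided_ideal I"
  shows "equivp (\<lambda>x y. x - y \<in> I)"
proof (rule equivpI)
  note D = two_sided_idealD[OF assms]
  show "reflp (\<lambda>x y. x - y \<in> I)" by (rule reflpI) (simp add: D)
  show "symp (\<lambda>x y. x - y \<in> I)"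
  proof (rule sympI)
    fix x y assume "x - y \<in> I"
    from D(5)[OF this] show "y - x \<in> I" by simp
  qed
  show "transp (\<lambda>x y. x - y \<in> I)"
  proof (rule transpI)
    fix x y z assume "x - y \<in> I" "y - z \<in> I"
    from D(2)[OF this] show "x - z \<in> I" by simp
  qed
qed

lemma ideal_mult_cong:
  assumes "two_sided_ideal I" "x - x' \<in> I" "y - y' \<in> I"
  shows "x * y - x' * y' \<in> I"
proof -
  have "x * y - x' * y' = (x - x') * y + x' * (y - y')" by (simp add: algebra_simps)
  then show ?thesis using assms by (simp add: two_sided_idealD)
qed

lemma ideal_add_cong:
  assumes "two_sided_ideal I" "x - x' \<in> I" "y - y' \<in> I"
  shows "(x + y) - (x' + y') \<in> I"
proof -
  have "(x + y) - (x' + y') = (x - x') + (y - y')" by simp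
  then show ?thesis using assms by (metis two_sided_idealD(2))
qed

lemma ideal_diff_cong:
  assumes "two_sided_ideal I" "x - x' \<in> I" "y - y' \<in> I"
  shows "(x - y) - (x' - y') \<in> I"
proof -
  have "(x - y) - (x' - y') = (x - x') - (y - y')" by simp
  then show ?thesis using assms by (metis two_sided_idealD(6))
qed

lemma ideal_uminus_cong:
  assumes "two_sided_ideal I" "x - x' \<in> I"
  shows "(- x) - (- x') \<in> I"
  using ideal_diff_cong[OF assms(1) _ assms(2), of 0 0] assms(1) by (simp add: two_sided_idealD)

text \<open>Lists form a monoid under concatenation, which makes \<open>'w list \<Rightarrow>\<^sub>0 complex\<close> the free
  associative unital algebra on the set \<open>'w\<close>.\<close>

instantiation list :: (type) monoid_add
begin
definition zero_list :: "'a list" where "zero_list = []"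
definition plus_list :: "'a list \<Rightarrow> 'a list \<Rightarrow> 'a list" where "plus_list = (@)"
instance by standard (simp_all add: zero_list_def plus_list_def)
end

definition word :: "'w list \<Rightarrow> 'w list \<Rightarrow>\<^sub>0 complex"
  where "word us = Poly_Mapping.single us 1"

lemma scaleC_free: "c *\<^sub>C p = Poly_Mapping.single 0 c * (p :: 'w list \<Rightarrow>\<^sub>0 complex)"
proof (rule poly_mapping_eqI)
  fix k
  have "Poly_Mapping.single 0 c * p = Poly_Mapping.map ((*) c) p"
    by (simp add: mult_map_scale_conv_mult)
  then show "Poly_Mapping.lookup (c *\<^sub>C p) k = Poly_Mapping.lookup (Poly_Mapping.single 0 c * p) k"
    by (simp add: scaleC_poly_mapping_def scaleC_complex_def)
qed

definition tensor_relations :: "('w::complex_vector list \<Rightarrow>\<^sub>0 complex) set"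
  where "tensor_relations =
    {word [u + v] - word [u] - word [v] | u v. True} \<union> {word [c *\<^sub>C u] - c *\<^sub>C word [u] | c u. True}"

quotient_type (overloaded) 'w tensor_algebra = "'w::complex_vector list \<Rightarrow>\<^sub>0 complex" /
  "\<lambda>x y. x - y \<in> ideal_generated tensor_relations"
  by (intro equivp_ideal two_sided_ideal_generated)

lemma scaleC_free_cong:
  assumes "x - y \<in> ideal_generated S"
  shows "c *\<^sub>C x - c *\<^sub>C y \<in> ideal_generated (S :: ('w list \<Rightarrow>\<^sub>0 complex) set)"
  unfolding scaleC_free
  by (rule ideal_mult_cong[OF two_sided_ideal_generated ideal_eq_cong[OF two_sided_ideal_generated] assms])
    (rule refl)

lemma scaleC_free_mult:
  "(c *\<^sub>C x) * y = c *\<^sub>C (x * y)" "x * (c *\<^sub>C y) = c *\<^sub>C (x * y :: 'w list \<Rightarrow>\<^sub>0 complex)"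
proof -
  show "(c *\<^sub>C x) * y = c *\<^sub>C (x * y)"
    by (simp only: scaleC_free mult.assoc)
  have "x * Poly_Mapping.single 0 c = Poly_Mapping.single 0 c * x"
  proof (induction x rule: update_induct)
    case (update f a b)
    have u: "Poly_Mapping.update a b f = f + Poly_Mapping.single a b"
      using update by (intro poly_mapping_eqI)
        (auto simp: lookup_update lookup_add lookup_single when_def in_keys_iff)
    show ?case
      unfolding u using update by (simp add: distrib_left distrib_right mult_single mult.commute)
  qed simp
  then show "x * (c *\<^sub>C y) = c *\<^sub>C (x * y)"
    by (metis scaleC_free mult.assoc)
qed

class complex_algebra = complex_vector + ring + monoid_mult +
  assumes scaleC_mult_left: "(c *\<^sub>C x) * y = c *\<^sub>C (x * y)"
    and scaleC_mult_right: "x * (c *\<^sub>C y) = c *\<^sub>C (x * y)"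

instantiation tensor_algebra :: (complex_vector) complex_algebra
begin
lift_definition zero_tensor_algebra :: "'a tensor_algebra" is 0 .
lift_definition one_tensor_algebra :: "'a tensor_algebra" is 1 .
lift_definition plus_tensor_algebra :: "'a tensor_algebra \<Rightarrow> 'a tensor_algebra \<Rightarrow> 'a tensor_algebra"
  is "(+)" by (intro ideal_add_cong two_sided_ideal_generated)
lift_definition minus_tensor_algebra :: "'a tensor_algebra \<Rightarrow> 'a tensor_algebra \<Rightarrow> 'a tensor_algebra"
  is "(-)" by (intro ideal_diff_cong two_sided_ideal_generated)
lift_definition uminus_tensor_algebra :: "'a tensor_algebra \<Rightarrow> 'a tensor_algebra"
  is uminus by (intro ideal_uminus_cong two_sided_ideal_generated)
lift_definition times_tensor_algebra :: "'a tensor_algebra \<Rightarrow> 'a tensor_algebra \<Rightarrow> 'a tensor_algebra"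
  is "(*)" by (intro ideal_mult_cong two_sided_ideal_generated)
lift_definition scaleC_tensor_algebra :: "complex \<Rightarrow> 'a tensor_algebra \<Rightarrow> 'a tensor_algebra"
  is "(*\<^sub>C)" by (rule scaleC_free_cong)
instance
proof
  fix x y z :: "'a tensor_algebra" and c d :: complex
  note eq = ideal_eq_cong[OF two_sided_ideal_generated]
  show "c *\<^sub>C (x + y) = c *\<^sub>C x + c *\<^sub>C y" by transfer (rule eq, rule scaleC_add_right)
  show "(c + d) *\<^sub>C x = c *\<^sub>C x + d *\<^sub>C x" by transfer (rule eq, rule scaleC_add_left)
  show "c *\<^sub>C d *\<^sub>C x = (c * d) *\<^sub>C x" by transfer (rule eq, rule scaleC_scaleC)
  show "1 *\<^sub>C x = x" by transfer (rule eq, rule scaleC_one)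
  show "(c *\<^sub>C x) * y = c *\<^sub>C (x * y)" by transfer (rule eq, rule scaleC_free_mult)
  show "x * (c *\<^sub>C y) = c *\<^sub>C (x * y)" by transfer (rule eq, rule scaleC_free_mult)
  show "x + y + z = x + (y + z)" by transfer (rule eq, rule add.assoc)
  show "x + y = y + x" by transfer (rule eq, rule add.commute)
  show "0 + x = x" by transfer (rule eq, rule add_0_left)
  show "- x + x = 0" by transfer (rule eq, rule left_minus)
  show "x - y = x + - y" by transfer (rule eq, rule diff_conv_add_uminus)
  show "x * y * z = x * (y * z)" by transfer (rule eq, rule mult.assoc)
  show "(x + y) * z = x * z + y * z" by transfer (rule eq, rule distrib_right)
  show "x * (y + z) = x * y + x * z" by transfer (rule eq, rule distrib_left)
  show "1 * x = x" by transfer (rule eq, rule mult_1_left)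
  show "x * 1 = x" by transfer (rule eq, rule mult_1_right)
qed
end

lemma ideal_scaleC_cong:
  fixes I :: "'a::complex_algebra set"
  assumes "two_sided_ideal I" "x - y \<in> I"
  shows "c *\<^sub>C x - c *\<^sub>C y \<in> I"
proof -
  have "c *\<^sub>C x - c *\<^sub>C y = (c *\<^sub>C 1) * (x - y)"
    by (simp add: scaleC_mult_left complex_vector.scale_right_diff_distrib)
  then show ?thesis using assms by (simp add: two_sided_idealD)
qed

lift_definition tensor_gen :: "'w::complex_vector \<Rightarrow> 'w tensor_algebra" is "\<lambda>w. word [w]" .


section \<open>The algebra \<open>N\<close>\<close>

text \<open>The element \<open>(u, c)\<close> stands for \<open>\<Sum>\<^sub>m u m \<otimes> t\<^bsup>m+1/2\<^esup> + c k\<close>; throughout, the mode with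
  exponent \<open>m + 1/2\<close> is indexed by the integer \<open>m\<close>.\<close>

type_synonym 'h affine = "(int \<Rightarrow>\<^sub>0 'h) \<times> complex"

definition tensor_mode :: "'h::complex_bilinear_space \<Rightarrow> int \<Rightarrow> 'h affine tensor_algebra"
  where "tensor_mode a m = tensor_gen (Poly_Mapping.single m a, 0)"

definition tensor_central :: "'h::complex_bilinear_space affine tensor_algebra"
  where "tensor_central = tensor_gen (0, 1)"

definition mode_relations :: "'h::complex_bilinear_space affine tensor_algebra set"
  where "mode_relations =
    {tensor_mode a m * tensor_mode b n + tensor_mode b n * tensor_mode a m
       - (form a b * of_bool (m + n + 1 = 0)) *\<^sub>C tensor_central | a b m n. m \<ge> 0 \<and> n \<le> -1} \<union>
    {tensor_mode a k * tensor_central - tensor_central * tensor_mode a k | a k. True}"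

quotient_type (overloaded) 'h mode_algebra = "'h::complex_bilinear_space affine tensor_algebra" /
  "\<lambda>x y. x - y \<in> ideal_generated mode_relations"
  by (intro equivp_ideal two_sided_ideal_generated)

instantiation mode_algebra :: (complex_bilinear_space) complex_algebra
begin
lift_definition zero_mode_algebra :: "'a mode_algebra" is 0 .
lift_definition one_mode_algebra :: "'a mode_algebra" is 1 .
lift_definition plus_mode_algebra :: "'a mode_algebra \<Rightarrow> 'a mode_algebra \<Rightarrow> 'a mode_algebra"
  is "(+)" by (intro ideal_add_cong two_sided_ideal_generated)
lift_definition minus_mode_algebra :: "'a mode_algebra \<Rightarrow> 'a mode_algebra \<Rightarrow> 'a mode_algebra"
  is "(-)" by (intro ideal_diff_cong two_sided_ideal_generated)
lift_definition uminus_mode_algebra :: "'a mode_algebra \<Rightarrow> 'a mode_algebra"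
  is uminus by (intro ideal_uminus_cong two_sided_ideal_generated)
lift_definition times_mode_algebra :: "'a mode_algebra \<Rightarrow> 'a mode_algebra \<Rightarrow> 'a mode_algebra"
  is "(*)" by (intro ideal_mult_cong two_sided_ideal_generated)
lift_definition scaleC_mode_algebra :: "complex \<Rightarrow> 'a mode_algebra \<Rightarrow> 'a mode_algebra"
  is "(*\<^sub>C)" by (intro ideal_scaleC_cong two_sided_ideal_generated)
instance
proof
  fix x y z :: "'a mode_algebra" and c d :: complex
  note eq = ideal_eq_cong[OF two_sided_ideal_generated]
  show "c *\<^sub>C (x + y) = c *\<^sub>C x + c *\<^sub>C y" by transfer (rule eq, rule scaleC_add_right)
  show "(c + d) *\<^sub>C x = c *\<^sub>C x + d *\<^sub>C x" by transfer (rule eq, rule scaleC_add_left)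
  show "c *\<^sub>C d *\<^sub>C x = (c * d) *\<^sub>C x" by transfer (rule eq, rule scaleC_scaleC)
  show "1 *\<^sub>C x = x" by transfer (rule eq, rule scaleC_one)
  show "(c *\<^sub>C x) * y = c *\<^sub>C (x * y)" by transfer (rule eq, rule scaleC_mult_left)
  show "x * (c *\<^sub>C y) = c *\<^sub>C (x * y)" by transfer (rule eq, rule scaleC_mult_right)
  show "x + y + z = x + (y + z)" by transfer (rule eq, rule add.assoc)
  show "x + y = y + x" by transfer (rule eq, rule add.commute)
  show "0 + x = x" by transfer (rule eq, rule add_0_left)
  show "- x + x = 0" by transfer (rule eq, rule left_minus)
  show "x - y = x + - y" by transfer (rule eq, rule diff_conv_add_uminus)
  show "x * y * z = x * (y * z)" by transfer (rule eq, rule mult.assoc)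
  show "(x + y) * z = x * z + y * z" by transfer (rule eq, rule distrib_right)
  show "x * (y + z) = x * y + x * z" by transfer (rule eq, rule distrib_left)
  show "1 * x = x" by transfer (rule eq, rule mult_1_left)
  show "x * 1 = x" by transfer (rule eq, rule mult_1_right)
qed
end

lift_definition mode_element :: "'h::complex_bilinear_space \<Rightarrow> int \<Rightarrow> 'h mode_algebra"
  is tensor_mode .

lift_definition central_element :: "'h::complex_bilinear_space mode_algebra" is tensor_central .


section \<open>The induced module \<open>V\<close>\<close>

text \<open>\<open>vacuum_action b e\<close>: the element \<open>b\<close> of the subalgebra generated by the positive modes and
  the central element acts on the one-dimensional module \<open>\<complex>\<one>\<close> as multiplication by \<open>e\<close>.\<close>

inductive vacuum_action :: "'h::complex_bilinear_space mode_algebra \<Rightarrow> complex \<Rightarrow> bool" where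
  positive: "m \<ge> 0 \<Longrightarrow> vacuum_action (mode_element a m) 0"
| central: "vacuum_action central_element 1"
| one: "vacuum_action 1 1"
| add: "vacuum_action b e \<Longrightarrow> vacuum_action b' e' \<Longrightarrow> vacuum_action (b + b') (e + e')"
| scale: "vacuum_action b e \<Longrightarrow> vacuum_action (c *\<^sub>C b) (c * e)"
| mult: "vacuum_action b e \<Longrightarrow> vacuum_action b' e' \<Longrightarrow> vacuum_action (b * b') (e * e')"

text \<open>The tensor product over that subalgebra: the free vector space on pairs \<open>(n, z)\<close>, modulo
  bilinearity and the balancing relations \<open>n b \<otimes> z = n \<otimes> b z\<close>.\<close>

definition pure_tensor :: "'h::complex_bilinear_space mode_algebra \<Rightarrow> complex \<Rightarrow>
    'h mode_algebra \<times> complex \<Rightarrow>\<^sub>0 complex"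
  where "pure_tensor n z = Poly_Mapping.single (n, z) 1"

definition induction_relations ::
    "('h::complex_bilinear_space mode_algebra \<times> complex \<Rightarrow>\<^sub>0 complex) set"
  where "induction_relations =
    {pure_tensor (n + n') z - pure_tensor n z - pure_tensor n' z | n n' z. True} \<union>
    {pure_tensor n (z + z') - pure_tensor n z - pure_tensor n z' | n z z'. True} \<union>
    {pure_tensor (c *\<^sub>C n) z - c *\<^sub>C pure_tensor n z | c n z. True} \<union>
    {pure_tensor n (c * z) - c *\<^sub>C pure_tensor n z | c n z. True} \<union>
    {pure_tensor (n * b) z - pure_tensor n (e * z) | n b e z. vacuum_action b e}"

lemma equivp_subspace:
  assumes "complex_vector.subspace S"
  shows "equivp (\<lambda>x y. x - y \<in> S)"
proof (rule equivpI)
  show "reflp (\<lambda>x y. x - y \<in> S)"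
    by (rule reflpI) (simp add: complex_vector.subspace_0[OF assms])
  show "symp (\<lambda>x y. x - y \<in> S)"
    by (rule sympI) (metis complex_vector.subspace_neg[OF assms] minus_diff_eq)
  show "transp (\<lambda>x y. x - y \<in> S)"
    by (rule transpI) (metis complex_vector.subspace_add[OF assms] diff_add_cancel add_diff_eq)
qed

quotient_type (overloaded) 'h fock_space =
  "'h::complex_bilinear_space mode_algebra \<times> complex \<Rightarrow>\<^sub>0 complex" /
  "\<lambda>x y. x - y \<in> complex_vector.span induction_relations"
  by (intro equivp_subspace complex_vector.subspace_span)

lemma span_cong:
  fixes S :: "'a::complex_vector set"
  shows "x = y \<Longrightarrow> x - y \<in> complex_vector.span S"
    and "x - x' \<in> complex_vector.span S \<Longrightarrow> y - y' \<in> complex_vector.span S \<Longrightarrow>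
      (x + y) - (x' + y') \<in> complex_vector.span S"
    and "x - x' \<in> complex_vector.span S \<Longrightarrow> y - y' \<in> complex_vector.span S \<Longrightarrow>
      (x - y) - (x' - y') \<in> complex_vector.span S"
    and "x - x' \<in> complex_vector.span S \<Longrightarrow> (- x) - (- x') \<in> complex_vector.span S"
    and "x - x' \<in> complex_vector.span S \<Longrightarrow> c *\<^sub>C x - c *\<^sub>C x' \<in> complex_vector.span S"
proof -
  show "x - y \<in> complex_vector.span S" if "x = y"
    using that by (simp add: complex_vector.span_zero)
  show "(x + y) - (x' + y') \<in> complex_vector.span S"
    if "x - x' \<in> complex_vector.span S" "y - y' \<in> complex_vector.span S"
    using complex_vector.span_add[OF that] by (simp add: algebra_simps)
  show "(x - y) - (x' - y') \<in> complex_vector.span S"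
    if "x - x' \<in> complex_vector.span S" "y - y' \<in> complex_vector.span S"
    using complex_vector.span_diff[OF that] by (simp add: algebra_simps)
  show "(- x) - (- x') \<in> complex_vector.span S" if "x - x' \<in> complex_vector.span S"
    using complex_vector.span_neg[OF that] by simp
  show "c *\<^sub>C x - c *\<^sub>C x' \<in> complex_vector.span S" if "x - x' \<in> complex_vector.span S"
    using complex_vector.span_scale[OF that, of c]
    by (simp add: complex_vector.scale_right_diff_distrib)
qed

instantiation fock_space :: (complex_bilinear_space) complex_vector
begin
lift_definition zero_fock_space :: "'a fock_space" is 0 .
lift_definition plus_fock_space :: "'a fock_space \<Rightarrow> 'a fock_space \<Rightarrow> 'a fock_space"
  is "(+)" by (rule span_cong)
lift_definition minus_fock_space :: "'a fock_space \<Rightarrow> 'a fock_space \<Rightarrow> 'a fock_space"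
  is "(-)" by (rule span_cong)
lift_definition uminus_fock_space :: "'a fock_space \<Rightarrow> 'a fock_space"
  is uminus by (rule span_cong)
lift_definition scaleC_fock_space :: "complex \<Rightarrow> 'a fock_space \<Rightarrow> 'a fock_space"
  is "(*\<^sub>C)" by (rule span_cong)
instance
proof
  fix x y z :: "'a fock_space" and c d :: complex
  note eq = span_cong(1)
  show "c *\<^sub>C (x + y) = c *\<^sub>C x + c *\<^sub>C y" by transfer (rule eq, rule scaleC_add_right)
  show "(c + d) *\<^sub>C x = c *\<^sub>C x + d *\<^sub>C x" by transfer (rule eq, rule scaleC_add_left)
  show "c *\<^sub>C d *\<^sub>C x = (c * d) *\<^sub>C x" by transfer (rule eq, rule scaleC_scaleC)
  show "1 *\<^sub>C x = x" by transfer (rule eq, rule scaleC_one)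
  show "x + y + z = x + (y + z)" by transfer (rule eq, rule add.assoc)
  show "x + y = y + x" by transfer (rule eq, rule add.commute)
  show "0 + x = x" by transfer (rule eq, rule add_0_left)
  show "- x + x = 0" by transfer (rule eq, rule left_minus)
  show "x - y = x + - y" by transfer (rule eq, rule diff_conv_add_uminus)
qed
end

definition left_mult :: "'h::complex_bilinear_space mode_algebra \<Rightarrow>
    ('h mode_algebra \<times> complex \<Rightarrow>\<^sub>0 complex) \<Rightarrow> 'h mode_algebra \<times> complex \<Rightarrow>\<^sub>0 complex"
  where "left_mult a p =
    (\<Sum>x\<in>Poly_Mapping.keys p. Poly_Mapping.lookup p x *\<^sub>C pure_tensor (a * fst x) (snd x))"

lemma left_mult_superset:
  assumes "finite A" "Poly_Mapping.keys p \<subseteq> A"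
  shows "left_mult a p = (\<Sum>x\<in>A. Poly_Mapping.lookup p x *\<^sub>C pure_tensor (a * fst x) (snd x))"
  unfolding left_mult_def using assms
  by (intro sum.mono_neutral_left) (auto simp: in_keys_iff)

lemma left_mult_pure: "left_mult a (pure_tensor n z) = pure_tensor (a * n) z"
  by (simp add: left_mult_def) (simp add: pure_tensor_def)

lemma clinear_left_mult: "clinear (left_mult a)"
proof (unfold_locales, goal_cases)
  case (1 p q)
  let ?A = "Poly_Mapping.keys p \<union> Poly_Mapping.keys q"
  have "finite ?A" "Poly_Mapping.keys (p + q) \<subseteq> ?A"
    by (auto dest: subsetD[OF keys_add])
  then show ?case
    by (simp add: left_mult_superset[of ?A] lookup_add scaleC_add_left sum.distrib)
next
  case (2 c p)
  have "Poly_Mapping.keys (c *\<^sub>C p) \<subseteq> Poly_Mapping.keys p"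
    by (auto simp: in_keys_iff)
  then show ?case
    by (simp add: left_mult_superset[of "Poly_Mapping.keys p"]
        complex_vector.scale_sum_right scaleC_complex_def)
qed

lemma left_mult_span:
  assumes "p \<in> complex_vector.span induction_relations"
  shows "left_mult a p \<in> complex_vector.span induction_relations"
proof -
  interpret l: Vector_Spaces.linear "(*\<^sub>C)" "(*\<^sub>C)" "left_mult a"
    by (rule clinear_left_mult)
  have "left_mult a r \<in> induction_relations" if "r \<in> induction_relations" for r
    using that unfolding induction_relations_def
    by (auto simp: l.diff l.scale left_mult_pure distrib_left scaleC_mult_right mult.assoc[symmetric])
      blast+
  then have "left_mult a ` induction_relations \<subseteq> induction_relations" by blast
  then show ?thesis
    using assms l.span_image[of induction_relations] complex_vector.span_mono by blast
qed

lift_definition action :: "'h::complex_bilinear_space mode_algebra \<Rightarrow> 'h fock_space \<Rightarrow> 'h fock_space"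
  is left_mult
proof -
  fix a :: "'h mode_algebra" and p q
  interpret l: Vector_Spaces.linear "(*\<^sub>C)" "(*\<^sub>C)" "left_mult a"
    by (rule clinear_left_mult)
  show "left_mult a p - left_mult a q \<in> complex_vector.span induction_relations"
    if "p - q \<in> complex_vector.span induction_relations"
    using left_mult_span[OF that, of a] by (simp add: l.diff)
qed

lift_definition vacuum :: "'h::complex_bilinear_space fock_space" is "pure_tensor 1 1" .

text \<open>\<open>mode h m\<close> is the operator \<open>h(m + 1/2)\<close>.\<close>

definition mode :: "'h::complex_bilinear_space \<Rightarrow> int \<Rightarrow> 'h fock_space \<Rightarrow> 'h fock_space"
  where "mode h m = action (mode_element h m)"

definition state :: "('h::complex_bilinear_space \<times> nat) list \<Rightarrow> 'h fock_space"
  where "state hs = foldr (\<lambda>(h, m). mode h (- int m - 1)) hs vacuum"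


section \<open>Normal ordering and the vertex operators\<close>

text \<open>The permutation moving the negative modes (\<open>n < 0\<close>) to the left of the positive modes
  (\<open>n \<ge> 0\<close>), keeping the relative order within both groups. Positions are counted from \<open>0\<close>.\<close>

definition normal_perm :: "int list \<Rightarrow> nat \<Rightarrow> nat"
  where "normal_perm ns = (THE \<sigma>. \<sigma> permutes {..<length ns} \<and>
    (\<forall>i j. i < j \<and> j < length ns \<longrightarrow>
      (ns ! \<sigma> i < 0 \<and> ns ! \<sigma> j \<ge> 0) \<or> ((ns ! \<sigma> i < 0 \<longleftrightarrow> ns ! \<sigma> j < 0) \<and> \<sigma> i < \<sigma> j)))"

definition normal_ordered_modes ::
    "'h::complex_bilinear_space list \<Rightarrow> int list \<Rightarrow> 'h fock_space \<Rightarrow> 'h fock_space"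
  where "normal_ordered_modes hs ns v =
    (let \<sigma> = normal_perm ns in
      of_int (sign \<sigma>) *\<^sub>C foldr (\<lambda>i. mode (hs ! \<sigma> i) (ns ! \<sigma> i)) [0..<length ns] v)"

text \<open>A formal series in variables of type \<open>'x\<close> whose coefficients are operators on \<open>V\<close> is
  represented by its coefficient function; a monomial is given by its exponents \<open>'x \<Rightarrow> int\<close>.
  The entries \<open>(h, m, x)\<close> of \<open>fs\<close> are the factors \<open>h\<^bsup>(m)\<^esup>(x)\<close>. For every vector \<open>v\<close> only
  finitely many \<open>ns\<close> contribute to a given coefficient.\<close>

definition normal_ordered_product ::
    "('h::complex_bilinear_space \<times> nat \<times> 'x) list \<Rightarrow> ('x \<Rightarrow> int) \<Rightarrow> 'h fock_space \<Rightarrow> 'h fock_space"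
  where "normal_ordered_product fs e v =
    Sum_any (\<lambda>ns.
      if length ns = length fs \<and>
        (\<forall>x. (\<Sum>i | i < length fs \<and> snd (snd (fs ! i)) = x. - ns ! i - int (fst (snd (fs ! i))) - 1) = e x)
      then (\<Prod>i<length fs. of_int (- ns ! i - 1) gchoose fst (snd (fs ! i))) *\<^sub>C
        normal_ordered_modes (map fst fs) ns v
      else 0)"

text \<open>\<open>vertex_operator u k\<close> is the coefficient of \<open>x\<^sup>k\<close> in \<open>Y(u, x)\<close>. The description determines
  it because the vectors \<open>state hs\<close> span \<open>V\<close>.\<close>

definition vertex_operator ::
    "'h::complex_bilinear_space fock_space \<Rightarrow> int \<Rightarrow> 'h fock_space \<Rightarrow> 'h fock_space"
  where "vertex_operator = (THE Y.
    (\<forall>k v. clinear (\<lambda>u. Y u k v)) \<and>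
    (\<forall>hs k v. Y (state hs) k v =
      normal_ordered_product (map (\<lambda>(h, m). (h, m, ())) hs) (\<lambda>_. k) v))"


section \<open>Two-variable series\<close>

datatype formal_variable = Var_x | Var_y

abbreviation monomial_xy :: "int \<Rightarrow> int \<Rightarrow> formal_variable \<Rightarrow> int"
  where "monomial_xy k l \<equiv> case_formal_variable k l"

text \<open>Scalar series are elements of \<open>\<complex>((x))[[y]]\<close>: the outer power series is in \<open>y\<close>, its
  coefficients are Laurent series in \<open>x\<close>. \<open>iota_xy_power t\<close> expands \<open>(x - y)\<^bsup>-t\<^esup>\<close> (used for
  \<open>t \<ge> 1\<close>).\<close>

definition iota_xy_power :: "nat \<Rightarrow> complex fls fps"
  where "iota_xy_power t =
    Abs_fps (\<lambda>i. fls_const (of_nat ((t + i - 1) choose i)) * fls_X_intpow (- int t - int i))"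

definition scalar_xy :: "complex \<Rightarrow> complex fls fps"
  where "scalar_xy c = fps_const (fls_const c)"

definition iota_xy_f :: "nat \<Rightarrow> nat \<Rightarrow> complex fls fps"
  where "iota_xy_f m n = scalar_xy (of_int (- int n - 1) gchoose m) * iota_xy_power (m + n + 1)"

text \<open>The coefficient of \<open>x\<^sup>k y\<^sup>l\<close> in the product of a scalar series with an operator series.\<close>

definition series_times :: "complex fls fps \<Rightarrow>
    ((formal_variable \<Rightarrow> int) \<Rightarrow> 'h::complex_bilinear_space fock_space \<Rightarrow> 'h fock_space) \<Rightarrow>
    (formal_variable \<Rightarrow> int) \<Rightarrow> 'h fock_space \<Rightarrow> 'h fock_space"
  where "series_times F A e v =
    Sum_any (\<lambda>(i::int, j::nat). fls_nth (fps_nth F j) i *\<^sub>C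
      A (monomial_xy (e Var_x - i) (e Var_y - int j)) v)"

text \<open>The strictly increasing index tuples \<open>1 \<le> i\<^sub>1 < \<dots> < i\<^sub>\<rho> \<le> r\<close>.\<close>

definition index_tuples :: "nat \<Rightarrow> nat \<Rightarrow> nat list set"
  where "index_tuples \<rho> r = {is. length is = \<rho> \<and> sorted_wrt (<) is \<and> set is \<subseteq> {1..r}}"

end

theory Submission
  imports Defs "HOL-Library.Function_Algebras"
begin

text \<open>Multiplying a normal-ordered product of modes by one further mode from the left gives the longer
  normal-ordered product plus the contractions of that mode with the factors. Iterating this gives
  Wick's theorem for modes: a product of two normal-ordered products is a signed sum over partial
  matchings, and grouping the matchings by their sets of matched indices turns the sum into
  determinants by Laplace expansion. Positive modes do not anticommute with each other, nor do
  negative ones, but only the relation between a positive and a negative mode is used.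

  To pass to formal series, the modes \<open>n + 1/2\<close> are restricted to \<open>- K \<le> n \<le> K\<close>. Then all sums are
  finite, Wick's theorem is multilinear in the factors, and the contraction of two factors is a truncation of
  \<open>(a, b) \<iota> f\<^sub>m\<^sub>n\<close>. Since a given vector is annihilated by all large positive modes, each fixed coefficient
  of either side of the identity is independent of \<open>K\<close> for large \<open>K\<close>.

  The operator \<open>Y\<close> is well defined because \<open>V\<close> has no relations between the spanning vectors beyond
  multilinearity; this is seen by letting the algebra act on \<open>T(\<hh>\<^sup>-)\<close>, with the positive modes acting as
  skew derivations.\<close>

section \<open>Signed sums over partial matchings\<close>

text \<open>The sum over matchings is formed in a module over an arbitrary commutative ring because
  it is needed twice: over the complex numbers for operators on \<open>V\<close>, and over the
  Laurent polynomials in x and y for truncated series. A Laurent polynomial multiplies any two-sided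
  series by a finite convolution, while two such series cannot be multiplied with each other; this
  is the obstacle that truncation removes. The truncated determinants are Laurent polynomials, those
  of the statement lie in C((x))[[y]], and the two are compared in C((x))((y)).

  Origin of the sign: the contraction of the i-th letter of A passes the r - i letters behind it, in
  total (-1)^(r \<rho> + sum of the i). If the partners in B are deleted from left to right, the
  l-th one has lost l - 1 predecessors and stands at the zero-based position j_l - l, in total
  (-1)^(sum of the j + \<rho>(\<rho> + 1)/2). The other matchings of the same index sets differ by
  the sign of a permutation, and this produces the determinant.\<close>

lemma sorted_list_of_set_insert_less:
  assumes "finite K" "\<And>k. k \<in> K \<Longrightarrow> b < k"
  shows "sorted_list_of_set (insert b K) = b # sorted_list_of_set K"
  using assms by (subst sorted_list_of_set_insert)
    (auto intro!: insort_is_Cons less_imp_le dest: assms(2))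

text \<open>Laplace expansion along the first row. The columns are given by a set, so that deleting
  one needs no renumbering; \<open>rdet_eq_det\<close> makes the link to \<open>det\<close>.\<close>

primrec rdet :: "('f \<Rightarrow> 'i::linorder \<Rightarrow> 'a::comm_ring_1) \<Rightarrow> 'f list \<Rightarrow> 'i set \<Rightarrow> 'a"
  where "rdet C [] T = 1"
  | "rdet C (i # is) T =
      (\<Sum>j\<in>T. (-1) ^ card {j'\<in>T. j' < j} * C i j * rdet C is (T - {j}))"

locale contraction = Modules.module scale
  for scale :: "'a::comm_ring_1 \<Rightarrow> 'b::ab_group_add \<Rightarrow> 'b"
begin

text \<open>A skew derivation on words. The word that remains is handed to the continuation
  \<open>F\<close> with values in the module, which avoids formal sums of words.\<close>

primrec del :: "('f \<Rightarrow> 'a) \<Rightarrow> 'f list \<Rightarrow> ('f list \<Rightarrow> 'b) \<Rightarrow> 'b"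
  where "del \<phi> [] F = 0"
  | "del \<phi> (b # B) F = scale (\<phi> b) (F B) - del \<phi> B (\<lambda>X. F (b # X))"

text \<open>\<open>contr C A G B\<close> sums over all partial matchings of the letters of \<open>A\<close> with letters of \<open>B\<close>, with
  \<open>G\<close> applied to the unmatched letters; the recursion chooses the partner of the first letter of \<open>A\<close>.\<close>

primrec contr :: "('f \<Rightarrow> 'g \<Rightarrow> 'a) \<Rightarrow> 'f list \<Rightarrow> ('f list \<Rightarrow> 'g list \<Rightarrow> 'b) \<Rightarrow> 'g list \<Rightarrow> 'b"
  where "contr C [] G B = G [] B"
  | "contr C (h # A) G B =
      contr C A (\<lambda>X. G (h # X)) B + scale ((-1) ^ length A) (del (C h) B (contr C A G))"

lemma del_add: "del \<phi> B (\<lambda>X. F X + G X) = del \<phi> B F + del \<phi> B G"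
  by (induction B arbitrary: F G) (simp_all add: scale_right_distrib)

lemma del_scale: "del \<phi> B (\<lambda>X. scale c (F X)) = scale c (del \<phi> B F)"
  by (induction B arbitrary: F) (simp_all add: scale_right_diff_distrib mult.commute)

lemma del_minus: "del \<phi> B (\<lambda>X. - F X) = - del \<phi> B F"
  by (induction B arbitrary: F) simp_all

lemma del_diff: "del \<phi> B (\<lambda>X. F X - G X) = del \<phi> B F - del \<phi> B G"
  by (induction B arbitrary: F G) (simp_all add: scale_right_diff_distrib)

lemma del_cong: "(\<And>X. Suc (length X) = length B \<Longrightarrow> F X = G X) \<Longrightarrow> del \<phi> B F = del \<phi> B G"
proof (induction B arbitrary: F G)
  case (Cons b B)
  have "del \<phi> B (\<lambda>X. F (b # X)) = del \<phi> B (\<lambda>X. G (b # X))"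
    by (rule Cons.IH) (simp add: Cons.prems)
  then show ?case by (simp add: Cons.prems)
qed simp

lemma del_swap: "del \<phi> A (\<lambda>Z. del \<psi> B (\<lambda>Y. H Z Y)) = del \<psi> B (\<lambda>Y. del \<phi> A (\<lambda>Z. H Z Y))"
  by (induction B arbitrary: H) (simp_all add: del_diff del_scale, induction A, simp_all)

lemma del_append: "del \<phi> (X @ Y) F =
    del \<phi> X (\<lambda>X'. F (X' @ Y)) + scale ((-1) ^ length X) (del \<phi> Y (\<lambda>Y'. F (X @ Y')))"
  by (induction X arbitrary: F) (simp_all add: algebra_simps)

text \<open>When two letters are deleted, the right one loses a predecessor only if the left one
  goes first; the two orders therefore have opposite signs.\<close>

lemma del_anticommute: "del \<phi> B (\<lambda>Y. del \<psi> Y F) = - del \<psi> B (\<lambda>Y. del \<phi> Y F)"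
  by (induction B arbitrary: F) (simp_all add: del_diff del_scale algebra_simps)

lemma del_linear_image:
  assumes "\<And>x y. T (x - y) = T x - T y" "\<And>c x. T (scale c x) = scale c (T x)"
  shows "T (del \<phi> B F) = del \<phi> B (\<lambda>X. T (F X))"
proof (induction B arbitrary: F)
  case Nil
  show ?case using assms(1)[of 0 0] by simp
qed (simp add: assms)

lemma contr_add: "contr C A (\<lambda>X Y. G X Y + H X Y) B = contr C A G B + contr C A H B"
proof (induction A arbitrary: G H B)
  case (Cons h A)
  have "contr C A (\<lambda>X Y. G X Y + H X Y) = (\<lambda>Y. contr C A G Y + contr C A H Y)"
    by (rule ext) (rule Cons)
  then show ?case by (simp add: Cons del_add scale_right_distrib)
qed simp

lemma contr_linear_image:
  assumes "\<And>x y. T (x + y) = T x + T y" "\<And>x y. T (x - y) = T x - T y"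
    "\<And>c x. T (scale c x) = scale c (T x)"
  shows "T (contr C A G B) = contr C A (\<lambda>X Y. T (G X Y)) B"
proof (induction A arbitrary: G B)
  case (Cons h A)
  show ?case by (simp add: Cons assms del_linear_image[where T = T])
qed simp

lemma contr_uminus: "contr C A (\<lambda>X Y. - G X Y) B = - contr C A G B"
  using contr_linear_image[of uminus C A G B] by simp

lemma contr_scale: "contr C A (\<lambda>X Y. scale c (G X Y)) B = scale c (contr C A G B)"
  using contr_linear_image[of "scale c" C A G B]
  by (simp add: scale_right_distrib scale_right_diff_distrib mult.commute)

lemma contr_diff: "contr C A (\<lambda>X Y. G X Y - H X Y) B = contr C A G B - contr C A H B"
  using contr_add[of C A G "\<lambda>X Y. - H X Y" B] by (simp add: contr_uminus)

text \<open>The sign of a contraction counts the letters behind it. If one of these has been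
  deleted, the sign changes, and this compensates the minus sign that \<open>del\<close> puts on the
  tail.\<close>

lemma contr_del_left:
  "contr C A (\<lambda>X Y. del \<phi> X (\<lambda>Z. G Z Y)) B = del \<phi> A (\<lambda>Z. contr C Z G B)"
proof (induction A arbitrary: G B)
  case (Cons a A)
  have "scale ((-1) ^ length Z) x = scale ((-1) ^ length A) (- x)"
    if "Suc (length Z) = length A" for Z :: "'c list" and x
    by (simp flip: that)
  then have "del \<phi> A (\<lambda>Z. scale ((-1) ^ length Z) (del (C a) B (contr C Z G)))
      = del \<phi> A (\<lambda>Z. scale ((-1) ^ length A) (- del (C a) B (contr C Z G)))"
    by (intro del_cong)
  also have "\<dots> = - scale ((-1) ^ length A) (del (C a) B (\<lambda>Y. del \<phi> A (\<lambda>Z. contr C Z G Y)))"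
    by (simp add: del_scale del_minus) (subst del_swap, rule refl)
  finally have *: "del \<phi> (a # A) (\<lambda>Z. contr C Z G B) = scale (\<phi> a) (contr C A G B)
      - del \<phi> A (\<lambda>Z. contr C Z (\<lambda>X. G (a # X)) B)
      + scale ((-1) ^ length A) (del (C a) B (\<lambda>Y. del \<phi> A (\<lambda>Z. contr C Z G Y)))"
    unfolding del.simps contr.simps del_add by simp
  have "contr C A (\<lambda>X Y. del \<phi> X (\<lambda>Z. G Z Y)) = (\<lambda>Y. del \<phi> A (\<lambda>Z. contr C Z G Y))"
    by (rule ext) (rule Cons)
  then show ?case
    unfolding * by (simp add: contr_diff contr_scale Cons)
qed simp

text \<open>Each contraction shortens \<open>X\<close> by one letter and exchanges two deletions in
  the right word. The factor with \<open>length X\<close> is there to make these two signs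
  cancel.\<close>

lemma contr_del_right:
  "contr C A (\<lambda>X Y. scale ((-1) ^ length X) (del \<phi> Y (G X))) B =
    scale ((-1) ^ length A) (del \<phi> B (contr C A G))"
proof (induction A arbitrary: G B)
  case Nil
  have "contr C [] G = G []" by (rule ext) simp
  then show ?case by simp
next
  case (Cons a A)
  let ?s = "(-1) ^ length A"
  have C1: "contr C (a # A) G =
      (\<lambda>Y. contr C A (\<lambda>X. G (a # X)) Y + scale ?s (del (C a) Y (contr C A G)))"
    by (rule ext) simp
  have C2: "contr C A (\<lambda>X Y. scale ((-1) ^ length X) (del \<phi> Y (G X))) =
      (\<lambda>Y. scale ?s (del \<phi> Y (contr C A G)))"
    by (rule ext) (rule Cons)
  have "contr C A (\<lambda>X Y. scale ((-1) ^ length (a # X)) (del \<phi> Y (G (a # X)))) B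
      = contr C A (\<lambda>X Y. - scale ((-1) ^ length X) (del \<phi> Y (G (a # X)))) B"
    by simp
  also have "\<dots> = - scale ?s (del \<phi> B (contr C A (\<lambda>X. G (a # X))))"
    by (simp only: contr_uminus Cons)
  finally have "contr C (a # A) (\<lambda>X Y. scale ((-1) ^ length X) (del \<phi> Y (G X))) B =
      - scale ?s (del \<phi> B (contr C A (\<lambda>X. G (a # X))))
      + scale ?s (scale ?s (del (C a) B (\<lambda>Y. del \<phi> Y (contr C A G))))"
    by (simp only: contr.simps C2 del_scale)
  also have "\<dots> = scale ((-1) ^ length (a # A)) (del \<phi> B (contr C (a # A) G))"
    unfolding C1 del_add del_scale del_anticommute[of "C a" B \<phi>]
    by (simp add: scale_right_distrib)
  finally show ?case .
qed

text \<open>The recursion for \<open>nord\<close> expresses the full product \<open>h \<sqdot> nord A\<close> as the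
  normal-ordered product plus the contractions of \<open>h\<close> with the factors of \<open>A\<close>; the contractions
  within \<open>A\<close> cancel in the product with \<open>nord B\<close>.\<close>

lemma wick_contr:
  assumes act: "\<And>h x y. act h (x + y) = act h x + act h y"
    "\<And>h x y. act h (x - y) = act h x - act h y"
    "\<And>h c x. act h (scale c x) = scale c (act h x)"
    and Nil: "\<And>w. nord [] w = w"
    and Cons: "\<And>h A w. nord (h # A) w = act h (nord A w) - del (C h) A (\<lambda>X. nord X w)"
  shows "nord A (nord B w) = contr C A (\<lambda>X Y. nord (X @ Y) w) B"
\<comment> \<open>Structural induction is too weak: the recursion for \<open>nord\<close> also
  deletes a letter from the tail, and the hypothesis is applied to the words that remain.\<close>
proof (induction A rule: length_induct)
  case (1 A)
  show ?case
  proof (cases A)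
    case (Cons h A')
    let ?G = "\<lambda>X Y. nord (X @ Y) w"
    have IH: "nord X (nord B w) = contr C X ?G B" if "length X < length A" for X
      using 1 that by blast
    have "act h (?G X Y) = ?G (h # X) Y + del (C h) X (\<lambda>Z. ?G Z Y)
        + scale ((-1) ^ length X) (del (C h) Y (?G X))" for X Y
      using assms(5)[of h "X @ Y" w] by (simp add: del_append algebra_simps)
    then have *: "act h (contr C A' ?G B) = contr C A' (\<lambda>X. ?G (h # X)) B
        + del (C h) A' (\<lambda>Z. contr C Z ?G B) + scale ((-1) ^ length A') (del (C h) B (contr C A' ?G))"
      by (simp only: contr_linear_image[where T = "act h", OF act] contr_add contr_del_left contr_del_right)
    have "del (C h) A' (\<lambda>X. nord X (nord B w)) = del (C h) A' (\<lambda>Z. contr C Z ?G B)"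
      by (rule del_cong) (simp add: IH Cons)
    then show ?thesis
      using * by (simp add: Cons assms(5)[of h A'] IH)
  qed (simp add: Nil)
qed

lemma del_sorted_list_of_set:
  assumes "finite J"
  shows "del \<phi> (sorted_list_of_set J) F =
    (\<Sum>j\<in>J. scale ((-1) ^ card {j'\<in>J. j' < j} * \<phi> j) (F (sorted_list_of_set (J - {j}))))"
  using assms
proof (induction J arbitrary: F rule: finite_linorder_min_induct)
  case (insert b J)
  have b: "b \<notin> J" using insert by auto
  have sl: "sorted_list_of_set (insert b K) = b # sorted_list_of_set K" if "K \<subseteq> J" for K
    using that insert finite_subset[OF that]
    by (intro sorted_list_of_set_insert_less) auto
  have z: "card {j'\<in>insert b J. j' < b} = 0"
    using insert by (auto simp: card_eq_0_iff)
  have "card {j'\<in>insert b J. j' < j} = Suc (card {j'\<in>J. j' < j})" if "j \<in> J" for j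
  proof -
    have "{j'\<in>insert b J. j' < j} = insert b {j'\<in>J. j' < j}" using that insert by auto
    then show ?thesis using insert b by simp
  qed
  moreover have "sorted_list_of_set (insert b J - {j}) = b # sorted_list_of_set (J - {j})"
    if "j \<in> J" for j
  proof -
    have "insert b J - {j} = insert b (J - {j})" using that b by auto
    then show ?thesis using sl[of "J - {j}"] by auto
  qed
  ultimately have "(\<Sum>j\<in>J. scale ((-1) ^ card {j'\<in>insert b J. j' < j} * \<phi> j)
        (F (sorted_list_of_set (insert b J - {j})))) =
      (\<Sum>j\<in>J. - scale ((-1) ^ card {j'\<in>J. j' < j} * \<phi> j) (F (b # sorted_list_of_set (J - {j}))))"
    by (intro sum.cong refl) (simp only:, simp)
  moreover have "insert b J - {b} = J" using b by auto
  ultimately show ?case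
    unfolding sum.insert[OF insert.hyps(1) b] sl[OF order.refl] del.simps insert.IH z
    by (simp only:) (simp add: sum_negf)
qed simp

end

text \<open>Positions are counted from 0. For \<open>{1..r}\<close> the value is smaller by
  \<open>card S\<close> than the sum of the indices; rows and columns lose the same amount, so no
  sign changes.\<close>

definition set_position :: "'i::linorder set \<Rightarrow> 'i set \<Rightarrow> nat"
  where "set_position I S = (\<Sum>i\<in>S. card {i'\<in>I. i' < i})"

lemma set_position_insert_min:
  assumes "finite I" "\<And>i'. i' \<in> I \<Longrightarrow> i < i'" "S \<subseteq> I"
  shows "set_position (insert i I) S = set_position I S + card S"
    "set_position (insert i I) (insert i S) = set_position I S + card S"
proof -
  have i: "i \<notin> I" using assms(2) by auto
  have S: "finite S" "i \<notin> S" using assms i finite_subset by auto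
  have "card {i'\<in>insert i I. i' < x} = Suc (card {i'\<in>I. i' < x})" if "x \<in> S" for x
  proof -
    have "{i'\<in>insert i I. i' < x} = insert i {i'\<in>I. i' < x}" using that assms by auto
    then show ?thesis using assms i by simp
  qed
  then show *: "set_position (insert i I) S = set_position I S + card S"
    by (simp add: set_position_def sum_Suc)
  have "card {i'\<in>insert i I. i' < i} = 0"
    using assms by (auto simp: card_eq_0_iff dest: order.asym)
  then show "set_position (insert i I) (insert i S) = set_position I S + card S"
    using * S by (simp add: set_position_def)
qed

text \<open>Removing \<open>j\<close> from \<open>T\<close> moves the elements of \<open>T\<close> above \<open>j\<close> down by one; together with the
  elements below \<open>j\<close>, which determine the Laplace sign, these are all of \<open>T - {j}\<close>.\<close>

lemma set_position_remove:
  fixes J :: "'i::linorder set"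
  assumes "finite J" "T \<subseteq> J" "j \<in> T"
  shows "set_position J T + card {j'\<in>T. j' < j} =
    set_position (J - {j}) (T - {j}) + card {j'\<in>J. j' < j} + (card T - 1)"
proof -
  have T: "finite T" using assms finite_subset by blast
  have "card {i'\<in>J. i' < x} = card {i'\<in>J - {j}. i' < x} + of_bool (j < x)" for x
  proof (cases "j < x")
    case True
    then have "{i'\<in>J. i' < x} = insert j {i'\<in>J - {j}. i' < x}" using assms by auto
    then show ?thesis using True assms by simp
  next
    case False
    then have "{i'\<in>J. i' < x} = {i'\<in>J - {j}. i' < x}" by auto
    then show ?thesis using False by simp
  qed
  then have "set_position J T = card {j'\<in>J. j' < j}
      + (\<Sum>x\<in>T - {j}. card {i'\<in>J - {j}. i' < x} + of_bool (j < x))"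
    using T assms by (simp add: set_position_def sum.remove[of T j])
  also have "\<dots> = card {j'\<in>J. j' < j} + set_position (J - {j}) (T - {j}) + card {x\<in>T - {j}. j < x}"
    using T by (simp add: sum.distrib set_position_def Int_def)
  finally have "set_position J T + card {j'\<in>T. j' < j} = set_position (J - {j}) (T - {j})
      + card {j'\<in>J. j' < j} + (card {x\<in>T - {j}. j < x} + card {x\<in>T - {j}. x < j})"
    by (auto intro: arg_cong[where f = card])
  also have "card {x\<in>T - {j}. j < x} + card {x\<in>T - {j}. x < j} = card (T - {j})"
    using T by (subst card_Un_disjoint[symmetric]) (auto intro!: arg_cong[where f = card])
  finally show ?thesis using T assms by simp
qed

context contraction
begin

text \<open>The least index \<open>i\<close> of \<open>I\<close> is unmatched or matched with some
  \<open>j\<close>. In the second case, exchanging the sums over \<open>T\<close> and over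
  \<open>j\<close> in \<open>T\<close> turns the Laplace expansion of \<open>rdet\<close> along the
  row of \<open>i\<close> into the recursion of \<open>contr\<close>.\<close>

lemma contr_sorted_list_of_set:
  fixes C :: "'i::linorder \<Rightarrow> 'j::linorder \<Rightarrow> 'a"
  assumes "finite I" "finite J"
  shows "contr C (sorted_list_of_set I) G (sorted_list_of_set J) =
    (\<Sum>S\<in>Pow I. \<Sum>T | T \<subseteq> J \<and> card T = card S.
      scale ((-1) ^ (set_position I S + set_position J T + card I * card S + card S * (card S + 1) div 2)
          * rdet C (sorted_list_of_set S) T)
        (G (sorted_list_of_set (I - S)) (sorted_list_of_set (J - T))))"
  using assms
proof (induction I arbitrary: G J rule: finite_linorder_min_induct)
  case empty
  have "{T. T \<subseteq> J \<and> card T = 0} = {{}}" using empty finite_subset by fastforce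
  then show ?case by (simp add: set_position_def)
next
  case (insert i I)
  let ?sl = "sorted_list_of_set :: 'i set \<Rightarrow> _" and ?sl' = "sorted_list_of_set :: 'j set \<Rightarrow> _"
  let ?e = "\<lambda>I J S T. set_position I S + set_position J T + card I * card S + card S * (card S +
      1) div 2"
  let ?t = "\<lambda>I J S T. scale ((-1) ^ ?e I J S T * rdet C (?sl S) T) (G (?sl (I - S)) (?sl' (J - T)))"
  have i: "i \<notin> I" using insert by auto
  have sl: "?sl (insert i K) = i # ?sl K" if "K \<subseteq> I" for K
    using that insert finite_subset[OF that]
    by (intro sorted_list_of_set_insert_less) auto
  have Pow: "(\<Sum>S\<in>Pow (insert i I). f S) = (\<Sum>S\<in>Pow I. f S) + (\<Sum>S\<in>Pow I. f (insert i S))"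
    for f :: "'i set \<Rightarrow> 'b"
  proof -
    have "inj_on (insert i) (Pow I)" using i by (auto simp: inj_on_def)
    then show ?thesis
      using insert i unfolding Pow_insert
      by (subst sum.union_disjoint) (auto simp: sum.reindex)
  qed
  have "contr C (?sl I) (\<lambda>X. G (i # X)) (?sl' J) =
      (\<Sum>S\<in>Pow I. \<Sum>T | T \<subseteq> J \<and> card T = card S. ?t (insert i I) J S T)"
    unfolding insert.IH[OF insert.prems]
  proof (intro sum.cong refl, goal_cases)
    case (1 S T)
    then have "set_position (insert i I) S = set_position I S + card S"
      using set_position_insert_min(1)[of I i S] insert by auto
    moreover have "card (insert i I) = Suc (card I)" using insert i by simp
    moreover have "insert i I - S = insert i (I - S)" using 1 i by auto
    \<comment> \<open>The positions and the product \<open>card I * card S\<close> both grow by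
      \<open>card S\<close>, so the sign stays the same.\<close>
    ultimately have "?e (insert i I) J S T = ?e I J S T + 2 * card S"
      and "?sl (insert i I - S) = i # ?sl (I - S)"
      using sl[of "I - S"] by auto
    then show ?case by (simp only: power_add) (simp add: power_mult)
  qed
  moreover have "scale ((-1) ^ card I) (del (C i) (?sl' J) (contr C (?sl I) G)) =
      (\<Sum>S\<in>Pow I. \<Sum>T | T \<subseteq> J \<and> card T = card (insert i S). ?t (insert i I) J (insert i S) T)"
  proof -
    let ?u = "\<lambda>S T j. scale ((-1) ^ (?e (insert i I) J (insert i S) T + card {j'\<in>T. j' < j}) * C i j *
        rdet C (?sl S) (T - {j})) (G (?sl (I - S)) (?sl' (J - T)))"
    have "?t (insert i I) J (insert i S) T = (\<Sum>j\<in>T. ?u S T j)" if "S \<in> Pow I" for S T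
    proof -
      have "insert i I - insert i S = I - S" using i by auto
      then show ?thesis
        using that by (simp add: sl sum_distrib_left scale_sum_left power_add mult.assoc)
    qed
    then have "(\<Sum>S\<in>Pow I. \<Sum>T | T \<subseteq> J \<and> card T = card (insert i S). ?t (insert i I) J (insert i S) T)
      = (\<Sum>S\<in>Pow I. \<Sum>T | T \<subseteq> J \<and> card T = card (insert i S). \<Sum>j\<in>T. ?u S T j)"
      by simp
    also have "\<dots> = (\<Sum>S\<in>Pow I. \<Sum>j\<in>J. \<Sum>T | T \<subseteq> J - {j} \<and> card T = card S. ?u S (insert j T) j)"
    proof (intro sum.cong refl)
      fix S assume S: "S \<in> Pow I"
      have cS: "card (insert i S) = Suc (card S)"
        using S i insert finite_subset[of S I] by (subst card_insert_disjoint) auto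
      have fin: "finite {T. T \<subseteq> K \<and> P T}" if "finite K" for K :: "'j set" and P
        using that by (rule finite_subset[rotated, OF finite_Pow_iff[THEN iffD2]]) auto
      have fT: "finite T" if "T \<subseteq> J" for T
        using that insert.prems finite_subset by blast
      have cT: "card (insert j T) = Suc (card T)" if "T \<subseteq> J - {j}" for j T
        using that fT[of T] by (subst card_insert_disjoint) auto
      have "(\<Sum>T | T \<subseteq> J \<and> card T = card (insert i S). \<Sum>j\<in>T. ?u S T j) =
        (\<Sum>(T, j)\<in>(SIGMA T:{T. T \<subseteq> J \<and> card T = card (insert i S)}. T). ?u S T j)"
        using fin[OF insert.prems] fT by (subst sum.Sigma) auto
      also have "\<dots> = (\<Sum>(j, T)\<in>(SIGMA j:J. {T. T \<subseteq> J - {j} \<and> card T = card S}). ?u S (insert j T) j)"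
      proof (rule sum.reindex_bij_witness[where
            j = "\<lambda>(T, j). (j, T - {j})" and i = "\<lambda>(j, T). (insert j T, j)"], goal_cases)
        case (5 a)
        obtain T j where a: "a = (T, j)" by (cases a)
        with 5 have "insert j (T - {j}) = T" by auto
        then show ?case by (simp only: a prod.case)
      qed (use fT cS cT in \<open>auto simp: insert_absorb card_Diff_singleton\<close>)
      also have "\<dots> = (\<Sum>j\<in>J. \<Sum>T | T \<subseteq> J - {j} \<and> card T = card S. ?u S (insert j T) j)"
        using fin[of "J - {_}"] insert.prems by (subst sum.Sigma) auto
      finally show "(\<Sum>T | T \<subseteq> J \<and> card T = card (insert i S). \<Sum>j\<in>T. ?u S T j) =
        (\<Sum>j\<in>J. \<Sum>T | T \<subseteq> J - {j} \<and> card T = card S. ?u S (insert j T) j)" .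
    qed
    also have "\<dots> = (\<Sum>j\<in>J. \<Sum>S\<in>Pow I. \<Sum>T | T \<subseteq> J - {j} \<and> card T = card S. ?u S (insert j T) j)"
      by (rule sum.swap)
    also have "\<dots> = (\<Sum>j\<in>J. scale ((-1) ^ card I * (-1) ^ card {j'\<in>J. j' < j} * C i j)
        (contr C (?sl I) G (?sl' (J - {j}))))"
    proof (intro sum.cong refl)
      fix j assume j: "j \<in> J"
      have "?u S (insert j T) j = scale ((-1) ^ card I * (-1) ^ card {j'\<in>J. j' < j} * C i j)
          (?t I (J - {j}) S T)" if S: "S \<in> Pow I" and T: "T \<subseteq> J - {j}" "card T = card S" for S T
      proof -
        have fT: "finite T" using T insert.prems finite_subset by blast
        have jT: "j \<notin> T" using T by auto
        have p: "set_position J (insert j T) + card {j'\<in>insert j T. j' < j} =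
            set_position (J - {j}) T + card {j'\<in>J. j' < j} + card S"
          using set_position_remove[of J "insert j T" j] insert.prems j T jT fT by auto
        have q: "set_position (insert i I) (insert i S) = set_position I S + card S"
          using set_position_insert_min(2)[of I i S] insert S by auto
        have c: "card (insert i I) = Suc (card I)" using insert i by simp
        have c': "card (insert i S) = Suc (card S)"
          using S i insert finite_subset[of S I] by (subst card_insert_disjoint) auto
        have d: "J - insert j T = J - {j} - T" by auto
        \<comment> \<open>The increment of the triangular number makes the remaining excess of the
          exponent even.\<close>
        have "Suc (card S) * (Suc (card S) + 1) div 2 = card S * (card S + 1) div 2 + Suc (card S)"
          by (simp add: algebra_simps)
        then have e: "?e (insert i I) J (insert i S) (insert j T) + card {j'\<in>insert j T. j' < j} =
          ?e I (J - {j}) S T + card I + card {j'\<in>J. j' < j} + 2 * (Suc (card S) + card S)"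
          using p unfolding q c c' by simp
        have "(-1 :: 'a) ^ (?e (insert i I) J (insert i S) (insert j T) +
            card {j'\<in>insert j T. j' < j}) =
          (-1) ^ ?e I (J - {j}) S T * (-1) ^ card I * (-1) ^ card {j'\<in>J. j' < j}"
          unfolding e by (simp add: power_add power_mult)
        then show ?thesis
          using jT by (simp add: d ac_simps)
      qed
      then show "(\<Sum>S\<in>Pow I. \<Sum>T | T \<subseteq> J - {j} \<and> card T = card S. ?u S (insert j T) j) =
        scale ((-1) ^ card I * (-1) ^ card {j'\<in>J. j' < j} * C i j) (contr C (?sl I) G (?sl' (J - {j})))"
        using insert.prems by (subst insert.IH) (simp_all add: scale_sum_right)
    qed
    also have "\<dots> = scale ((-1) ^ card I) (del (C i) (?sl' J) (contr C (?sl I) G))"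
      using insert.prems by (simp add: del_sorted_list_of_set scale_sum_right mult.assoc)
    finally show ?thesis ..
  qed
  ultimately show ?case
    using insert by (simp only: sl[OF order.refl] contr.simps Pow) simp
qed

section \<open>Substitution and multilinear expansion of letters\<close>

lemma del_map: "del \<phi> (map g B) F = del (\<lambda>b. \<phi> (g b)) B (\<lambda>X. F (map g X))"
  by (induction B arbitrary: F) simp_all

lemma contr_map:
  "contr C (map f A) G (map g B) = contr (\<lambda>i j. C (f i) (g j)) A (\<lambda>X Y. G (map f X) (map g Y)) B"
proof (induction A arbitrary: G B)
  case (Cons a A)
  have "(\<lambda>Y. contr C (map f A) G (map g Y)) =
      contr (\<lambda>i j. C (f i) (g j)) A (\<lambda>X Y. G (map f X) (map g Y))" for G
    by (rule ext) (rule Cons)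
  then show ?case by (simp add: Cons del_map)
qed simp

text \<open>With factors as letters and monomials as weights, this is the expansion of a product of
  series into modes.\<close>

primrec lift_sum :: "('f \<Rightarrow> 'n \<Rightarrow> 'a) \<Rightarrow> 'n set \<Rightarrow> 'f list \<Rightarrow> (('f \<times> 'n) list \<Rightarrow> 'b) \<Rightarrow> 'b"
  where "lift_sum w N [] F = F []"
  | "lift_sum w N (i # A) F = (\<Sum>n\<in>N. scale (w i n) (lift_sum w N A (\<lambda>X. F ((i, n) # X))))"

lemma lift_sum_zero: "lift_sum w N A (\<lambda>X. 0) = 0"
  by (induction A) simp_all

lemma lift_sum_add: "lift_sum w N A (\<lambda>X. F X + G X) = lift_sum w N A F + lift_sum w N A G"
  by (induction A arbitrary: F G) (simp_all add: scale_right_distrib sum.distrib)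

lemma lift_sum_diff: "lift_sum w N A (\<lambda>X. F X - G X) = lift_sum w N A F - lift_sum w N A G"
  by (induction A arbitrary: F G) (simp_all add: scale_right_diff_distrib sum_subtractf)

lemma lift_sum_scale: "lift_sum w N A (\<lambda>X. scale c (F X)) = scale c (lift_sum w N A F)"
  by (induction A arbitrary: F) (simp_all add: scale_sum_right mult.commute)

lemma lift_sum_del:
  "lift_sum w N B (\<lambda>X. del \<phi> X F) =
    del (\<lambda>b. \<Sum>n\<in>N. w b n * \<phi> (b, n)) B (\<lambda>X. lift_sum w N X F)"
proof (induction B arbitrary: F)
  case (Cons b B)
  have "del \<psi> B (\<lambda>X. lift_sum w N (b # X) F) =
      (\<Sum>n\<in>N. scale (w b n) (del \<psi> B (\<lambda>X. lift_sum w N X (\<lambda>Z. F ((b, n) # Z)))))" for \<psi>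
  proof -
    have "del \<psi> B (\<lambda>X. \<Sum>n\<in>N. H n X) = (\<Sum>n\<in>N. del \<psi> B (H n))" for H
    proof (induction N rule: infinite_finite_induct)
      case (insert n N)
      then show ?case by (simp add: del_add)
    qed (simp_all add: del_diff[of \<psi> B "\<lambda>_. 0" "\<lambda>_. 0", simplified])
    then show ?thesis by (simp add: del_scale)
  qed
  then show ?case
    by (simp add: Cons lift_sum_diff lift_sum_scale scale_right_diff_distrib sum_subtractf
        scale_sum_left)
qed simp

lemma lift_sum_cong:
  "(\<And>X. map fst X = A \<Longrightarrow> F X = G X) \<Longrightarrow> lift_sum w N A F = lift_sum w N A G"
proof (induction A arbitrary: F G)
  case (Cons i A)
  have "lift_sum w N A (\<lambda>X. F ((i, n) # X)) = lift_sum w N A (\<lambda>X. G ((i, n) # X))" for n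
    by (rule Cons.IH) (simp add: Cons.prems)
  then show ?case by simp
qed simp

lemma lift_sum_del_swap:
  "lift_sum w N A (\<lambda>X. del \<phi> B (\<lambda>Z. H X Z)) = del \<phi> B (\<lambda>Z. lift_sum w N A (\<lambda>X. H X Z))"
  by (induction B arbitrary: H) (simp_all add: lift_sum_zero lift_sum_diff lift_sum_scale)

lemma del_sum_left:
  "del (\<lambda>b. \<Sum>k\<in>K. c k * \<phi> k b) B F = (\<Sum>k\<in>K. scale (c k) (del (\<phi> k) B F))"
  by (induction B arbitrary: F)
    (simp_all add: scale_right_diff_distrib sum_subtractf scale_sum_left)

lemma contr_sum: "contr C A (\<lambda>X Y. \<Sum>k\<in>K. G k X Y) B = (\<Sum>k\<in>K. contr C A (G k) B)"
proof (induction K rule: infinite_finite_induct)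
  case (insert k K)
  then show ?case by (simp add: contr_add)
qed (simp_all add: contr_diff[of C A "\<lambda>_ _. 0" "\<lambda>_ _. 0", simplified])

text \<open>A contraction uses up one letter of each word, and all other letters keep their own
  summation. Hence only the contraction coefficients change: they become weighted double sums, the
  contractions of two series.\<close>

lemma lift_sum_contr:
  "lift_sum w N A (\<lambda>X. lift_sum w' N' B (\<lambda>Y. contr C X G Y)) =
    contr (\<lambda>i j. \<Sum>n\<in>N. w i n * (\<Sum>n'\<in>N'. w' j n' * C (i, n) (j, n'))) A
      (\<lambda>A' B'. lift_sum w N A' (\<lambda>X. lift_sum w' N' B' (\<lambda>Y. G X Y))) B"
    (is "_ = contr ?C A _ B")
proof (induction A arbitrary: G B)
  case Nil
  have "contr C [] G = G []" by (rule ext) simp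
  then show ?case by simp
next
  case (Cons i A)
  let ?L = "\<lambda>F A B. lift_sum w N A (\<lambda>X. lift_sum w' N' B (\<lambda>Y. F X Y))"
  let ?\<phi> = "\<lambda>n j. \<Sum>n'\<in>N'. w' j n' * C (i, n) (j, n')"
  have IH: "?L (\<lambda>X Y. contr C X G Y) A = contr ?C A (?L G)" for G
    by (rule ext) (rule Cons)
  have *: "?L (\<lambda>X Y. contr C ((i, n) # X) G Y) A B = contr ?C A (?L (\<lambda>X. G ((i, n) # X))) B
      + scale ((-1) ^ length A) (del (?\<phi> n) B (contr ?C A (?L G)))" for n
  proof -
    have "?L (\<lambda>X Y. contr C ((i, n) # X) G Y) A B =
        ?L (\<lambda>X Y. contr C X (\<lambda>X'. G ((i, n) # X')) Y
          + scale ((-1) ^ length A) (del (C (i, n)) Y (\<lambda>Z. contr C X G Z))) A B"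
      by (intro lift_sum_cong) (auto dest: map_eq_imp_length_eq)
    then show ?thesis
      by (simp only: lift_sum_add lift_sum_scale lift_sum_del lift_sum_del_swap IH Cons)
  qed
  show ?case
    unfolding lift_sum.simps *
    by (simp add: contr_sum contr_scale del_sum_left scale_right_distrib sum.distrib
        scale_sum_right mult.commute)
qed

end

section \<open>The Laplace recursion as a determinant\<close>

lemma sorted_list_of_set_remove_nth:
  fixes T :: "'i::linorder set"
  assumes "finite T" "l < card T"
  shows "sorted_list_of_set (T - {sorted_list_of_set T ! l}) =
      take l (sorted_list_of_set T) @ drop (Suc l) (sorted_list_of_set T)"
    and "card {j \<in> T. j < sorted_list_of_set T ! l} = l"
proof -
  let ?t = "sorted_list_of_set T"
  have t: "?t = take l ?t @ ?t ! l # drop (Suc l) ?t"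
    using assms by (simp add: id_take_nth_drop)
  have s: "sorted_wrt (<) (take l ?t @ ?t ! l # drop (Suc l) ?t)"
    using strict_sorted_list_of_set[of T] t by simp
  have T: "T = set (take l ?t @ ?t ! l # drop (Suc l) ?t)"
    using assms(1) t set_sorted_list_of_set by metis
  have "T - {?t ! l} = set (take l ?t @ drop (Suc l) ?t)"
    using s by (subst T) (auto simp: sorted_wrt_append)
  moreover have "sorted_wrt (<) (take l ?t @ drop (Suc l) ?t)"
    using s by (auto simp: sorted_wrt_append)
  ultimately show "sorted_list_of_set (T - {?t ! l}) = take l ?t @ drop (Suc l) ?t"
    by (simp only: sorted_list_of_set.idem_if_sorted_distinct strict_sorted_iff)
  have "{j \<in> T. j < ?t ! l} = set (take l ?t)"
    using s by (subst T) (auto simp: sorted_wrt_append)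
  moreover have "distinct (take l ?t)" by simp
  ultimately show "card {j \<in> T. j < ?t ! l} = l"
    using assms by (simp add: distinct_card)
qed

lemma rdet_eq_det:
  fixes C :: "'f \<Rightarrow> 'i::linorder \<Rightarrow> 'a::comm_ring_1"
  assumes "finite T" "card T = length is"
  shows "rdet C is T =
    det (mat (length is) (length is) (\<lambda>(g, h). C (is ! g) (sorted_list_of_set T ! h)))"
  using assms
proof (induction "is" arbitrary: T)
  case Nil
  show ?case by (simp add: det_dim_zero)
next
  case (Cons i "is")
  let ?n = "length is" and ?t = "sorted_list_of_set T"
  let ?A = "mat (Suc ?n) (Suc ?n) (\<lambda>(g, h). C ((i # is) ! g) (?t ! h))"
  have "inj_on ((!) ?t) {..<Suc ?n}"
    using Cons.prems by (simp add: inj_on_nth)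
  moreover have "(!) ?t ` {..<Suc ?n} = T"
    using Cons.prems nth_image[of "Suc ?n" ?t] by (simp add: lessThan_atLeast0)
  ultimately have bij: "bij_betw ((!) ?t) {..<Suc ?n} T" by (simp add: bij_betw_def)
  have "det ?A = (\<Sum>l<Suc ?n. ?A $$ (0, l) * cofactor ?A 0 l)"
    by (rule laplace_expansion_row) auto
  also have "\<dots> = (\<Sum>l<Suc ?n. (-1) ^ card {j'\<in>T. j' < ?t ! l} * C i (?t ! l) * rdet C is (T - {?t ! l}))"
  proof (intro sum.cong refl)
    fix l assume l: "l \<in> {..<Suc ?n}"
    have lT: "l < card T" using l Cons.prems by simp
    note rm = sorted_list_of_set_remove_nth[OF Cons.prems(1) lT]
    have "?t ! l \<in> T" using bij l by (auto simp: bij_betw_def)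
    then have "rdet C is (T - {?t ! l}) =
        det (mat ?n ?n (\<lambda>(g, h). C (is ! g) (sorted_list_of_set (T - {?t ! l}) ! h)))"
      using Cons.prems by (intro Cons.IH) auto
    also have "mat ?n ?n (\<lambda>(g, h). C (is ! g) (sorted_list_of_set (T - {?t ! l}) ! h)) =
        mat_delete ?A 0 l"
      using lT Cons.prems unfolding rm(1)
      by (intro eq_matI) (auto simp: mat_delete_def nth_append)
    finally show "?A $$ (0, l) * cofactor ?A 0 l =
        (-1) ^ card {j'\<in>T. j' < ?t ! l} * C i (?t ! l) * rdet C is (T - {?t ! l})"
      using l by (simp add: cofactor_def rm(2))
  qed
  also have "\<dots> = rdet C (i # is) T"
    using sum.reindex_bij_betw[OF bij,
        of "\<lambda>j. (-1) ^ card {j'\<in>T. j' < j} * C i j * rdet C is (T - {j})"] by simp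
  finally show ?case by simp
qed

section \<open>The algebra and its induced module\<close>

lemma poly_mapping_add_induct [case_names single add]:
  assumes "\<And>k c. P (Poly_Mapping.single k c)" "\<And>p q. P p \<Longrightarrow> P q \<Longrightarrow> P (p + q)"
  shows "P (p :: 'k \<Rightarrow>\<^sub>0 'c::monoid_add)"
proof (induction p rule: update_induct)
  case const
  then show ?case using assms(1)[of undefined 0] by simp
next
  case (update p k c)
  then have "Poly_Mapping.update k c p = p + Poly_Mapping.single k c"
    by (intro poly_mapping_eqI) (auto simp: lookup_update lookup_add lookup_single when_def in_keys_iff)
  then show ?case using assms(2)[OF update.IH assms(1)] by simp
qed

lemma tensor_gen_add: "tensor_gen (u + v) = tensor_gen u + tensor_gen v"
proof transfer
  fix u v :: 'a
  have "word [u + v] - word [u] - word [v] \<in> ideal_generated tensor_relations"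
    by (rule hull_inc) (auto simp: tensor_relations_def)
  then show "word [u + v] - (word [u] + word [v]) \<in> ideal_generated tensor_relations"
    by (simp add: algebra_simps)
qed

lemma tensor_gen_scaleC: "tensor_gen (c *\<^sub>C u) = c *\<^sub>C tensor_gen u"
  by transfer (auto simp: tensor_relations_def intro!: hull_inc)

lemma clinear_iff: "clinear f \<longleftrightarrow> (\<forall>x y. f (x + y) = f x + f y) \<and> (\<forall>c x. f (c *\<^sub>C x) = c *\<^sub>C f x)"
proof
  assume "(\<forall>x y. f (x + y) = f x + f y) \<and> (\<forall>c x. f (c *\<^sub>C x) = c *\<^sub>C f x)"
  then show "clinear f" by unfold_locales auto
next
  assume "clinear f"
  then interpret Vector_Spaces.linear "(*\<^sub>C)" "(*\<^sub>C)" f .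
  show "(\<forall>x y. f (x + y) = f x + f y) \<and> (\<forall>c x. f (c *\<^sub>C x) = c *\<^sub>C f x)"
    by (simp add: add scale)
qed

lemma clinear_props:
  assumes "clinear f"
  shows "f (x + y) = f x + f y" "f (c *\<^sub>C x) = c *\<^sub>C f x" "f 0 = 0" "f (- x) = - f x"
    "f (x - y) = f x - f y" "f (sum g A) = (\<Sum>a\<in>A. f (g a))"
proof -
  interpret Vector_Spaces.linear "(*\<^sub>C)" "(*\<^sub>C)" f by fact
  show "f (x + y) = f x + f y" "f (c *\<^sub>C x) = c *\<^sub>C f x" "f 0 = 0" "f (- x) = - f x"
    "f (x - y) = f x - f y" "f (sum g A) = (\<Sum>a\<in>A. f (g a))"
    by (simp_all add: add scale neg diff sum)
qed

lemma clinear_compose: "clinear f \<Longrightarrow> clinear g \<Longrightarrow> clinear (\<lambda>x. f (g x))"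
  by (simp add: clinear_iff)

lemma clinear_tensor_gen: "clinear tensor_gen"
  by (simp add: clinear_iff tensor_gen_add tensor_gen_scaleC)

lemma tensor_algebra_induct [case_names gen one add scale mult]:
  assumes "\<And>w. P (tensor_gen w)" "P 1" "\<And>x y. P x \<Longrightarrow> P y \<Longrightarrow> P (x + y)"
    "\<And>c x. P x \<Longrightarrow> P (c *\<^sub>C x)" "\<And>x y. P x \<Longrightarrow> P y \<Longrightarrow> P (x * y)"
  shows "P x"
proof (induction x rule: tensor_algebra.abs_induct)
  fix p :: "'a list \<Rightarrow>\<^sub>0 complex"
  have "P (abs_tensor_algebra (word us))" for us :: "'a list"
  proof (induction us)
    case Nil
    have "word ([] :: 'a list) = 1"
      unfolding word_def by (simp add: zero_list_def flip: single_one)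
    then show ?case using assms(2) by (simp add: one_tensor_algebra_def)
  next
    case (Cons u us)
    have "word (u # us) = word [u] * word us"
      by (simp add: word_def mult_single plus_list_def)
    then have "abs_tensor_algebra (word (u # us)) = tensor_gen u * abs_tensor_algebra (word us)"
      by (simp add: tensor_gen.abs_eq times_tensor_algebra.abs_eq)
    then show ?case using assms(1)[of u] assms(5) Cons by simp
  qed
  moreover have "Poly_Mapping.single us c = c *\<^sub>C word us" for us :: "'a list" and c
    by (rule poly_mapping_eqI) (simp add: word_def lookup_single when_def scaleC_complex_def)
  ultimately have abs_single: "P (abs_tensor_algebra (Poly_Mapping.single us c))" for us c
    using assms(4)[of _ c] by (simp flip: scaleC_tensor_algebra.abs_eq)
  show "P (abs_tensor_algebra p)"
  proof (induction p rule: poly_mapping_add_induct)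
    case (single us c)
    show ?case by (rule abs_single)
  next
    case (add p q)
    then show ?case using assms(3) by (simp flip: plus_tensor_algebra.abs_eq)
  qed
qed

lemma affine_eq_sum:
  fixes w :: "'h::complex_bilinear_space affine"
  shows "w = (\<Sum>m\<in>Poly_Mapping.keys (fst w). (Poly_Mapping.single m (Poly_Mapping.lookup (fst w) m), 0))
    + snd w *\<^sub>C (0, 1)"
proof -
  have "(\<Sum>m\<in>K. (Poly_Mapping.single m (f m), 0)) = ((\<Sum>m\<in>K. Poly_Mapping.single m (f m)), 0 :: complex)"
    for K :: "int set" and f :: "int \<Rightarrow> 'h"
    by (induction K rule: infinite_finite_induct) (auto simp: zero_prod_def)
  moreover have "(\<Sum>m\<in>Poly_Mapping.keys p. Poly_Mapping.single m (Poly_Mapping.lookup p m)) = p"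
    for p :: "int \<Rightarrow>\<^sub>0 'h"
    by (rule poly_mapping_eqI) (auto simp: lookup_sum lookup_single when_def in_keys_iff)
  moreover have "(0 :: int \<Rightarrow>\<^sub>0 'h) = c *\<^sub>C 0" for c by simp
  ultimately show ?thesis
    by (simp add: prod_eq_iff scaleC_prod_def scaleC_complex_def)
qed

lemma mode_algebra_induct [case_names mode central one add scale mult]:
  assumes "\<And>a m. P (mode_element a m)" "P central_element" "P 1"
    "\<And>x y. P x \<Longrightarrow> P y \<Longrightarrow> P (x + y)"
    "\<And>c x. P x \<Longrightarrow> P (c *\<^sub>C x)" "\<And>x y. P x \<Longrightarrow> P y \<Longrightarrow> P (x * y)"
  shows "P x"
proof (induction x rule: mode_algebra.abs_induct)
  fix t :: "'a affine tensor_algebra"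
  show "P (abs_mode_algebra t)"
  proof (induction t rule: tensor_algebra_induct)
    case (gen w)
    have zero: "P 0" using assms(5)[OF assms(3), of 0] by simp
    let ?t = "\<lambda>m. tensor_mode (Poly_Mapping.lookup (fst w) m) m"
    have "tensor_gen w = (\<Sum>m\<in>Poly_Mapping.keys (fst w). ?t m) + snd w *\<^sub>C tensor_central"
      by (subst affine_eq_sum) (simp add: clinear_props[OF clinear_tensor_gen] tensor_mode_def tensor_central_def)
    moreover have "P (abs_mode_algebra (\<Sum>m\<in>K. ?t m))" for K
    proof (induction K rule: infinite_finite_induct)
      case (insert m K)
      then show ?case
        using assms(4)[OF assms(1) insert.IH, of "Poly_Mapping.lookup (fst w) m" m]
        by (simp add: mode_element.abs_eq plus_mode_algebra.abs_eq)
    qed (use zero in \<open>simp_all add: zero_mode_algebra_def\<close>)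
    ultimately show ?case
      using assms(4)[OF _ assms(5)[OF assms(2), of "snd w"]]
      by (simp add: central_element_def scaleC_mode_algebra.abs_eq flip: plus_mode_algebra.abs_eq)
  next
    case one
    then show ?case using assms(3) by (simp add: one_mode_algebra_def)
  next
    case (add x y)
    then show ?case using assms(4) by (simp flip: plus_mode_algebra.abs_eq)
  next
    case (scale c x)
    then show ?case using assms(5) by (simp flip: scaleC_mode_algebra.abs_eq)
  next
    case (mult x y)
    then show ?case using assms(6) by (simp flip: times_mode_algebra.abs_eq)
  qed
qed

lemma mode_element_anticommute:
  assumes "m \<ge> 0" "n \<le> -1"
  shows "mode_element a m * mode_element b n + mode_element b n * mode_element a m =
    (form a b * of_bool (m + n + 1 = 0)) *\<^sub>C central_element"
proof -
  have "tensor_mode a m * tensor_mode b n + tensor_mode b n * tensor_mode a m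
      - (form a b * of_bool (m + n + 1 = 0)) *\<^sub>C tensor_central \<in> ideal_generated mode_relations"
    using assms by (intro hull_inc) (unfold mode_relations_def, blast)
  then show ?thesis by transfer
qed

lemma mode_element_central: "mode_element a m * central_element = central_element * mode_element a m"
  by transfer (rule hull_inc, unfold mode_relations_def, blast)

lemma clinear_mode_element: "clinear (\<lambda>a. mode_element a m)"
proof -
  have *: "tensor_mode (a + b) m = tensor_mode a m + tensor_mode b m"
      "tensor_mode (c *\<^sub>C a) m = c *\<^sub>C tensor_mode a m" for a b :: 'a and c
  proof -
    show "tensor_mode (a + b) m = tensor_mode a m + tensor_mode b m"
      unfolding tensor_mode_def tensor_gen_add[symmetric] by (simp add: single_add)
    have "Poly_Mapping.single m (c *\<^sub>C a) = c *\<^sub>C Poly_Mapping.single m a"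
      by (rule poly_mapping_eqI) (simp add: lookup_single when_def)
    then show "tensor_mode (c *\<^sub>C a) m = c *\<^sub>C tensor_mode a m"
      unfolding tensor_mode_def tensor_gen_scaleC[symmetric] by (simp add: scaleC_prod_def)
  qed
  show ?thesis
    unfolding clinear_iff
    by (simp add: mode_element_def * plus_mode_algebra.abs_eq scaleC_mode_algebra.abs_eq)
qed

text \<open>Composition holds exactly, but linearity in the algebra element only modulo the
  relations, because the pairs \<open>(n, z)\<close> are formal basis vectors.\<close>

lemma left_mult_eqs:
  "left_mult (a * b) p = left_mult a (left_mult b p)"
  "left_mult (a + b) p - (left_mult a p + left_mult b p) \<in> complex_vector.span induction_relations"
  "left_mult (c *\<^sub>C a) p - c *\<^sub>C left_mult a p \<in> complex_vector.span induction_relations"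
proof -
  note l = clinear_props[OF clinear_left_mult]
  show "left_mult (a * b) p = left_mult a (left_mult b p)"
    by (simp add: left_mult_def[of b] left_mult_def[of "a * b"] l left_mult_pure mult.assoc)
  have "left_mult (a + b) p - (left_mult a p + left_mult b p) =
     (\<Sum>x\<in>Poly_Mapping.keys p. Poly_Mapping.lookup p x *\<^sub>C
       (pure_tensor (a * fst x + b * fst x) (snd x) - pure_tensor (a * fst x) (snd x) - pure_tensor (b * fst x) (snd x)))"
    by (simp add: left_mult_def sum.distrib[symmetric] sum_subtractf[symmetric] distrib_right
        complex_vector.scale_right_diff_distrib algebra_simps)
  also have "\<dots> \<in> complex_vector.span induction_relations"
    by (intro complex_vector.span_sum complex_vector.span_scale complex_vector.span_base)
      (unfold induction_relations_def, blast)
  finally show "left_mult (a + b) p - (left_mult a p +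
      left_mult b p) \<in> complex_vector.span induction_relations" .
  have "left_mult (c *\<^sub>C a) p - c *\<^sub>C left_mult a p =
     (\<Sum>x\<in>Poly_Mapping.keys p. Poly_Mapping.lookup p x *\<^sub>C
       (pure_tensor (c *\<^sub>C (a * fst x)) (snd x) - c *\<^sub>C pure_tensor (a * fst x) (snd x)))"
    by (simp add: left_mult_def complex_vector.scale_sum_right sum_subtractf[symmetric]
        complex_vector.scale_right_diff_distrib scaleC_mult_left mult.commute)
  also have "\<dots> \<in> complex_vector.span induction_relations"
    by (intro complex_vector.span_sum complex_vector.span_scale complex_vector.span_base)
      (unfold induction_relations_def, blast)
  finally show "left_mult (c *\<^sub>C a) p - c *\<^sub>C left_mult a p \<in> complex_vector.span induction_relations" .
qed

lemma action_mult: "action (a * b) v = action a (action b v)"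
  by transfer (simp add: left_mult_eqs(1) complex_vector.span_zero)

lemma action_add: "action (a + b) v = action a v + action b v"
  by transfer (rule left_mult_eqs)

lemma action_scaleC: "action (c *\<^sub>C a) v = c *\<^sub>C action a v"
  by transfer (rule left_mult_eqs)

lemma clinear_action: "clinear (action a)"
  unfolding clinear_iff
  by (intro conjI allI; transfer)
    (simp_all add: clinear_props[OF clinear_left_mult] complex_vector.span_zero)

lemma clinear_mode: "clinear (mode h n)"
  unfolding mode_def by (rule clinear_action)

lemma clinear_mode_left: "clinear (\<lambda>h. mode h n v)"
  unfolding clinear_iff mode_def
  by (simp add: clinear_props[OF clinear_mode_element] action_add action_scaleC)

lemma action_one: "action 1 v = v"
proof (induction v rule: fock_space.abs_induct)
  fix p :: "'a mode_algebra \<times> complex \<Rightarrow>\<^sub>0 complex"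
  have "left_mult 1 p = p"
    by (rule poly_mapping_eqI)
      (auto simp: left_mult_def pure_tensor_def lookup_sum lookup_single when_def in_keys_iff
        scaleC_complex_def if_distrib cong: if_cong)
  then show "action 1 (abs_fock_space p) = abs_fock_space p"
    by (simp add: action.abs_eq)
qed

lemma vacuum_action_vacuum:
  assumes "vacuum_action b e"
  shows "action b vacuum = e *\<^sub>C vacuum"
  using assms
proof transfer
  fix b :: "'a mode_algebra" and e
  assume b: "vacuum_action b e"
  let ?R = "induction_relations :: ('a mode_algebra \<times> complex \<Rightarrow>\<^sub>0 complex) set"
  have "pure_tensor (1 * b) 1 - pure_tensor 1 (e * 1) \<in> ?R" "pure_tensor 1 (e * 1) - e *\<^sub>C pure_tensor 1 1 \<in> ?R"
    using b unfolding induction_relations_def by blast+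
  then have "(pure_tensor (1 * b) 1 - pure_tensor 1 (e * 1)) +
      (pure_tensor 1 (e * 1) - e *\<^sub>C pure_tensor 1 1)
      \<in> complex_vector.span ?R"
    by (intro complex_vector.span_add complex_vector.span_base)
  then show "left_mult b (pure_tensor 1 1) - e *\<^sub>C pure_tensor 1 1 \<in> complex_vector.span ?R"
    by (simp add: left_mult_pure)
qed

text \<open>The vacuum is cyclic: scalars move from the second tensor factor to the first, so the
  pair \<open>(n, z)\<close> represents \<open>z *\<^sub>C n\<close> applied to the vacuum.\<close>

lemma fock_space_induct [case_names action add]:
  fixes v :: "'h::complex_bilinear_space fock_space"
  assumes "\<And>n. P (action n vacuum)" "\<And>u v. P u \<Longrightarrow> P v \<Longrightarrow> P (u + v)"
  shows "P v"
proof (induction v rule: fock_space.abs_induct)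
  fix p :: "'h mode_algebra \<times> complex \<Rightarrow>\<^sub>0 complex"
  let ?R = "induction_relations :: ('h mode_algebra \<times> complex \<Rightarrow>\<^sub>0 complex) set"
  have "abs_fock_space (Poly_Mapping.single (n, z) c) =
      action ((c * z) *\<^sub>C n) vacuum" for n :: "'h mode_algebra" and z c
  proof -
    have "pure_tensor n (z * 1) - z *\<^sub>C pure_tensor n 1 \<in> ?R"
      "pure_tensor ((c * z) *\<^sub>C n) 1 - (c * z) *\<^sub>C pure_tensor n 1 \<in> ?R"
      unfolding induction_relations_def by blast+
    then have "c *\<^sub>C (pure_tensor n (z * 1) - z *\<^sub>C pure_tensor n 1) -
        (pure_tensor ((c * z) *\<^sub>C n) 1 - (c * z) *\<^sub>C pure_tensor n 1) \<in> complex_vector.span ?R"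
      by (intro complex_vector.span_diff complex_vector.span_scale complex_vector.span_base)
    moreover have "Poly_Mapping.single (n, z) c = c *\<^sub>C pure_tensor n z"
      by (rule poly_mapping_eqI) (simp add: pure_tensor_def lookup_single when_def scaleC_complex_def)
    ultimately have "Poly_Mapping.single (n, z) c - pure_tensor ((c * z) *\<^sub>C n) 1 \<in> complex_vector.span ?R"
      by (simp add: complex_vector.scale_right_diff_distrib scaleC_scaleC)
    then show ?thesis
      by (simp add: vacuum_def action.abs_eq left_mult_pure fock_space.abs_eq_iff)
  qed
  then have abs_single: "P (abs_fock_space (Poly_Mapping.single x c))" for x c
    using assms(1) by (cases x) simp
  show "P (abs_fock_space p)"
  proof (induction p rule: poly_mapping_add_induct)
    case (single x c)
    show ?case by (rule abs_single)
  next
    case (add p q)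
    then show ?case using assms(2) by (simp flip: plus_fock_space.abs_eq)
  qed
qed

section \<open>The filtration of \<open>V\<close> and the modes acting on it\<close>

lemma action_central_commute: "action central_element (mode a m v) =
    mode a m (action central_element v)"
  by (simp add: mode_def mode_element_central flip: action_mult)

lemma state_Nil: "state [] = vacuum"
  and state_Cons: "state ((h, m) # hs) = mode h (- int m - 1) (state hs)"
  by (simp_all add: state_def)

lemma action_central_state: "action central_element (state hs) = state hs"
proof (induction hs)
  case Nil
  show ?case
    using vacuum_action_vacuum[OF vacuum_action.central] by (simp add: state_Nil scaleC_one)
next
  case (Cons x hs)
  then show ?case by (cases x) (simp add: state_Cons action_central_commute)
qed

text \<open>An exhaustive filtration of \<open>V\<close>. Each stage is stable under the positive
  modes and annihilated by those of index at least \<open>N\<close>; this uniform vanishing makes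
  the coefficients of normal-ordered series finite sums.\<close>

definition bounded_states :: "nat \<Rightarrow> 'h::complex_bilinear_space fock_space set"
  where "bounded_states N = complex_vector.span {state hs | hs. \<forall>(h, m)\<in>set hs. m < N}"

lemma bounded_statesI: "(\<And>h m. (h, m) \<in> set hs \<Longrightarrow> m < N) \<Longrightarrow> state hs \<in> bounded_states N"
  unfolding bounded_states_def by (intro complex_vector.span_base) auto

lemma bounded_states_mono: "N \<le> N' \<Longrightarrow> bounded_states N \<subseteq> bounded_states N'"
  unfolding bounded_states_def by (intro complex_vector.span_mono) fastforce

lemma bounded_states_clinear:
  assumes "v \<in> bounded_states N" "clinear f" "complex_vector.subspace S"
    "\<And>hs. (\<And>h m. (h, m) \<in> set hs \<Longrightarrow> m < N) \<Longrightarrow> f (state hs) \<in> S"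
  shows "f v \<in> S"
  using assms(1) unfolding bounded_states_def
proof (induction rule: complex_vector.span_induct)
  case base
  show ?case
    using assms(2,3) unfolding complex_vector.subspace_def
    by (auto simp: clinear_props[OF assms(2)])
next
  case (step x)
  then show ?case using assms(4) by auto
qed

lemma subspace_bounded_states: "complex_vector.subspace (bounded_states N)"
  unfolding bounded_states_def by (rule complex_vector.subspace_span)

lemma action_central_bounded_states: "v \<in> bounded_states N \<Longrightarrow> action central_element v = v"
proof -
  assume v: "v \<in> bounded_states N"
  have "clinear (\<lambda>v. action central_element v - v)"
    unfolding clinear_iff
    by (simp add: clinear_props[OF clinear_action] complex_vector.scale_right_diff_distrib)
  from bounded_states_clinear[OF v this, of "{0}"]
  show ?thesis by (simp add: action_central_state complex_vector.subspace_single_0)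
qed

lemma mode_anticommute_action:
  assumes "m \<ge> 0" "n < 0"
  shows "mode a m (mode b n v) =
    (form a b * of_bool (m + n + 1 = 0)) *\<^sub>C action central_element v - mode b n (mode a m v)"
proof -
  have "mode a m (mode b n v) + mode b n (mode a m v)
      = (form a b * of_bool (m + n + 1 = 0)) *\<^sub>C action central_element v"
    using mode_element_anticommute[of m n a b] assms
    by (simp add: mode_def flip: action_mult action_add action_scaleC)
  then show ?thesis by (simp add: algebra_simps)
qed

lemma mode_positive_vacuum: "m \<ge> 0 \<Longrightarrow> mode a m vacuum = 0"
  using vacuum_action_vacuum[OF vacuum_action.positive, of m a] by (simp add: mode_def)

lemma mode_negative_bounded_states:
  assumes "v \<in> bounded_states N" "m < N"
  shows "mode a (- int m - 1) v \<in> bounded_states N"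
proof (rule bounded_states_clinear[OF assms(1) clinear_mode subspace_bounded_states])
  fix hs :: "('a \<times> nat) list"
  assume "\<And>h m. (h, m) \<in> set hs \<Longrightarrow> m < N"
  then have "state ((a, m) # hs) \<in> bounded_states N"
    using assms(2) by (intro bounded_statesI) auto
  then show "mode a (- int m - 1) (state hs) \<in> bounded_states N" by (simp add: state_Cons)
qed

text \<open>The mode is moved to the right until it meets the vacuum. Its contraction with a letter
  \<open>(h, m)\<close> requires \<open>n = m\<close>, which is impossible for \<open>n\<close> at
  least \<open>N\<close>.\<close>

lemma mode_positive_state:
  assumes "\<And>h m. (h, m) \<in> set hs \<Longrightarrow> m < N" "n \<ge> 0"
  shows "mode a n (state hs) \<in> bounded_states N \<and> (n \<ge> int N \<longrightarrow> mode a n (state hs) = 0)"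
  using assms(1)
proof (induction hs)
  case Nil
  show ?case
    using assms(2)
    by (simp add: state_Nil mode_positive_vacuum complex_vector.subspace_0[OF subspace_bounded_states])
next
  case (Cons x hs)
  obtain h m where x: "x = (h, m)" by (cases x)
  have m: "m < N" and hs: "\<And>h m. (h, m) \<in> set hs \<Longrightarrow> m < N"
    using Cons.prems x by auto
  have eq: "mode a n (state (x # hs)) =
      (form a h * of_bool (n = int m)) *\<^sub>C state hs - mode h (- int m - 1) (mode a n (state hs))"
    using mode_anticommute_action[of n "- int m - 1" a h "state hs"] assms(2)
    by (simp add: x state_Cons action_central_state)
  have "mode h (- int m - 1) (mode a n (state hs)) \<in> bounded_states N"
    using Cons.IH hs m by (intro mode_negative_bounded_states) auto
  moreover have "state hs \<in> bounded_states N" using hs by (rule bounded_statesI)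
  ultimately have "mode a n (state (x # hs)) \<in> bounded_states N"
    unfolding eq
    by (intro complex_vector.subspace_diff complex_vector.subspace_scale subspace_bounded_states)
  moreover have "mode a n (state (x # hs)) = 0" if "n \<ge> int N"
  proof -
    have "mode a n (state hs) = 0" using Cons.IH hs that by blast
    then show ?thesis
      unfolding eq using m that by (simp add: clinear_props[OF clinear_mode])
  qed
  ultimately show ?case by blast
qed

lemma mode_positive_bounded_states:
  assumes "v \<in> bounded_states N" "n \<ge> 0"
  shows "mode a n v \<in> bounded_states N" "n \<ge> int N \<Longrightarrow> mode a n v = 0"
proof -
  show "mode a n v \<in> bounded_states N"
    by (rule bounded_states_clinear[OF assms(1) clinear_mode subspace_bounded_states])
      (use mode_positive_state assms(2) in blast)
  have "mode a n v \<in> {0}" if "n \<ge> int N"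
    by (rule bounded_states_clinear[OF assms(1) clinear_mode complex_vector.subspace_single_0])
      (use mode_positive_state assms(2) that in blast)
  then show "mode a n v = 0" if "n \<ge> int N"
    using that by blast
qed

text \<open>The union of the stages contains the vacuum and is preserved by every generator of the
  algebra: positive modes and the central element respect each stage, and a negative mode at worst
  leads to a later one.\<close>

lemma bounded_states_exhaust: "\<exists>N. v \<in> bounded_states N"
proof (induction v rule: fock_space_induct)
  case (add u v)
  then obtain M N where "u \<in> bounded_states M" "v \<in> bounded_states N" by blast
  then have "u \<in> bounded_states (max M N)" "v \<in> bounded_states (max M N)"
    using bounded_states_mono[of M "max M N"] bounded_states_mono[of N "max M N"] by auto
  then show ?case using complex_vector.subspace_add[OF subspace_bounded_states] by blast
next
  case (action n)
  have "\<forall>v. (\<exists>N. v \<in> bounded_states N) \<longrightarrow> (\<exists>N. action n v \<in> bounded_states N)"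
  proof (induction n rule: mode_algebra_induct)
    case (mode a m)
    show ?case
    proof (intro allI impI, elim exE)
      fix v :: "'a fock_space" and N assume v: "v \<in> bounded_states N"
      show "\<exists>N. action (mode_element a m) v \<in> bounded_states N"
      proof (cases "m \<ge> 0")
        case True
        then show ?thesis using mode_positive_bounded_states(1)[OF v] by (auto simp: mode_def)
      next
        case False
        then have "v \<in> bounded_states (max N (nat (- m)))"
          using v bounded_states_mono[of N "max N (nat (- m))"] by auto
        from mode_negative_bounded_states[OF this, of "nat (- m - 1)" a]
        have "mode a m v \<in> bounded_states (max N (nat (- m)))" using False by auto
        then show ?thesis unfolding mode_def ..
      qed
    qed
  next
    case central
    then show ?case using action_central_bounded_states by metis
  next
    case one
    then show ?case by (simp add: action_one)
  next
    case (add x y)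
    show ?case
    proof (intro allI impI)
      fix v :: "'a fock_space" assume "\<exists>N. v \<in> bounded_states N"
      with add obtain M N where "action x v \<in> bounded_states M" "action y v \<in> bounded_states N" by blast
      then have "action x v \<in> bounded_states (max M N)" "action y v \<in> bounded_states (max M N)"
        using bounded_states_mono[of M "max M N"] bounded_states_mono[of N "max M N"] by auto
      then have "action (x + y) v \<in> bounded_states (max M N)"
        unfolding action_add by (rule complex_vector.subspace_add[OF subspace_bounded_states])
      then show "\<exists>N. action (x + y) v \<in> bounded_states N" ..
    qed
  next
    case (scale c x)
    then show ?case
      using complex_vector.subspace_scale[OF subspace_bounded_states] unfolding action_scaleC by blast
  next
    case (mult x y)
    then show ?case by (simp add: action_mult)
  qed
  moreover have "vacuum \<in> bounded_states 0"
    using bounded_statesI[of "[]" 0] by (simp add: state_Nil)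
  ultimately show ?case by blast
qed

text \<open>The central element acts as the identity on every stage of the filtration, hence on all
  of \<open>V\<close>.\<close>

lemma mode_anticommute:
  assumes "m \<ge> 0" "n < 0"
  shows "mode a m (mode b n v) = (form a b * of_bool (m + n + 1 = 0)) *\<^sub>C v - mode b n (mode a m v)"
  using mode_anticommute_action[OF assms] bounded_states_exhaust[of v] action_central_bounded_states
  by metis

lemma span_states: "complex_vector.span (range state) = UNIV"
proof -
  have "bounded_states N \<subseteq> complex_vector.span (range state)" for N
    unfolding bounded_states_def by (intro complex_vector.span_mono) auto
  then show ?thesis using bounded_states_exhaust by blast
qed

section \<open>Normal ordering and Wick's theorem for modes\<close>

global_interpretation complex_contraction: contraction "scaleC :: complex \<Rightarrow> 'a \<Rightarrow> 'a::complex_vector"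
  by (simp add: contraction_def complex_vector.module_axioms)

text \<open>Deliberately not symmetric: only a positive mode to the left of a negative one is
  contracted. The second index is forced to be negative by the sum condition.\<close>

definition mode_form :: "'h::complex_bilinear_space \<times> int \<Rightarrow> 'h \<times> int \<Rightarrow> complex"
  where "mode_form x y = form (fst x) (fst y) * of_bool (0 \<le> snd x \<and> snd x + snd y + 1 = 0)"

abbreviation mode_pair :: "'h::complex_bilinear_space \<times> int \<Rightarrow> 'h fock_space \<Rightarrow> 'h fock_space"
  where "mode_pair x \<equiv> mode (fst x) (snd x)"

text \<open>The sign of the normal ordering permutation, obtained by counting inversions so that it
  follows the recursion on lists; \<open>sign_normal_perm\<close> proves the agreement.\<close>

primrec inversion_sign :: "int list \<Rightarrow> int"
  where "inversion_sign [] = 1"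
  | "inversion_sign (n # ns) =
      (if n < 0 then 1 else (-1) ^ length (filter (\<lambda>n. n < 0) ns)) * inversion_sign ns"

definition nord :: "('h::complex_bilinear_space \<times> int) list \<Rightarrow> 'h fock_space \<Rightarrow> 'h fock_space"
  where "nord A v = of_int (inversion_sign (map snd A)) *\<^sub>C
    foldr mode_pair (filter (\<lambda>x. snd x < 0) A) (foldr mode_pair (filter (\<lambda>x. \<not> snd x < 0) A) v)"

text \<open>The operator \<open>T\<close> is inserted between the negative and the positive modes, and every negative
  mode contributes a factor \<open>\<tau>\<close>. Both are needed for induction on the factors: moving a positive
  mode to the right past the negative ones appends it to \<open>T\<close> and changes the sign of \<open>\<tau>\<close>.\<close>

primrec nord_insert :: "complex \<Rightarrow> ('h::complex_bilinear_space \<times> int) list \<Rightarrow>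
    ('h fock_space \<Rightarrow> 'h fock_space) \<Rightarrow> 'h fock_space \<Rightarrow> 'h fock_space"
  where "nord_insert \<tau> [] T v = T v"
  | "nord_insert \<tau> (x # A) T v =
      (if snd x < 0 then \<tau> *\<^sub>C mode_pair x (nord_insert \<tau> A T v)
       else nord_insert (- \<tau>) A (\<lambda>v. T (mode_pair x v)) v)"

lemma nord_insert_eq:
  "nord_insert \<tau> A T v =
    (\<tau> ^ length (filter (\<lambda>x. snd x < 0) A) * of_int (inversion_sign (map snd A))) *\<^sub>C
    foldr mode_pair (filter (\<lambda>x. snd x < 0) A) (T (foldr mode_pair (filter (\<lambda>x. \<not> snd x < 0) A) v))"
proof (induction A arbitrary: \<tau> T)
  case Nil
  show ?case by (simp add: scaleC_one)
next
  case (Cons x A)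
  have "length (filter (\<lambda>n. n < 0) (map snd A)) = length (filter (\<lambda>x. snd x < 0) A)"
    by (simp add: filter_map o_def)
  then show ?case
    by (simp add: Cons clinear_props[OF clinear_mode] scaleC_scaleC power_minus[of \<tau>] mult_ac)
qed

lemma nord_eq_nord_insert: "nord A v = nord_insert 1 A (\<lambda>v. v) v"
  by (simp add: nord_insert_eq nord_def)

text \<open>Passing a negative mode costs one contraction and a sign, which is absorbed by
  \<open>\<tau>\<close>. The mode stops directly in front of \<open>T\<close> and so is never
  exchanged with a positive mode, for which there is no relation.\<close>

lemma mode_nord_insert:
  assumes "0 \<le> snd x"
  shows "mode_pair x (nord_insert \<tau> A T v) = nord_insert (- \<tau>) A (\<lambda>v. mode_pair x (T v)) v
    + \<tau> *\<^sub>C complex_contraction.del (mode_form x) A (\<lambda>X. nord_insert \<tau> X T v)"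
proof (induction A arbitrary: \<tau> T)
  case (Cons y A)
  let ?del = "complex_contraction.del (mode_form x) A"
  show ?case
  proof (cases "snd y < 0")
    case True
    have "mode_pair x (mode_pair y w) = mode_form x y *\<^sub>C w - mode_pair y (mode_pair x w)" for w
      using mode_anticommute[OF assms True, of "fst x" "fst y" w] assms
      by (simp only: mode_form_def simp_thms)
    moreover have "mode_pair y (?del F) = ?del (\<lambda>X. mode_pair y (F X))" for F
      by (rule complex_contraction.del_linear_image) (simp_all add: clinear_props[OF clinear_mode])
    ultimately show ?thesis
      using True
      by (simp add: Cons clinear_props[OF clinear_mode] complex_contraction.del_scale
          complex_vector.scale_right_diff_distrib scaleC_add_right)
  next
    case False
    then have "mode_form x y = 0" using assms by (simp add: mode_form_def)
    then show ?thesis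
      using False by (simp add: Cons)
  qed
qed simp

lemma nord_Nil: "nord [] v = v"
  by (simp add: nord_eq_nord_insert)

text \<open>A negative mode is already in place and has no contractions. For a positive one,
  \<open>mode_nord_insert\<close> is used with \<open>T\<close> the identity, where it makes no
  difference on which side of \<open>T\<close> the mode is put.\<close>

lemma nord_Cons:
  "nord (x # A) v = mode_pair x (nord A v) - complex_contraction.del (mode_form x) A (\<lambda>X. nord X v)"
proof (cases "snd x < 0")
  case True
  then have "mode_form x = (\<lambda>_. 0)" by (auto simp: mode_form_def)
  moreover have "complex_contraction.del (\<lambda>_. 0) A F =
      (0 :: 'a fock_space)" for F :: "('a \<times> int) list \<Rightarrow> _"
    by (induction A arbitrary: F) simp_all
  ultimately show ?thesis using True by (simp add: nord_eq_nord_insert scaleC_one)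
next
  case False
  then show ?thesis
    using mode_nord_insert[of x 1 A "\<lambda>v. v" v] by (simp add: nord_eq_nord_insert scaleC_one)
qed

theorem nord_nord:
  "nord A (nord B v) = complex_contraction.contr mode_form A (\<lambda>X Y. nord (X @ Y) v) B"
  by (rule complex_contraction.wick_contr[where act = mode_pair])
    (simp_all add: clinear_props[OF clinear_mode] nord_Nil nord_Cons)

lemma clinear_foldr_mode_pair: "clinear (foldr mode_pair A)"
proof (induction A)
  case (Cons x A)
  show ?case using clinear_compose[OF clinear_mode Cons] by (simp add: o_def)
qed (simp add: clinear_iff)

lemma clinear_nord: "clinear (nord A)"
  unfolding clinear_iff nord_def
  by (simp add: clinear_props[OF clinear_foldr_mode_pair] scaleC_add_right scaleC_scaleC mult.commute)

lemma clinear_nord_slot: "clinear (\<lambda>h. nord (X @ (h, n) # Y) v)"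
proof -
  have slot: "clinear (\<lambda>h. foldr mode_pair A (mode h n w))" for A w
    using clinear_compose[OF clinear_foldr_mode_pair clinear_mode_left] .
  show ?thesis
  proof (cases "n < 0")
    case True
    then show ?thesis
      unfolding clinear_iff nord_def
      by (simp add: clinear_props[OF slot] scaleC_add_right scaleC_scaleC mult.commute)
  next
    case False
    then show ?thesis
      unfolding clinear_iff nord_def
      by (simp add: clinear_props[OF slot] clinear_props[OF clinear_foldr_mode_pair] scaleC_add_right scaleC_scaleC mult.commute)
  qed
qed

text \<open>The positive modes act first and keep the vector in stage \<open>N\<close> until the
  mode \<open>(h, n)\<close> annihilates it.\<close>

lemma nord_eq_0:
  assumes "v \<in> bounded_states N" "(h, n) \<in> set A" "n \<ge> int N"
  shows "nord A v = 0"
proof -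
  let ?P = "filter (\<lambda>x. \<not> snd x < 0) A"
  have "foldr mode_pair P v \<in> bounded_states N \<and> ((h, n) \<in> set P \<longrightarrow> foldr mode_pair P v = 0)"
    if "\<forall>x\<in>set P. snd x \<ge> 0" for P
    using that
  proof (induction P)
    case (Cons x P)
    then show ?case
      using mode_positive_bounded_states[of "foldr mode_pair P v" N "snd x"] assms(3)
      by (auto simp: clinear_props[OF clinear_mode])
  qed (use assms in simp)
  from this[of ?P] have "foldr mode_pair ?P v = 0" using assms by auto
  then show ?thesis
    unfolding nord_def by (simp add: clinear_props[OF clinear_foldr_mode_pair])
qed

section \<open>The normal ordering permutation and its sign\<close>

definition normal_list :: "int list \<Rightarrow> nat list"
  where "normal_list ns = filter (\<lambda>i. ns ! i < 0) [0..<length ns] @ filter (\<lambda>i. \<not> ns ! i < 0) [0..<length ns]"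

lemma set_normal_list: "set (normal_list ns) = {..<length ns}"
  and distinct_normal_list: "distinct (normal_list ns)"
  and length_normal_list: "length (normal_list ns) = length ns"
proof -
  show "set (normal_list ns) = {..<length ns}" "distinct (normal_list ns)"
    by (auto simp: normal_list_def)
  show "length (normal_list ns) = length ns"
    using sum_length_filter_compl[of "\<lambda>i. ns ! i < 0" "[0..<length ns]"] by (simp add: normal_list_def)
qed

definition list_perm :: "nat list \<Rightarrow> nat \<Rightarrow> nat"
  where "list_perm xs i = (if i < length xs then xs ! i else i)"

lemma list_perm_permutes:
  assumes "distinct xs" "set xs = {..<length xs}"
  shows "list_perm xs permutes {..<length xs}"
proof (rule bij_imp_permutes)
  have "bij_betw ((!) xs) {..<length xs} (set xs)"
    using assms(1) by (intro bij_betw_nth) auto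
  then show "bij_betw (list_perm xs) {..<length xs} {..<length xs}"
    using assms(2) by (subst bij_betw_cong[where g = "(!) xs"]) (simp_all add: list_perm_def)
qed (simp add: list_perm_def)

text \<open>Shifting the positions of the positive modes by the length turns the required order into
  the usual one. A strictly increasing list is determined by its set of entries, and this yields
  uniqueness.\<close>

lemma normal_perm_eq: "normal_perm ns = list_perm (normal_list ns)"
proof -
  let ?r = "length ns" and ?xs = "normal_list ns"
  let ?R = "\<lambda>a b. (ns ! a < 0 \<and> ns ! b \<ge> 0) \<or> ((ns ! a < 0 \<longleftrightarrow> ns ! b < 0) \<and> a < b)"
  define key where "key a = (if ns ! a < 0 then a else a + ?r)" for a
  have key: "?R a b \<longleftrightarrow> key a < key b" if "a < ?r" "b < ?r" for a b
    using that by (auto simp: key_def)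
  have inj: "inj_on key {..<?r}" by (auto simp: inj_on_def key_def split: if_splits)
  have "sorted_wrt ?R ?xs"
    by (auto simp: normal_list_def sorted_wrt_append sorted_wrt_filter
        intro!: sorted_wrt_mono_rel[OF _ sorted_wrt_filter[OF sorted_wrt_upt]])
  then have R: "?R (?xs ! i) (?xs ! j)" if "i < j" "j < ?r" for i j
    using that by (simp add: sorted_wrt_iff_nth_less length_normal_list)
  show ?thesis
    unfolding normal_perm_def
  proof (rule the_equality)
    show "list_perm ?xs permutes {..<?r} \<and> (\<forall>i j. i < j \<and> j < ?r \<longrightarrow> ?R (list_perm ?xs i) (list_perm ?xs j))"
      using R list_perm_permutes[OF distinct_normal_list] set_normal_list
      by (auto simp: list_perm_def length_normal_list)
  next
    fix \<sigma>
    assume \<sigma>: "\<sigma> permutes {..<?r} \<and> (\<forall>i j. i < j \<and> j < ?r \<longrightarrow> ?R (\<sigma> i) (\<sigma> j))"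
    have lt: "\<sigma> i < ?r" if "i < ?r" for i
      using permutes_in_image[of \<sigma> "{..<?r}" i] \<sigma> that by simp
    have "sorted_wrt (<) (map key (map \<sigma> [0..<?r]))"
      using \<sigma> key lt by (auto simp: sorted_wrt_iff_nth_less)
    moreover have "sorted_wrt (<) (map key ?xs)"
      using R key set_normal_list[of ns] nth_mem[of _ ?xs]
      by (auto simp: sorted_wrt_iff_nth_less length_normal_list)
    moreover have "set (map \<sigma> [0..<?r]) = {..<?r}"
      using permutes_image[of \<sigma> "{..<?r}"] \<sigma> by (simp add: lessThan_atLeast0)
    moreover from this have "set (map key (map \<sigma> [0..<?r])) = set (map key ?xs)"
      by (simp only: set_map[of key] set_normal_list)
    ultimately have "map key (map \<sigma> [0..<?r]) = map key ?xs"
      by (intro sorted_distinct_set_unique) (simp_all only: strict_sorted_iff)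
    then have "map \<sigma> [0..<?r] = ?xs"
      using inj \<open>set (map \<sigma> [0..<?r]) = {..<?r}\<close> set_normal_list[of ns]
      by (simp only: inj_on_map_eq_map Un_absorb)
    then have "\<sigma> i = ?xs ! i" if "i < ?r" for i
      using that nth_map[of i "[0..<?r]" \<sigma>] by simp
    moreover have "\<sigma> i = i" if "\<not> i < ?r" for i
      using \<sigma> that by (auto simp: permutes_def)
    ultimately show "\<sigma> = list_perm ?xs"
      by (auto simp: list_perm_def length_normal_list)
  qed
qed

lemma inversion_sign_snoc:
  "inversion_sign (ns @ [n]) =
    inversion_sign ns * (if n < 0 then (-1) ^ length (filter (\<lambda>n. \<not> n < 0) ns) else 1)"
  by (induction ns) (auto simp: power_add)

text \<open>The change of the permutation when a negative mode is appended: its position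
  \<open>r\<close> is inserted at slot \<open>q\<close>, between the two blocks, and the later slots
  move up by one. It is a product of \<open>r - q\<close> adjacent transpositions.\<close>

definition insertion_cycle :: "nat \<Rightarrow> nat \<Rightarrow> nat \<Rightarrow> nat"
  where "insertion_cycle q r i = (if i = q then r else if q < i \<and> i \<le> r then i - 1 else i)"

lemma insertion_cycle:
  "permutation (insertion_cycle q (q + d)) \<and> sign (insertion_cycle q (q + d)) = (-1) ^ d"
proof (induction d)
  case 0
  have "insertion_cycle q (q + 0) = id" by (auto simp: insertion_cycle_def)
  then show ?case by (simp add: sign_id)
next
  case (Suc d)
  let ?t = "transpose (q + d) (q + Suc d)"
  have "insertion_cycle q (q + Suc d) = ?t \<circ> insertion_cycle q (q + d)"
    by (auto simp: insertion_cycle_def transpose_def fun_eq_iff)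
  moreover have "sign ?t = -1" by (simp add: sign_swap_id)
  ultimately show ?case
    using Suc permutation_compose[OF permutation_swap_id, of "insertion_cycle q (q + d)"]
      sign_compose[OF permutation_swap_id, of "insertion_cycle q (q + d)"]
    by (metis power_Suc)
qed

text \<open>Induction from the right end, since appending a mode leaves the positions of the others
  unchanged; a new negative mode crosses exactly the positive modes before it.\<close>

lemma sign_normal_perm: "sign (normal_perm ns) = inversion_sign ns"
proof (induction ns rule: rev_induct)
  case Nil
  have "list_perm [] = id" by (auto simp: list_perm_def)
  then show ?case by (simp add: normal_perm_eq normal_list_def sign_id)
next
  case (snoc n ns)
  let ?r = "length ns"
  let ?N = "filter (\<lambda>i. ns ! i < 0) [0..<?r]" and ?P = "filter (\<lambda>i. \<not> ns ! i < 0) [0..<?r]"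
  have f: "filter (\<lambda>i. Q ((ns @ [n]) ! i)) [0..<?r] = filter (\<lambda>i. Q (ns ! i)) [0..<?r]" for Q
    by (rule filter_cong) (auto simp: nth_append)
  have nl: "normal_list (ns @ [n]) = (if n < 0 then ?N @ [?r] @ ?P else ?N @ ?P @ [?r])"
    using f[of "\<lambda>x. x < 0"] f[of "\<lambda>x. \<not> x < 0"] by (simp add: normal_list_def)
  have len: "length ?N + length ?P = ?r"
    using length_normal_list[of ns] by (simp add: normal_list_def)
  have perm: "permutation (normal_perm ns)"
    using list_perm_permutes[OF distinct_normal_list, of ns]
    unfolding permutation_permutes normal_perm_eq length_normal_list set_normal_list by blast
  show ?case
  proof (cases "n < 0")
    case True
    have "normal_perm (ns @ [n]) = normal_perm ns \<circ> insertion_cycle (length ?N) (length ?N + length ?P)"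
      using True len unfolding normal_perm_eq nl normal_list_def[of ns]
      by (auto simp: fun_eq_iff list_perm_def insertion_cycle_def nth_append nth_Cons split: nat.splits)
        (simp_all add: Suc_diff_le not_less)
    moreover have "length ?P = length (filter (\<lambda>n. \<not> n < 0) ns)"
      by (subst (3) map_nth[symmetric]) (simp add: filter_map o_def)
    ultimately show ?thesis
      using sign_compose[OF perm, of "insertion_cycle (length ?N) (length ?N + length ?P)"]
        insertion_cycle[of "length ?N" "length ?P"] snoc True
      by (simp only: inversion_sign_snoc if_True)
  next
    case False
    have "normal_perm (ns @ [n]) = normal_perm ns"
      using False len unfolding normal_perm_eq nl normal_list_def[of ns]
      by (auto simp: fun_eq_iff list_perm_def nth_append)
    then show ?thesis using snoc False by (simp add: inversion_sign_snoc)
  qed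
qed

lemma normal_ordered_modes_eq:
  assumes "length hs = length ns"
  shows "normal_ordered_modes hs ns v = nord (zip hs ns) v"
proof -
  let ?r = "length ns"
  have "map (normal_perm ns) [0..<?r] = normal_list ns"
    by (rule nth_equalityI) (simp_all add: normal_perm_eq list_perm_def length_normal_list)
  then have perm: "foldr (\<lambda>i. mode (hs ! normal_perm ns i) (ns ! normal_perm ns i)) [0..<?r] v =
      foldr (\<lambda>j. mode (hs ! j) (ns ! j)) (normal_list ns) v"
    using foldr_map[of "\<lambda>j. mode (hs ! j) (ns ! j)" "normal_perm ns" "[0..<?r]" v] by (simp add: o_def)
  have eq: "foldr (\<lambda>j. mode (hs ! j) (ns ! j)) (filter (\<lambda>j. Q (ns ! j)) [0..<?r]) w =
      foldr mode_pair (filter (\<lambda>x. Q (snd x)) (zip hs ns)) w" for Q w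
  proof -
    have "zip hs ns = map (\<lambda>j. (hs ! j, ns ! j)) [0..<?r]"
      using assms by (intro nth_equalityI) simp_all
    then show ?thesis by (simp add: filter_map foldr_map o_def)
  qed
  have "map snd (zip hs ns) = ns" using assms by simp
  then show ?thesis
    unfolding normal_ordered_modes_def Let_def nord_def sign_normal_perm perm
    by (simp add: normal_list_def eq[of "\<lambda>x. x < 0"] eq[of "\<lambda>x. \<not> x < 0"])
qed

section \<open>The universal property of the induced module\<close>

definition linear_extension :: "('k \<Rightarrow> 'v::complex_vector) \<Rightarrow> ('k \<Rightarrow>\<^sub>0 complex) \<Rightarrow> 'v"
  where "linear_extension F p = (\<Sum>k\<in>Poly_Mapping.keys p. Poly_Mapping.lookup p k *\<^sub>C F k)"

lemma linear_extension_single [simp]: "linear_extension F (Poly_Mapping.single k c) = c *\<^sub>C F k"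
  by (simp add: linear_extension_def)

lemma linear_extension_superset:
  assumes "finite K" "Poly_Mapping.keys p \<subseteq> K"
  shows "linear_extension F p = (\<Sum>k\<in>K. Poly_Mapping.lookup p k *\<^sub>C F k)"
  unfolding linear_extension_def using assms
  by (intro sum.mono_neutral_left) (auto simp: in_keys_iff)

lemma clinear_linear_extension: "clinear (linear_extension F)"
  unfolding clinear_iff
proof (intro conjI allI)
  fix p q :: "'a \<Rightarrow>\<^sub>0 complex" and c
  let ?K = "Poly_Mapping.keys p \<union> Poly_Mapping.keys q"
  have "Poly_Mapping.keys (p + q) \<subseteq> ?K" by (auto dest: subsetD[OF keys_add])
  then show "linear_extension F (p + q) = linear_extension F p + linear_extension F q"
    by (simp add: linear_extension_superset[of ?K] lookup_add scaleC_add_left sum.distrib)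
  have "Poly_Mapping.keys (c *\<^sub>C p) \<subseteq> Poly_Mapping.keys p" by (auto simp: in_keys_iff)
  then show "linear_extension F (c *\<^sub>C p) = c *\<^sub>C linear_extension F p"
    by (simp add: linear_extension_superset[of "Poly_Mapping.keys p"]
        complex_vector.scale_sum_right scaleC_complex_def)
qed

lemmas linear_extension_linear = clinear_props[OF clinear_linear_extension]

lemma single_eq_scaleC: "Poly_Mapping.single k c = c *\<^sub>C Poly_Mapping.single k (1::complex)"
  by (rule poly_mapping_eqI) (simp add: lookup_single when_def scaleC_complex_def)

lemma clinear_linear_extension_fun:
  assumes "\<And>k. clinear (\<lambda>x. F x k)"
  shows "clinear (\<lambda>x. linear_extension (F x) p)"
  unfolding clinear_iff linear_extension_def
  by (simp add: clinear_props[OF assms] scaleC_add_right sum.distrib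
      complex_vector.scale_sum_right scaleC_scaleC mult.commute)

lemma clinear_linear_extension_eq:
  assumes "clinear f"
  shows "f p = linear_extension (\<lambda>k. f (Poly_Mapping.single k 1)) p"
proof (induction p rule: poly_mapping_add_induct)
  case (single k c)
  show ?case by (subst single_eq_scaleC) (simp add: clinear_props[OF assms])
next
  case (add p q)
  then show ?case by (simp add: clinear_props[OF assms] linear_extension_linear)
qed

lemma clinear_eqI:
  assumes "clinear f" "clinear g" "\<And>k. f (Poly_Mapping.single k 1) = g (Poly_Mapping.single k 1)"
  shows "f (p :: 'k \<Rightarrow>\<^sub>0 complex) = (g p :: 'v::complex_vector)"
  using clinear_linear_extension_eq[OF assms(1), of p] clinear_linear_extension_eq[OF assms(2), of p]
    assms(3) by simp

definition word_action :: "('w \<Rightarrow> 'v \<Rightarrow> 'v) \<Rightarrow> ('w list \<Rightarrow>\<^sub>0 complex) \<Rightarrow> 'v::complex_vector \<Rightarrow> 'v"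
  where "word_action \<rho> p v = linear_extension (\<lambda>us. foldr \<rho> us v) p"

lemma clinear_word_action_left: "clinear (\<lambda>p. word_action \<rho> p v)"
  unfolding word_action_def by (rule clinear_linear_extension)

lemma clinear_foldr: "(\<And>u. clinear (\<rho> u)) \<Longrightarrow> clinear (foldr \<rho> us)"
proof (induction us)
  case (Cons u us)
  then show ?case using clinear_compose[of "\<rho> u" "foldr \<rho> us"] by (simp add: o_def)
qed (simp add: clinear_iff)

lemma clinear_word_action: "(\<And>u. clinear (\<rho> u)) \<Longrightarrow> clinear (word_action \<rho> p)"
  unfolding word_action_def by (intro clinear_linear_extension_fun) (rule clinear_foldr)

lemma word_action_mult:
  assumes "\<And>u. clinear (\<rho> u)"
  shows "word_action \<rho> (p * q) v = word_action \<rho> p (word_action \<rho> q v)"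
proof (induction p rule: poly_mapping_add_induct)
  case (single us c)
  show ?case
  proof (induction q rule: poly_mapping_add_induct)
    case (single vs d)
    show ?case
      by (simp add: word_action_def mult_single plus_list_def clinear_props[OF clinear_foldr[OF assms]] scaleC_scaleC)
  next
    case (add p q)
    then show ?case
      by (simp add: distrib_left clinear_props[OF clinear_word_action_left]
          clinear_props[OF clinear_word_action[OF assms]])
  qed
next
  case (add p q)
  then show ?case by (simp add: distrib_right clinear_props[OF clinear_word_action_left])
qed

text \<open>The elements that act as zero form a two-sided ideal, and it contains the relations
  because the action is bilinear.\<close>

lemma word_action_tensor_relations:
  assumes "\<And>u. clinear (\<rho> u)" "\<And>v. clinear (\<lambda>u. \<rho> u v)" "p \<in> ideal_generated tensor_relations"
  shows "word_action \<rho> p v = 0"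
proof -
  note l = clinear_props[OF clinear_word_action_left] clinear_props[OF clinear_word_action[OF assms(1)]]
  let ?I = "{p. \<forall>v. word_action \<rho> p v = 0}"
  have "ideal_generated tensor_relations \<subseteq> ?I"
  proof (rule hull_minimal)
    have "word_action \<rho> (word [u]) v = \<rho> u v" for u v
      by (simp add: word_action_def word_def scaleC_one)
    then show "tensor_relations \<subseteq> ?I"
      by (auto simp: tensor_relations_def l clinear_props[OF assms(2)])
    show "two_sided_ideal ?I"
      by (auto simp: two_sided_ideal_def l word_action_mult[OF assms(1)])
  qed
  then show ?thesis using assms(3) by blast
qed

type_synonym 'h fock_word = "('h \<times> nat) list"

abbreviation pm_word :: "'a list \<Rightarrow> 'a list \<Rightarrow>\<^sub>0 complex"
  where "pm_word k \<equiv> Poly_Mapping.single k 1"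

text \<open>A basis of \<open>\<hh>\<close> turns \<open>T(\<hh>\<^sup>-)\<close> into the space of finitely supported functions on words in the
  basis vectors, where linear maps are free to prescribe. On it the negative modes act by left
  multiplication and the positive modes by skew derivations.\<close>

definition coord :: "'h::complex_vector \<Rightarrow> 'h \<Rightarrow> complex"
  where "coord = complex_vector.representation (complex_vector.extend_basis {})"

lemma finite_coord: "finite {b. coord h b \<noteq> 0}"
  unfolding coord_def by (rule complex_vector.finite_representation)

text \<open>The value at \<open>h\<close> of the linear map with the prescribed values
  \<open>F\<close> on the basis.\<close>

definition coord_sum :: "'h::complex_vector \<Rightarrow> ('h \<Rightarrow> 'v::complex_vector) \<Rightarrow> 'v"
  where "coord_sum h F = (\<Sum>b | coord h b \<noteq> 0. coord h b *\<^sub>C F b)"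

lemma coord_basis:
  "complex_vector.independent (complex_vector.extend_basis ({} :: 'h::complex_vector set))"
  "h \<in> complex_vector.span (complex_vector.extend_basis ({} :: 'h::complex_vector set))"
  using complex_vector.independent_extend_basis[OF complex_vector.independent_empty]
    complex_vector.span_extend_basis[OF complex_vector.independent_empty] by auto

lemma coord_linear: "coord (g + h) b = coord g b + coord h b" "coord (c *\<^sub>C h) b = c * coord h b"
  unfolding coord_def
  using complex_vector.representation_add[OF coord_basis(1) coord_basis(2) coord_basis(2), of g h]
    complex_vector.representation_scale[OF coord_basis(1) coord_basis(2), of c h] by auto

lemma coord_sum_superset:
  assumes "finite B" "{b. coord h b \<noteq> 0} \<subseteq> B"
  shows "coord_sum h F = (\<Sum>b\<in>B. coord h b *\<^sub>C F b)"
  unfolding coord_sum_def using assms by (intro sum.mono_neutral_left) auto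

lemma clinear_coord_sum: "clinear (\<lambda>h. coord_sum h F)"
  unfolding clinear_iff
proof (intro conjI allI)
  fix g h :: 'a and c
  let ?B = "{b. coord g b \<noteq> 0} \<union> {b. coord h b \<noteq> 0}"
  have *: "finite ?B" using finite_coord by auto
  have "coord_sum (g + h) F = (\<Sum>b\<in>?B. coord (g + h) b *\<^sub>C F b)"
    by (rule coord_sum_superset[OF *]) (auto simp: coord_linear)
  moreover have "coord_sum g F = (\<Sum>b\<in>?B. coord g b *\<^sub>C F b)" "coord_sum h F =
      (\<Sum>b\<in>?B. coord h b *\<^sub>C F b)"
    by (rule coord_sum_superset[OF *]; auto)+
  ultimately show "coord_sum (g + h) F = coord_sum g F + coord_sum h F"
    by (simp add: coord_linear scaleC_add_left sum.distrib)
  show "coord_sum (c *\<^sub>C h) F = c *\<^sub>C coord_sum h F"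
    by (subst coord_sum_superset[of "{b. coord h b \<noteq> 0}"])
      (auto simp: finite_coord coord_linear coord_sum_def complex_vector.scale_sum_right scaleC_scaleC)
qed

lemma coord_sum_linear:
  assumes "clinear f"
  shows "coord_sum h f = f h"
proof -
  have "f (coord_sum h (\<lambda>b. b)) = coord_sum h f"
    by (simp add: coord_sum_def clinear_props[OF assms])
  moreover have "coord_sum h (\<lambda>b. b) = h"
    unfolding coord_sum_def coord_def
    by (rule complex_vector.sum_nonzero_representation_eq[OF coord_basis])
  ultimately show ?thesis by simp
qed

lemma coord_sum_image: "clinear f \<Longrightarrow> f (coord_sum h F) = coord_sum h (\<lambda>b. f (F b))"
  by (simp add: coord_sum_def clinear_props)

text \<open>Expanding \<open>h\<close> in the basis first makes this linear in \<open>h\<close>;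
  prepending the letter \<open>(h, m)\<close> itself would not be.\<close>

definition word_negative :: "'h::complex_bilinear_space \<Rightarrow> nat \<Rightarrow> ('h fock_word \<Rightarrow>\<^sub>0 complex) \<Rightarrow>
    'h fock_word \<Rightarrow>\<^sub>0 complex"
  where "word_negative h m = linear_extension (\<lambda>k. coord_sum h (\<lambda>b. pm_word ((b, m) # k)))"

definition word_form :: "'h::complex_bilinear_space \<Rightarrow> int \<Rightarrow> 'h \<times> nat \<Rightarrow> complex"
  where "word_form a n x = form a (fst x) * of_bool (n = int (snd x))"

definition word_positive :: "'h::complex_bilinear_space \<Rightarrow> int \<Rightarrow> ('h fock_word \<Rightarrow>\<^sub>0 complex) \<Rightarrow>
    'h fock_word \<Rightarrow>\<^sub>0 complex"
  where "word_positive a n = linear_extension (\<lambda>k. complex_contraction.del (word_form a n) k pm_word)"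

definition word_mode :: "'h::complex_bilinear_space \<Rightarrow> int \<Rightarrow> ('h fock_word \<Rightarrow>\<^sub>0 complex) \<Rightarrow>
    'h fock_word \<Rightarrow>\<^sub>0 complex"
  where "word_mode a n = (if n < 0 then word_negative a (nat (- n - 1)) else word_positive a n)"

lemma clinear_word_mode: "clinear (word_mode a n)"
  by (simp add: word_mode_def word_negative_def word_positive_def clinear_linear_extension)

lemma form_right: "form x (y + z) = form x y + form x z" "form x (c *\<^sub>C y) = c * form x y"
  by (metis form_sym form_add_left, metis form_sym form_scaleC_left)

lemma clinear_word_mode_left: "clinear (\<lambda>a. word_mode a n w)"
proof (cases "n < 0")
  case True
  then show ?thesis
    unfolding word_mode_def word_negative_def
    by (simp add: clinear_linear_extension_fun clinear_coord_sum)
next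
  case False
  have "clinear (\<lambda>a. complex_contraction.del (word_form a n) k F)"
    for k :: "'a fock_word" and F :: "_ \<Rightarrow> 'a fock_word \<Rightarrow>\<^sub>0 complex"
    unfolding clinear_iff
    by (induction k arbitrary: F)
      (auto simp: word_form_def form_add_left form_scaleC_left distrib_right scaleC_add_left
        complex_vector.scale_right_diff_distrib scaleC_scaleC mult.assoc)
  then show ?thesis
    using False unfolding word_mode_def word_positive_def
    by (simp add: clinear_linear_extension_fun)
qed

text \<open>Deleting a letter of \<open>(b, n') # k\<close> removes either the new letter, which
  gives the form, or a letter of \<open>k\<close>, now with the opposite sign. The basis expansion
  of \<open>b\<close> disappears from the first term because the form is linear.\<close>

lemma word_mode_anticommute:
  assumes "0 \<le> m" "n < 0"
  shows "word_mode a m (word_mode b n w) + word_mode b n (word_mode a m w) =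
    (form a b * of_bool (m + n + 1 = 0)) *\<^sub>C w"
proof (rule clinear_eqI[where p = w], goal_cases)
  case 1
  show ?case
    by (simp add: clinear_iff clinear_props[OF clinear_word_mode] scaleC_add_right)
next
  case 2
  show ?case by (simp add: clinear_iff scaleC_add_right scaleC_scaleC mult.commute)
next
  case (3 k)
  define n' where "n' = nat (- n - 1)"
  let ?del = "complex_contraction.del (word_form a m)"
  have neg: "word_mode b n = word_negative b n'" using assms by (simp add: word_mode_def n'_def)
  have pos: "word_mode a m = word_positive a m" using assms by (simp add: word_mode_def)
  have "clinear (\<lambda>b. (form a b * of_bool (m = int n')) *\<^sub>C pm_word k)"
    by (simp add: clinear_iff form_right distrib_right scaleC_add_left scaleC_scaleC mult.assoc)
  note form = coord_sum_linear[OF this, of b]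
  have "word_negative b n' (?del k pm_word) = ?del k (\<lambda>X. coord_sum b (\<lambda>b. pm_word ((b, n') # X)))"
    using complex_contraction.del_linear_image[of "word_negative b n'" "word_form a m" k pm_word]
    by (simp add: word_negative_def linear_extension_linear scaleC_one)
  moreover have "word_positive a m (coord_sum b (\<lambda>b. pm_word ((b, n') # k))) =
      coord_sum b (\<lambda>b. word_form a m (b, n') *\<^sub>C pm_word k - ?del k (\<lambda>X. pm_word ((b, n') # X)))"
    by (simp add: word_positive_def scaleC_one coord_sum_image[OF clinear_linear_extension])
  moreover have "coord_sum b (\<lambda>b. F b - G b) = coord_sum b F - coord_sum b G" for F G :: "'a \<Rightarrow>
      'a fock_word \<Rightarrow>\<^sub>0 complex"
    by (simp add: coord_sum_def complex_vector.scale_right_diff_distrib sum_subtractf)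
  moreover have "coord_sum b (\<lambda>b. ?del k (\<lambda>X. pm_word ((b, n') # X))) =
      ?del k (\<lambda>X. coord_sum b (\<lambda>b. pm_word ((b, n') # X)))"
  proof -
    have "?del k (\<lambda>X. \<Sum>b\<in>B. c b *\<^sub>C H b X) = (\<Sum>b\<in>B. c b *\<^sub>C ?del k (H b))" if "finite B"
      for B :: "'a set" and c and H :: "'a \<Rightarrow> 'a fock_word \<Rightarrow> 'a fock_word \<Rightarrow>\<^sub>0 complex"
      using that
    proof (induction B rule: finite_induct)
      case empty
      show ?case using complex_contraction.del_scale[of "word_form a m" k 0 "\<lambda>_. 0"] by simp
    next
      case (insert b B)
      then show ?case by (simp add: complex_contraction.del_add complex_contraction.del_scale)
    qed
    from this[OF finite_coord] show ?thesis unfolding coord_sum_def by simp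
  qed
  ultimately show ?case
    unfolding neg pos using form assms
    by (simp add: word_negative_def word_positive_def scaleC_one word_form_def n'_def)
qed

section \<open>Passing from words to the algebra and to the induced module\<close>

definition word_generator :: "'h::complex_bilinear_space affine \<Rightarrow> ('h fock_word \<Rightarrow>\<^sub>0 complex) \<Rightarrow>
    'h fock_word \<Rightarrow>\<^sub>0 complex"
  where "word_generator u w =
    (\<Sum>m\<in>Poly_Mapping.keys (fst u). word_mode (Poly_Mapping.lookup (fst u) m) m w) + snd u *\<^sub>C w"

lemma clinear_word_generator: "clinear (word_generator u)"
  unfolding clinear_iff word_generator_def
  by (simp add: clinear_props[OF clinear_word_mode] scaleC_add_right scaleC_scaleC mult.commute
      sum.distrib complex_vector.scale_sum_right)

lemma clinear_word_generator_left: "clinear (\<lambda>u. word_generator u w)"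
proof -
  note l = clinear_props[OF clinear_word_mode_left]
  have superset: "word_generator u w = (\<Sum>m\<in>K. word_mode (Poly_Mapping.lookup (fst u) m) m w) +
      snd u *\<^sub>C w"
    if "finite K" "Poly_Mapping.keys (fst u) \<subseteq> K" for u K
    unfolding word_generator_def using that
    by (intro arg_cong2[where f = "(+)"] sum.mono_neutral_left) (auto simp: in_keys_iff l)
  show ?thesis
    unfolding clinear_iff
  proof (intro conjI allI)
    fix u v :: "'a affine" and c
    let ?K = "Poly_Mapping.keys (fst u) \<union> Poly_Mapping.keys (fst v)"
    have "Poly_Mapping.keys (fst (u + v)) \<subseteq> ?K" by (auto dest: subsetD[OF keys_add])
    then show "word_generator (u + v) w = word_generator u w + word_generator v w"
      by (simp add: superset[of ?K] lookup_add l sum.distrib scaleC_add_left)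
    have "Poly_Mapping.keys (fst (c *\<^sub>C u)) \<subseteq> Poly_Mapping.keys (fst u)"
      by (auto simp: in_keys_iff scaleC_prod_def)
    then show "word_generator (c *\<^sub>C u) w = c *\<^sub>C word_generator u w"
      by (simp add: superset[of "Poly_Mapping.keys (fst u)"] scaleC_prod_def l scaleC_complex_def
          scaleC_add_right scaleC_scaleC complex_vector.scale_sum_right)
  qed
qed

lift_definition tensor_action :: "'h::complex_bilinear_space affine tensor_algebra \<Rightarrow>
    ('h fock_word \<Rightarrow>\<^sub>0 complex) \<Rightarrow> 'h fock_word \<Rightarrow>\<^sub>0 complex" is "word_action word_generator"
proof (rule ext)
  fix p q :: "'h affine list \<Rightarrow>\<^sub>0 complex" and w
  assume "p - q \<in> ideal_generated tensor_relations"
  from word_action_tensor_relations[OF clinear_word_generator clinear_word_generator_left this, of w]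
  show "word_action word_generator p w = word_action word_generator q w"
    by (simp add: clinear_props[OF clinear_word_action_left])
qed

lemma tensor_action_mult: "tensor_action (x * y) w = tensor_action x (tensor_action y w)"
  by transfer (rule word_action_mult[OF clinear_word_generator])

lemma clinear_tensor_action_left: "clinear (\<lambda>x. tensor_action x w)"
proof -
  have "tensor_action (x + y) w = tensor_action x w + tensor_action y w" for x y
    by transfer (rule clinear_props(1)[OF clinear_word_action_left])
  moreover have "tensor_action (c *\<^sub>C x) w = c *\<^sub>C tensor_action x w" for c x
    by transfer (rule clinear_props(2)[OF clinear_word_action_left])
  ultimately show ?thesis by (simp add: clinear_iff)
qed

lemma clinear_tensor_action: "clinear (tensor_action x)"
  by transfer (rule clinear_word_action[OF clinear_word_generator])

lemma tensor_action_one: "tensor_action 1 w = w"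
proof transfer
  fix w :: "'a fock_word \<Rightarrow>\<^sub>0 complex"
  have one: "(1 :: 'a affine list \<Rightarrow>\<^sub>0 complex) = pm_word []"
    by (simp add: zero_list_def flip: single_one)
  show "word_action word_generator 1 w = w"
    unfolding one by (simp add: word_action_def scaleC_one)
qed

lemma tensor_action_gen: "tensor_action (tensor_gen u) w = word_generator u w"
  by transfer (simp add: word_action_def word_def scaleC_one)

lemmas tensor_action_hom = tensor_action_mult clinear_props[OF clinear_tensor_action_left]
  tensor_action_one tensor_action_gen

lemma tensor_action_mode: "tensor_action (tensor_mode a m) w = word_mode a m w"
  using clinear_props(3)[OF clinear_word_mode_left[of m w]]
  by (simp add: tensor_mode_def tensor_action_hom word_generator_def)

lemma tensor_action_central: "tensor_action tensor_central w = w"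
  by (simp add: tensor_central_def tensor_action_hom word_generator_def scaleC_one)

lift_definition algebra_action :: "'h::complex_bilinear_space mode_algebra \<Rightarrow>
    ('h fock_word \<Rightarrow>\<^sub>0 complex) \<Rightarrow> 'h fock_word \<Rightarrow>\<^sub>0 complex" is tensor_action
proof (rule ext)
  fix x y :: "'h affine tensor_algebra" and w
  let ?I = "{x :: 'h affine tensor_algebra. \<forall>w. tensor_action x w = 0}"
  have "ideal_generated mode_relations \<subseteq> ?I"
  proof (rule hull_minimal)
    show "mode_relations \<subseteq> ?I"
    proof
      fix x :: "'h affine tensor_algebra"
      assume "x \<in> mode_relations"
      then consider a b m n where "m \<ge> 0" "n \<le> -1" "x = tensor_mode a m * tensor_mode b n
          + tensor_mode b n * tensor_mode a m - (form a b * of_bool (m + n + 1 = 0)) *\<^sub>C tensor_central"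
        | a k where "x = tensor_mode a k * tensor_central - tensor_central * tensor_mode a k"
        unfolding mode_relations_def by blast
      then show "x \<in> ?I"
      proof cases
        case 1
        have "word_mode a m (word_mode b n w) + word_mode b n (word_mode a m w) =
            (form a b * of_bool (m + n + 1 = 0)) *\<^sub>C w" for w
          using word_mode_anticommute[of m n a b w] 1 by simp
        then show ?thesis
          by (simp only: 1 mem_Collect_eq tensor_action_hom tensor_action_mode tensor_action_central
              diff_self simp_thms)
      next
        case 2
        then show ?thesis
          by (simp add: tensor_action_hom tensor_action_mode tensor_action_central)
      qed
    qed
    show "two_sided_ideal ?I"
      by (auto simp: two_sided_ideal_def tensor_action_hom clinear_props(3)[OF clinear_tensor_action])
  qed
  moreover assume "x - y \<in> ideal_generated mode_relations"
  ultimately have "tensor_action (x - y) w = 0" by blast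
  then show "tensor_action x w = tensor_action y w" by (simp add: tensor_action_hom)
qed

lemma algebra_action_mult: "algebra_action (x * y) w = algebra_action x (algebra_action y w)"
  by transfer (rule tensor_action_mult)

lemma clinear_algebra_action_left: "clinear (\<lambda>x. algebra_action x w)"
proof -
  have "algebra_action (x + y) w = algebra_action x w + algebra_action y w" for x y
    by transfer (rule clinear_props(1)[OF clinear_tensor_action_left])
  moreover have "algebra_action (c *\<^sub>C x) w = c *\<^sub>C algebra_action x w" for c x
    by transfer (rule clinear_props(2)[OF clinear_tensor_action_left])
  ultimately show ?thesis by (simp add: clinear_iff)
qed

lemma clinear_algebra_action: "clinear (algebra_action x)"
  by transfer (rule clinear_tensor_action)

lemma algebra_action_one: "algebra_action 1 w = w"
  by transfer (rule tensor_action_one)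

lemma algebra_action_mode: "algebra_action (mode_element a m) w = word_mode a m w"
  by transfer (rule tensor_action_mode)

lemma algebra_action_central: "algebra_action central_element w = w"
  by transfer (rule tensor_action_central)

text \<open>The empty word spans a copy of the one-dimensional module; therefore
  \<open>fock_word_map\<close> respects the balancing relations.\<close>

lemma algebra_action_vacuum:
  assumes "vacuum_action b e"
  shows "algebra_action b (pm_word []) = e *\<^sub>C pm_word []"
  using assms
proof induction
  case (positive m a)
  then show ?case by (simp add: algebra_action_mode word_mode_def word_positive_def scaleC_one)
next
  case (mult b e b' e')
  then show ?case
    by (simp add: algebra_action_mult clinear_props[OF clinear_algebra_action] scaleC_scaleC mult.commute)
qed (simp_all add: algebra_action_central algebra_action_one clinear_props[OF clinear_algebra_action_left]
    scaleC_one scaleC_add_left scaleC_scaleC)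

lift_definition fock_word_map :: "'h::complex_bilinear_space fock_space \<Rightarrow> 'h fock_word \<Rightarrow>\<^sub>0 complex"
  is "linear_extension (\<lambda>(n, z). z *\<^sub>C algebra_action n (pm_word []))"
proof -
  fix p q :: "'h mode_algebra \<times> complex \<Rightarrow>\<^sub>0 complex"
  let ?f = "linear_extension (\<lambda>(n, z). z *\<^sub>C algebra_action n (pm_word []))"
  assume "p - q \<in> complex_vector.span induction_relations"
  then have "?f (p - q) = 0"
  proof (induction rule: complex_vector.span_induct)
    case base
    show ?case
      by (auto simp: complex_vector.subspace_def linear_extension_linear)
  next
    case (step r)
    have f: "?f (pure_tensor n z) = z *\<^sub>C algebra_action n (pm_word [])" for n :: "'h mode_algebra" and z
      by (simp add: pure_tensor_def scaleC_one)
    have "\<exists>n n' z z' b c e. r = pure_tensor (n + n') z - pure_tensor n z - pure_tensor n' z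
      \<or> r = pure_tensor n (z + z') - pure_tensor n z - pure_tensor n z'
      \<or> r = pure_tensor (c *\<^sub>C n) z - c *\<^sub>C pure_tensor n z
      \<or> r = pure_tensor n (c * z) - c *\<^sub>C pure_tensor n z
      \<or> (r = pure_tensor (n * b) z - pure_tensor n (e * z) \<and> vacuum_action b e)"
      using step unfolding induction_relations_def by blast
    then show ?case
      by (elim exE disjE conjE)
        (simp_all add: linear_extension_linear f algebra_action_mult algebra_action_vacuum
          clinear_props[OF clinear_algebra_action] clinear_props[OF clinear_algebra_action_left]
          scaleC_add_left scaleC_add_right scaleC_scaleC mult.commute)
  qed
  then show "?f p = ?f q" by (simp add: linear_extension_linear)
qed

lemma clinear_fock_word_map: "clinear fock_word_map"
  unfolding clinear_iff
  by (intro conjI allI; transfer; simp add: linear_extension_linear)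

lemma fock_word_map_vacuum: "fock_word_map vacuum = pm_word []"
  by transfer (simp add: pure_tensor_def scaleC_one algebra_action_one)

lemma fock_word_map_mode: "fock_word_map (mode a m v) = word_mode a m (fock_word_map v)"
proof -
  have "fock_word_map (action x v) = algebra_action x (fock_word_map v)" for x
  proof (induction v rule: fock_space.abs_induct)
    fix p :: "'a mode_algebra \<times> complex \<Rightarrow>\<^sub>0 complex"
    let ?f = "linear_extension (\<lambda>(n, z). z *\<^sub>C algebra_action n (pm_word []))"
    have "?f (left_mult x p) = algebra_action x (?f p)"
    proof (rule clinear_eqI[where p = p])
      show "clinear (\<lambda>p. ?f (left_mult x p))" "clinear (\<lambda>p. algebra_action x (?f p))"
        using clinear_compose clinear_linear_extension clinear_left_mult clinear_algebra_action by blast+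
      fix k :: "'a mode_algebra \<times> complex"
      show "?f (left_mult x (Poly_Mapping.single k 1)) =
          algebra_action x (?f (Poly_Mapping.single k 1))"
        using left_mult_pure[of x "fst k" "snd k"]
        by (simp add: pure_tensor_def scaleC_one case_prod_beta algebra_action_mult
            clinear_props[OF clinear_algebra_action])
    qed
    then show "fock_word_map (action x (abs_fock_space p)) =
        algebra_action x (fock_word_map (abs_fock_space p))"
      by (simp add: action.abs_eq fock_word_map.abs_eq)
  qed
  then show ?thesis by (simp add: mode_def algebra_action_mode)
qed

text \<open>This is the isomorphism \<open>V \<cong> T(\<hh>\<^sup>-)\<close> in the form of a universal property.\<close>

theorem state_extension:
  fixes G :: "('h::complex_bilinear_space \<times> nat) list \<Rightarrow> 'v::complex_vector"
  assumes "\<And>X m Y. clinear (\<lambda>h. G (X @ (h, m) # Y))"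
  obtains f where "clinear f" "\<And>hs. f (state hs) = G hs"
proof
  let ?f = "\<lambda>u. linear_extension G (fock_word_map u)"
  show "clinear ?f" by (rule clinear_compose[OF clinear_linear_extension clinear_fock_word_map])
  \<comment> \<open>The prefix \<open>P\<close> collects the letters already split off, so that the
    linearity of \<open>G\<close> can be used in the slot behind them.\<close>
  have "linear_extension (\<lambda>k. G (P @ k)) (fock_word_map (state hs)) = G (P @ hs)" for P hs
  proof (induction hs arbitrary: P)
    case Nil
    show ?case by (simp add: state_Nil fock_word_map_vacuum scaleC_one)
  next
    case (Cons x hs)
    obtain h m where x: "x = (h, m)" by (cases x)
    let ?F = "\<lambda>k. G (P @ k)"
    have "linear_extension ?F (word_negative h m w) =
        linear_extension (\<lambda>k. G ((P @ [(h, m)]) @ k)) w" for w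
    proof (rule clinear_eqI[where p = w])
      show "clinear (\<lambda>w. linear_extension ?F (word_negative h m w))"
        unfolding word_negative_def
        by (rule clinear_compose[OF clinear_linear_extension clinear_linear_extension])
      fix k :: "'h fock_word"
      show "linear_extension ?F (word_negative h m (pm_word k)) =
          linear_extension (\<lambda>k. G ((P @ [(h, m)]) @ k)) (pm_word k)"
        using coord_sum_linear[OF assms[of P m k], of h]
        by (simp add: word_negative_def scaleC_one coord_sum_image[OF clinear_linear_extension])
    qed (rule clinear_linear_extension)
    then show ?case
      using Cons[of "P @ [(h, m)]"] by (simp add: x state_Cons fock_word_map_mode word_mode_def)
  qed
  from this[of "[]"] show "?f (state hs) = G hs" for hs by simp
qed

section \<open>Normal-ordered products of series\<close>

lemma clinear_scale: "clinear f \<Longrightarrow> clinear (\<lambda>x. c *\<^sub>C f x)"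
  by (simp add: clinear_iff scaleC_add_right scaleC_scaleC mult.commute)

lemma clinear_sum:
  assumes "\<And>i. i \<in> I \<Longrightarrow> clinear (f i)"
  shows "clinear (\<lambda>x. \<Sum>i\<in>I. f i x)"
  unfolding clinear_iff
  using assms by (simp add: clinear_props sum.distrib complex_vector.scale_sum_right)

type_synonym ('h, 'x) factor = "'h \<times> nat \<times> 'x"

definition factor_exponent :: "('h, 'x) factor list \<Rightarrow> int list \<Rightarrow> 'x \<Rightarrow> int"
  where "factor_exponent fs ns x =
    (\<Sum>i | i < length fs \<and> snd (snd (fs ! i)) = x. - ns ! i - int (fst (snd (fs ! i))) - 1)"

definition factor_coeff :: "('h, 'x) factor list \<Rightarrow> int list \<Rightarrow> complex"
  where "factor_coeff fs ns = (\<Prod>i<length fs. of_int (- ns ! i - 1) gchoose fst (snd (fs ! i)))"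

text \<open>On a vector of stage \<open>N\<close>, only these lists of indices can contribute to the
  coefficient at \<open>e\<close>.\<close>

definition admissible :: "int \<Rightarrow> ('h, 'x) factor list \<Rightarrow> ('x \<Rightarrow> int) \<Rightarrow> int list set"
  where "admissible N fs e = {ns. length ns =
      length fs \<and> (\<forall>n\<in>set ns. n < N) \<and> factor_exponent fs ns = e}"

lemma factor_exponent_ge:
  assumes "length ns = length fs" "\<forall>n\<in>set ns. n < N"
  shows "factor_exponent fs ns x \<ge> - (\<Sum>i<length fs. \<bar>N\<bar> + int (fst (snd (fs ! i))))"
proof -
  let ?I = "{i. i < length fs \<and> snd (snd (fs ! i)) = x}"
  have "- ns ! i - int (fst (snd (fs ! i))) - 1 \<ge> - (\<bar>N\<bar> + int (fst (snd (fs ! i))))" if "i \<in> ?I" for i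
  proof -
    have "ns ! i < N" using assms that by simp
    then show ?thesis by simp
  qed
  then have "(\<Sum>i\<in>?I. - (\<bar>N\<bar> + int (fst (snd (fs ! i))))) \<le> factor_exponent fs ns x"
    unfolding factor_exponent_def by (rule sum_mono)
  moreover have "(\<Sum>i\<in>?I. \<bar>N\<bar> + int (fst (snd (fs ! i)))) \<le> (\<Sum>i<length fs. \<bar>N\<bar> +
      int (fst (snd (fs ! i))))"
    by (rule sum_mono2) auto
  ultimately show ?thesis unfolding sum_negf by linarith
qed

text \<open>Indices below \<open>N\<close> bound every single exponent from below. The exponents
  belonging to one variable have a fixed sum, so they are bounded above as well, and the indices are
  bounded below.\<close>

lemma admissible_bounded_below: "\<exists>L. \<forall>ns\<in>admissible N fs e. \<forall>n\<in>set ns. L \<le> n"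
proof -
  let ?s = "\<lambda>i. \<bar>N\<bar> + int (fst (snd (fs ! i)))"
  \<comment> \<open>One sum of \<open>?s\<close> accounts for the other factors in the same
    variable, the second one for the order of differentiation of the factor itself; the absolute
    values make the bound uniform in the variable.\<close>
  define L where "L = - (\<Sum>i<length fs. \<bar>e (snd (snd (fs ! i)))\<bar>) - 1 - 2 * (\<Sum>i<length fs. ?s i)"
  have "L \<le> ns ! i" if "ns \<in> admissible N fs e" "i < length fs" for ns i
  proof -
    let ?x = "snd (snd (fs ! i))"
    let ?I = "{i. i < length fs \<and> snd (snd (fs ! i)) = ?x}"
    let ?t = "\<lambda>i. - ns ! i - int (fst (snd (fs ! i))) - 1"
    have ns: "length ns = length fs" "\<forall>n\<in>set ns. n < N" "factor_exponent fs ns = e"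
      using that by (auto simp: admissible_def)
    have "?t j \<ge> - ?s j" if "j < length fs" for j
    proof -
      have "ns ! j < N" using ns that by simp
      then show ?thesis by simp
    qed
    then have "(\<Sum>j\<in>?I - {i}. - ?s j) \<le> (\<Sum>j\<in>?I - {i}. ?t j)" by (intro sum_mono) auto
    moreover have "(\<Sum>j\<in>?I - {i}. ?s j) \<le> (\<Sum>j<length fs. ?s j)" by (rule sum_mono2) auto
    moreover have "e ?x = ?t i + (\<Sum>j\<in>?I - {i}. ?t j)"
      using that(2) unfolding ns(3)[symmetric] factor_exponent_def by (subst sum.remove[of _ i]) auto
    ultimately have "?t i \<le> e ?x + (\<Sum>j<length fs. ?s j)" unfolding sum_negf by linarith
    moreover have "e ?x \<le> (\<Sum>i<length fs. \<bar>e (snd (snd (fs ! i)))\<bar>)"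
      using that(2) member_le_sum[of i "{..<length fs}" "\<lambda>i. \<bar>e (snd (snd (fs ! i)))\<bar>"] by simp
    moreover have "?s i \<le> (\<Sum>j<length fs. ?s j)"
      using that(2) member_le_sum[of i "{..<length fs}" ?s] by simp
    ultimately show ?thesis unfolding L_def by simp
  qed
  moreover have "length ns = length fs" if "ns \<in> admissible N fs e" for ns
    using that by (simp add: admissible_def)
  ultimately show ?thesis by (metis in_set_conv_nth)
qed

lemma finite_admissible: "finite (admissible N fs e)"
proof -
  obtain L where "\<forall>ns\<in>admissible N fs e. \<forall>n\<in>set ns. L \<le> n"
    using admissible_bounded_below by blast
  then have "admissible N fs e \<subseteq> {ns. set ns \<subseteq> {L..N} \<and> length ns = length fs}"
    by (fastforce simp: admissible_def)
  then show ?thesis by (rule finite_subset) (rule finite_lists_length_eq, simp)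
qed

text \<open>A list outside \<open>B\<close> of the right length and exponent contains an index at
  least \<open>N\<close>, hence a mode that annihilates \<open>v\<close>. The set \<open>B\<close>
  is left free to allow both the admissible lists and the boxes of the truncation.\<close>

lemma normal_ordered_product_eq_sum:
  assumes "v \<in> bounded_states N" "finite B" "admissible (int N) fs e \<subseteq> B"
  shows "normal_ordered_product fs e v = (\<Sum>ns | ns \<in> B \<and> length ns =
      length fs \<and> factor_exponent fs ns = e.
    factor_coeff fs ns *\<^sub>C nord (zip (map fst fs) ns) v)"
proof -
  let ?t = "\<lambda>ns. factor_coeff fs ns *\<^sub>C nord (zip (map fst fs) ns) v"
  let ?f = "\<lambda>ns. if length ns = length fs \<and> factor_exponent fs ns = e then ?t ns else 0"
  have "normal_ordered_product fs e v = Sum_any ?f"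
    unfolding normal_ordered_product_def
    by (rule arg_cong[where f = Sum_any], rule ext)
      (simp add: factor_coeff_def factor_exponent_def fun_eq_iff normal_ordered_modes_eq)
  also have "\<dots> = sum ?f B"
  proof (rule Sum_any.expand_superset[OF assms(2)])
    show "{ns. ?f ns \<noteq> 0} \<subseteq> B"
    proof
      fix ns assume "ns \<in> {ns. ?f ns \<noteq> 0}"
      then have ns: "length ns = length fs" "factor_exponent fs ns =
          e" "nord (zip (map fst fs) ns) v \<noteq> 0"
        by (auto split: if_splits)
      have "ns ! i < int N" if "i < length ns" for i
      proof (rule ccontr)
        assume "\<not> ns ! i < int N"
        moreover have "(fst (fs ! i), ns ! i) \<in> set (zip (map fst fs) ns)"
          using that ns(1) nth_mem[of i "zip (map fst fs) ns"] by simp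
        ultimately show False using nord_eq_0[OF assms(1)] ns(3) by fastforce
      qed
      then have "\<forall>n\<in>set ns. n < int N" by (auto simp: in_set_conv_nth)
      then show "ns \<in> B" using ns assms(3) by (auto simp: admissible_def)
    qed
  qed
  also have "\<dots> = sum ?t {ns \<in> B. length ns = length fs \<and> factor_exponent fs ns = e}"
    using assms(2) by (simp add: sum.inter_filter)
  finally show ?thesis .
qed

lemma normal_ordered_product_eq_0:
  assumes "v \<in> bounded_states N"
    and "e x < - (\<Sum>i<length fs. int N + int (fst (snd (fs ! i))))"
  shows "normal_ordered_product fs e v = 0"
proof -
  have "admissible (int N) fs e = {}"
    using factor_exponent_ge[of _ fs "int N" x] assms(2) by (fastforce simp: admissible_def)
  then show ?thesis
    using normal_ordered_product_eq_sum[OF assms(1), of "{}" fs e] by simp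
qed

text \<open>This is the hypothesis that \<open>state_extension\<close> needs in order to define
  \<open>Y\<close> by its values on the states.\<close>

lemma clinear_normal_ordered_product_slot:
  "clinear (\<lambda>h. normal_ordered_product (X @ (h, m, x) # Y) e v)"
proof -
  obtain N where v: "v \<in> bounded_states N" using bounded_states_exhaust by blast
  let ?fs = "\<lambda>h. X @ (h, m, x) # Y"
  have snd: "snd (?fs h ! i) = snd (?fs 0 ! i)" for h i
    by (simp add: nth_append nth_Cons split: nat.splits)
  have coeff: "factor_coeff (?fs h) = factor_coeff (?fs 0)" for h
    unfolding factor_coeff_def snd[of h] by simp
  have exponent: "factor_exponent (?fs h) = factor_exponent (?fs 0)" for h
    unfolding factor_exponent_def snd[of h] by simp
  have admissible: "admissible (int N) (?fs h) e = admissible (int N) (?fs 0) e" for h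
    unfolding admissible_def exponent[of h] by simp
  let ?B = "admissible (int N) (?fs 0) e"
  have "normal_ordered_product (?fs h) e v =
      (\<Sum>ns\<in>?B. factor_coeff (?fs 0) ns *\<^sub>C nord (zip (map fst (?fs h)) ns) v)" for h
    unfolding normal_ordered_product_eq_sum[OF v finite_admissible order.refl] coeff[of h] exponent[of h] admissible[of h]
    by (rule sum.cong) (auto simp: admissible_def)
  moreover have "clinear (\<lambda>h. \<Sum>ns\<in>?B. factor_coeff (?fs 0) ns *\<^sub>C nord (zip (map fst (?fs h)) ns) v)"
  proof (intro clinear_sum clinear_scale)
    fix ns assume "ns \<in> ?B"
    then have len: "length ns = Suc (length X + length Y)" by (simp add: admissible_def)
    then have ns: "take (length X) ns @ ns ! length X # drop (Suc (length X)) ns = ns"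
      by (simp add: id_take_nth_drop[symmetric])
    have "zip (map fst (?fs h)) (take (length X) ns @ ns ! length X # drop (Suc (length X)) ns) =
        zip (map fst X) (take (length X) ns) @ (h, ns ! length X) # zip (map fst Y) (drop (Suc (length X)) ns)" for h
      using len by simp
    then show "clinear (\<lambda>h. nord (zip (map fst (?fs h)) ns) v)"
      unfolding ns by (simp only: clinear_nord_slot)
  qed
  ultimately show ?thesis by simp
qed

text \<open>The definite description is legitimate: existence comes from
  \<open>state_extension\<close>, uniqueness from the fact that the states span
  \<open>V\<close>.\<close>

theorem vertex_operator_state:
  fixes v :: "'a::complex_bilinear_space fock_space"
  shows "vertex_operator (state hs) k v =
      normal_ordered_product (map (\<lambda>(h, m). (h, m, ())) hs) (\<lambda>_. k) v"
proof -
  let ?G = "\<lambda>k v hs. normal_ordered_product (map (\<lambda>(h, m). (h, m, ())) hs) (\<lambda>_. k) v"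
  let ?P = "\<lambda>Y :: 'a fock_space \<Rightarrow> int \<Rightarrow> 'a fock_space \<Rightarrow>
      'a fock_space. (\<forall>k v. clinear (\<lambda>u. Y u k v)) \<and> (\<forall>hs k v. Y (state hs) k v = ?G k v hs)"
  have "\<exists>f. clinear f \<and> (\<forall>hs. f (state hs) = ?G k v hs)" for k and v :: "'a fock_space"
    by (rule state_extension[of "?G k v"]) (simp add: clinear_normal_ordered_product_slot, blast)
  then obtain Y where "clinear (Y k v)" "Y k v (state hs) =
      ?G k v hs" for k and v :: "'a fock_space" and hs
    by metis
  then have ex: "?P (\<lambda>u k v. Y k v u)" by blast
  have uniq: "Y = Y'" if "?P Y" "?P Y'" for Y Y' :: "'a fock_space \<Rightarrow> int \<Rightarrow> 'a fock_space \<Rightarrow>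
      'a fock_space"
  proof (intro ext)
    fix u v :: "'a fock_space" and k
    have l: "clinear (\<lambda>u. Y u k v)" "clinear (\<lambda>u. Y' u k v)" using that by blast+
    have "u \<in> complex_vector.span (range state)" by (simp add: span_states)
    then show "Y u k v = Y' u k v"
    proof (induction rule: complex_vector.span_induct)
      case base
      show ?case by (simp add: complex_vector.subspace_def clinear_props[OF l(1)] clinear_props[OF l(2)])
    next
      case (step u)
      then show ?case using that by auto
    qed
  qed
  have "\<exists>!Y. ?P Y" by (rule ex1I[of ?P, OF ex]) (rule uniq[OF _ ex])
  then have "?P vertex_operator" unfolding vertex_operator_def by (rule theI')
  then show ?thesis by blast
qed

text \<open>Brings both vertex operators into the two-variable setting, where the variable that does
  not occur has exponent 0.\<close>

lemma normal_ordered_product_unit_var: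
  fixes x :: formal_variable
  shows "normal_ordered_product (map (\<lambda>(h, m). (h, m, ())) hs) (\<lambda>_. k) v =
    normal_ordered_product (map (\<lambda>(h, m). (h, m, x)) hs) (\<lambda>y. if y = x then k else 0) v"
proof -
  obtain N where v: "v \<in> bounded_states N" using bounded_states_exhaust by blast
  let ?f = "map (\<lambda>(h, m). (h, m, ())) hs" and ?g = "map (\<lambda>(h, m). (h, m, x)) hs"
  have "factor_exponent ?f ns = (\<lambda>_. k) \<longleftrightarrow> factor_exponent ?g ns = (\<lambda>y. if y = x then k else 0)" for ns
  proof -
    have "{i. i < length ?g \<and> snd (snd (?g ! i)) = y} = (if y =
        x then {i. i < length hs} else {})" for y
      by (auto simp: case_prod_beta)
    then have "factor_exponent ?g ns = (\<lambda>y. if y = x then factor_exponent ?f ns () else 0)"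
      by (auto simp: factor_exponent_def fun_eq_iff case_prod_beta intro!: sum.cong)
    then show ?thesis by (auto simp: fun_eq_iff)
  qed
  moreover have "factor_coeff ?f = factor_coeff ?g"
    by (auto simp: factor_coeff_def fun_eq_iff case_prod_beta)
  moreover have "map fst ?f = map fst ?g" by (simp add: case_prod_beta)
  moreover from calculation have "admissible (int N) ?f (\<lambda>_. k) = admissible (int N) ?g (\<lambda>y. if y =
      x then k else 0)"
    by (simp add: admissible_def)
  ultimately show ?thesis
    by (simp only: normal_ordered_product_eq_sum[OF v finite_admissible order.refl] length_map)
qed

section \<open>Truncation to finitely many modes\<close>

type_synonym laurent = "int \<times> int \<Rightarrow>\<^sub>0 complex"

definition laurent_scale :: "laurent \<Rightarrow> (int \<times> int \<Rightarrow> 'v::complex_vector) \<Rightarrow> int \<times> int \<Rightarrow> 'v"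
  where "laurent_scale P A e = linear_extension (\<lambda>d. A (e - d)) P"

lemma laurent_scale_single: "laurent_scale (Poly_Mapping.single d c) A e = c *\<^sub>C A (e - d)"
  by (simp add: laurent_scale_def)

global_interpretation laurent: contraction "laurent_scale :: laurent \<Rightarrow> _ \<Rightarrow> int \<times> int \<Rightarrow>
    'v::complex_vector"
proof
  fix P Q :: laurent and A B :: "int \<times> int \<Rightarrow> 'v"
  show add_right: "laurent_scale P (A + B) = laurent_scale P A + laurent_scale P B" for P A B
    by (rule ext) (simp add: laurent_scale_def linear_extension_def scaleC_add_right sum.distrib)
  show add_left: "laurent_scale (P + Q) A = laurent_scale P A + laurent_scale Q A" for P Q A
    by (rule ext) (simp add: laurent_scale_def linear_extension_linear)
  show "laurent_scale P (laurent_scale Q A) = laurent_scale (P * Q) A"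
  proof (induction P rule: poly_mapping_add_induct)
    case (single d c)
    show ?case
    proof (induction Q rule: poly_mapping_add_induct)
      case (single d' c')
      show ?case
        by (rule ext) (simp add: mult_single laurent_scale_single scaleC_scaleC algebra_simps)
    next
      case (add P Q)
      then show ?case by (simp only: distrib_left add_left add_right)
    qed
  next
    case (add P Q)
    then show ?case by (simp only: distrib_right add_left)
  qed
  show "laurent_scale 1 A = A"
    unfolding single_one[symmetric] by (rule ext) (simp add: laurent_scale_single scaleC_one del: single_one)
qed

definition const_series :: "'v::complex_vector \<Rightarrow> int \<times> int \<Rightarrow> 'v"
  where "const_series v e = (if e = 0 then v else 0)"

text \<open>Carries the matching formula from complex scalars to Laurent polynomials, over which the
  modes can be weighted by monomials.\<close>

lemma const_series_contr:
  fixes G :: "'f list \<Rightarrow> 'g list \<Rightarrow> 'v::complex_vector"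
  shows "const_series (complex_contraction.contr C A G B) =
    laurent.contr (\<lambda>x y. Poly_Mapping.single 0 (C x y)) A (\<lambda>X Y. const_series (G X Y)) B"
proof -
  have lin: "const_series (u + v) = const_series u + const_series v"
    "const_series (u - v) = const_series u - const_series v"
    "const_series (c *\<^sub>C u) = laurent_scale (Poly_Mapping.single 0 c) (const_series u)"
    for u v :: 'v and c
    by (auto simp: const_series_def fun_eq_iff laurent_scale_single)
  have zero: "const_series (0 :: 'v) = 0" by (auto simp: const_series_def)
  have del: "const_series (complex_contraction.del \<phi> B F) =
      laurent.del (\<lambda>y. Poly_Mapping.single 0 (\<phi> y)) B (\<lambda>X. const_series (F X))"
    for \<phi> and B :: "'g list" and F :: "'g list \<Rightarrow> 'v"
    by (induction B arbitrary: F) (simp_all add: lin zero)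
  have pow: "Poly_Mapping.single 0 ((-1) ^ n) = (-1 :: laurent) ^ n" for n
    by (induction n) (simp_all add: single_uminus)
  show ?thesis
  proof (induction A arbitrary: G B)
    case (Cons x A)
    have "(\<lambda>Y. const_series (complex_contraction.contr C A G Y)) =
        laurent.contr (\<lambda>x y. Poly_Mapping.single 0 (C x y)) A (\<lambda>X Y. const_series (G X Y))"
      by (rule ext) (rule Cons)
    then show ?case by (simp add: Cons lin del pow)
  qed simp
qed

primrec position :: "formal_variable \<Rightarrow> int \<Rightarrow> int \<times> int"
  where "position Var_x t = (t, 0)" | "position Var_y t = (0, t)"

text \<open>The monomial that accompanies the mode of index \<open>n\<close> in the series of the
  factor \<open>f\<close>.\<close>

definition factor_weight :: "('h, formal_variable) factor \<Rightarrow> int \<Rightarrow> laurent"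
  where "factor_weight f n = Poly_Mapping.single (position (snd (snd f)) (- n - int (fst (snd f)) - 1))
    (of_int (- n - 1) gchoose fst (snd f))"

definition total_exponent :: "('h, formal_variable) factor list \<Rightarrow> int list \<Rightarrow> int \<times> int"
  where "total_exponent fs ns = (factor_exponent fs ns Var_x, factor_exponent fs ns Var_y)"

lemma factor_coeff_Cons: "factor_coeff (f # fs) (n # ns) =
    (of_int (- n - 1) gchoose fst (snd f)) * factor_coeff fs ns"
  by (simp add: factor_coeff_def prod.lessThan_Suc_shift del: prod.lessThan_Suc)

lemma factor_exponent_Cons: "factor_exponent (f # fs) (n # ns) x =
    (if snd (snd f) = x then - n - int (fst (snd f)) - 1 else 0) + factor_exponent fs ns x"
proof -
  have "(\<Sum>i | i < Suc r \<and> Q i. g i) = (if Q 0 then g 0 else 0) + (\<Sum>i | i < r \<and> Q (Suc i). g (Suc i))"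
    for Q and g :: "nat \<Rightarrow> int" and r
  proof -
    have "(\<Sum>i | i < r \<and> Q i. g i) = (\<Sum>i<r. if Q i then g i else 0)" for r Q and g :: "nat \<Rightarrow> int"
      by (simp add: sum.If_cases Int_def lessThan_def)
    then show ?thesis by (simp add: sum.lessThan_Suc_shift del: sum.lessThan_Suc)
  qed
  from this[of _ "length fs" "\<lambda>i. snd (snd ((f # fs) ! i)) = x"] show ?thesis
    by (simp add: factor_exponent_def)
qed

lemma total_exponent_Cons:
  "total_exponent (f # fs) (n # ns) = position (snd (snd f)) (- n - int (fst (snd f)) - 1) +
      total_exponent fs ns"
  by (cases "snd (snd f)") (simp_all add: total_exponent_def factor_exponent_Cons)

lemma sum_lists_Suc:
  assumes "finite N"
  shows "(\<Sum>ns | set ns \<subseteq> N \<and> length ns = Suc r. g ns) =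
    (\<Sum>n\<in>N. \<Sum>ns | set ns \<subseteq> N \<and> length ns = r. g (n # ns))"
  using assms finite_lists_length_eq[OF assms, of r]
  by (simp add: sum.Sigma)
    (rule sum.reindex_bij_witness[where i = "\<lambda>(n, ns). n # ns" and j = "\<lambda>ns. (hd ns, tl ns)"];
      auto simp: length_Suc_conv)

lemma sum_fun_apply: "(\<Sum>i\<in>I. f i) x = (\<Sum>i\<in>I. f i x)"
  by (induction I rule: infinite_finite_induct) simp_all

lemma lift_sum_expand:
  assumes "finite N"
  shows "laurent.lift_sum factor_weight N fs F e = (\<Sum>ns | set ns \<subseteq> N \<and> length ns = length fs.
    factor_coeff fs ns *\<^sub>C F (zip fs ns) (e - total_exponent fs ns))"
proof (induction fs arbitrary: F e)
  case Nil
  have "{ns. set ns \<subseteq> N \<and> length ns = 0} = {[]}" by auto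
  then show ?case
    by (simp add: factor_coeff_def total_exponent_def factor_exponent_def scaleC_one flip: zero_prod_def)
next
  case (Cons f fs)
  show ?case
    by (simp add: sum_fun_apply factor_weight_def[of f] laurent_scale_single Cons sum_lists_Suc[OF assms]
        factor_coeff_Cons total_exponent_Cons complex_vector.scale_sum_right scaleC_scaleC algebra_simps)
qed

definition truncated_product :: "nat \<Rightarrow> ('h::complex_bilinear_space, formal_variable) factor list \<Rightarrow>
    'h fock_space \<Rightarrow> int \<times> int \<Rightarrow> 'h fock_space"
  where "truncated_product K fs v = laurent.lift_sum factor_weight {- int K..int K} fs
    (\<lambda>X. const_series (nord (map (\<lambda>(f, n). (fst f, n)) X) v))"

lemma map_zip_factor: "map (\<lambda>(f, n). (fst f, n)) (zip fs ns) = zip (map fst fs) ns"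
  by (induction fs ns rule: list_induct2') auto

lemma lift_sum_const_series:
  "laurent.lift_sum factor_weight {- int K..int K} fs (\<lambda>X. const_series (g X)) e =
    (\<Sum>ns | set ns \<subseteq> {- int K..int K} \<and> length ns = length fs \<and> total_exponent fs ns = e.
      factor_coeff fs ns *\<^sub>C g (zip fs ns))"
proof -
  let ?B = "{ns. set ns \<subseteq> {- int K..int K} \<and> length ns = length fs}"
  have "finite ?B" by (rule finite_lists_length_eq) simp
  moreover have "laurent.lift_sum factor_weight {- int K..int K} fs (\<lambda>X. const_series (g X)) e =
      (\<Sum>ns\<in>?B. if total_exponent fs ns = e then factor_coeff fs ns *\<^sub>C g (zip fs ns) else 0)"
    unfolding lift_sum_expand[OF finite_atLeastAtMost_int]
    by (rule sum.cong) (auto simp: const_series_def)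
  ultimately show ?thesis
    by (simp add: sum.inter_filter[symmetric] conj_assoc)
qed

lemma truncated_product_eq:
  "truncated_product K fs v e =
    (\<Sum>ns | set ns \<subseteq> {- int K..int K} \<and> length ns = length fs \<and> total_exponent fs ns = e.
      factor_coeff fs ns *\<^sub>C nord (zip (map fst fs) ns) v)"
  unfolding truncated_product_def lift_sum_const_series map_zip_factor ..

lemma total_exponent_eq_iff: "total_exponent fs ns = (k, l) \<longleftrightarrow> factor_exponent fs ns = monomial_xy k l"
  by (auto simp: total_exponent_def fun_eq_iff split: formal_variable.split)

lemma eventually_admissible_subset:
  "\<forall>\<^sub>F K in sequentially. admissible N fs e \<subseteq> {ns. set ns \<subseteq> {- int K..int K} \<and> length ns = length fs}"
proof -
  obtain L where L: "\<forall>ns\<in>admissible N fs e. \<forall>n\<in>set ns. L \<le> n" using admissible_bounded_below by blast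
  show ?thesis
  proof (rule eventually_sequentiallyI[of "nat (\<bar>L\<bar> + \<bar>N\<bar>)"])
    fix K assume "nat (\<bar>L\<bar> + \<bar>N\<bar>) \<le> K"
    then have "- int K \<le> L" "N \<le> int K" by auto
    then show "admissible N fs e \<subseteq> {ns. set ns \<subseteq> {- int K..int K} \<and> length ns = length fs}"
      using L by (fastforce simp: admissible_def)
  qed
qed

lemma eventually_truncated_product:
  "\<forall>\<^sub>F K in sequentially. truncated_product K fs v (k, l) =
      normal_ordered_product fs (monomial_xy k l) v"
proof -
  obtain N where v: "v \<in> bounded_states N" using bounded_states_exhaust by blast
  show ?thesis
    using eventually_admissible_subset[of "int N" fs "monomial_xy k l"]
  proof eventually_elim
    case (elim K)
    have "finite {ns. set ns \<subseteq> {- int K..int K} \<and> length ns = length fs}"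
      by (rule finite_lists_length_eq) simp
    from normal_ordered_product_eq_sum[OF v this elim] show ?case
      by (simp add: truncated_product_eq total_exponent_eq_iff conj_assoc)
  qed
qed

lemma truncated_product_eq_0:
  assumes "v \<in> bounded_states N"
    and "k < - (\<Sum>i<length fs. int N + int (fst (snd (fs ! i)))) \<or> l < - (\<Sum>i<length fs. int N +
        int (fst (snd (fs ! i))))"
  shows "truncated_product K fs v (k, l) = 0"
  unfolding truncated_product_eq
proof (rule sum.neutral, intro ballI)
  fix ns
  assume ns: "ns \<in> {ns. set ns \<subseteq> {- int K..int K} \<and> length ns = length fs \<and> total_exponent fs ns =
      (k, l)}"
  have "\<not> (\<forall>n\<in>set ns. n < int N)"
  proof
    assume "\<forall>n\<in>set ns. n < int N"
    from factor_exponent_ge[OF _ this, of fs Var_x] factor_exponent_ge[OF _ this, of fs Var_y]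
    have "- (\<Sum>i<length fs. int N + int (fst (snd (fs ! i)))) \<le> k"
      "- (\<Sum>i<length fs. int N + int (fst (snd (fs ! i)))) \<le> l"
      using ns by (auto simp: total_exponent_def)
    then show False using assms(2) by linarith
  qed
  then obtain i where i: "i < length ns" "ns ! i \<ge> int N" by (auto simp: in_set_conv_nth not_less)
  then have "(fst (fs ! i), ns ! i) \<in> set (zip (map fst fs) ns)"
    using ns nth_mem[of i "zip (map fst fs) ns"] by simp
  then show "factor_coeff fs ns *\<^sub>C nord (zip (map fst fs) ns) v = 0"
    using nord_eq_0[OF assms(1) _ i(2)] by simp
qed

lemma factor_exponent_other_var:
  assumes "\<And>f. f \<in> set fs \<Longrightarrow> snd (snd f) = x" "y \<noteq> x"
  shows "factor_exponent fs ns y = 0"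
proof -
  have "{i. i < length fs \<and> snd (snd (fs ! i)) = y} = {}" using assms by auto
  then show ?thesis by (simp only: factor_exponent_def sum.empty)
qed

text \<open>The coefficient \<open>?w\<close> of the inner product is one fixed vector, so the outer
  truncation has to be exact on this vector only. The exponents separate because \<open>A\<close>
  involves only x and \<open>B\<close> only y.\<close>

lemma eventually_iterated_product:
  fixes v :: "'h::complex_bilinear_space fock_space"
  assumes A: "\<And>f. f \<in> set A \<Longrightarrow> snd (snd f) = Var_x" and B: "\<And>f. f \<in> set B \<Longrightarrow> snd (snd f) = Var_y"
  shows "\<forall>\<^sub>F K in sequentially. laurent.lift_sum factor_weight {- int K..int K} A (\<lambda>X.
      laurent.lift_sum factor_weight {- int K..int K} B (\<lambda>Y. const_series
        (nord (map (\<lambda>(f, n). (fst f, n)) X) (nord (map (\<lambda>(f, n). (fst f, n)) Y) v)))) (k, l) =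
    normal_ordered_product A (monomial_xy k 0) (normal_ordered_product B (monomial_xy 0 l) v)"
proof -
  let ?w = "normal_ordered_product B (monomial_xy 0 l) v"
  let ?p = "map (\<lambda>(f, n :: int). (fst f, n)) :: (('h, formal_variable) factor \<times> int) list \<Rightarrow>
      ('h \<times> int) list"
  show ?thesis
    using eventually_truncated_product[of B v 0 l] eventually_truncated_product[of A ?w k 0]
  proof eventually_elim
    case (elim K)
    let ?N = "{- int K..int K}"
    let ?T = "\<lambda>X. laurent.lift_sum factor_weight ?N B (\<lambda>Y. const_series (nord (?p X) (nord (?p Y) v)))"
    have T: "?T X (k', l') = (if k' = 0 then nord (?p X) (truncated_product K B v (0, l')) else 0)" for X k' l'
    proof -
      have e: "total_exponent B ns = (0, factor_exponent B ns Var_y)" for ns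
        using factor_exponent_other_var[of B Var_y Var_x ns] B by (simp add: total_exponent_def)
      show ?thesis
        by (auto simp: lift_sum_const_series truncated_product_eq e map_zip_factor
            clinear_props[OF clinear_nord])
    qed
    have e: "total_exponent A ns = (factor_exponent A ns Var_x, 0)" for ns
      using factor_exponent_other_var[of A Var_x Var_y ns] A by (simp add: total_exponent_def)
    let ?L = "{ns. set ns \<subseteq> ?N \<and> length ns = length A}"
    have "finite ?L" by (rule finite_lists_length_eq) simp
    have "laurent.lift_sum factor_weight ?N A ?T (k, l) =
        (\<Sum>ns\<in>?L. if total_exponent A ns = (k, 0) then factor_coeff A ns *\<^sub>C nord (zip (map fst A) ns) ?w else 0)"
      unfolding lift_sum_expand[OF finite_atLeastAtMost_int, where fs = A]
    proof (rule sum.cong[OF refl], goal_cases)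
      case (1 ns)
      have "(k, l) - total_exponent A ns = (k - factor_exponent A ns Var_x, l)" by (simp add: e)
      then show ?case
        by (simp only: T elim(1)) (simp add: e map_zip_factor)
    qed
    also have "\<dots> = truncated_product K A ?w (k, 0)"
      using \<open>finite ?L\<close> by (simp add: truncated_product_eq sum.inter_filter[symmetric] conj_assoc)
    finally show ?case using elim(2) by simp
  qed
qed

text \<open>A ring homomorphism to C((x))((y)), with y as the outer variable to match C((x))[[y]];
  in this common ring the truncated and the full determinants become comparable.\<close>

definition laurent_to_fls :: "laurent \<Rightarrow> complex fls fls"
  where "laurent_to_fls P = (\<Sum>d\<in>Poly_Mapping.keys P.
    fls_const (fls_const (Poly_Mapping.lookup P d) * fls_X_intpow (fst d)) * fls_X_intpow (snd d))"

lemma laurent_to_fls_add: "laurent_to_fls (P + Q) = laurent_to_fls P + laurent_to_fls Q"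
  unfolding laurent_to_fls_def
  by (rule setsum_keys_plus_distrib)
    (simp_all add: distrib_right distrib_left flip: fls_plus_const)

lemma laurent_to_fls_single: "laurent_to_fls (Poly_Mapping.single d c) =
    fls_const (fls_const c * fls_X_intpow (fst d)) * fls_X_intpow (snd d)"
  by (simp add: laurent_to_fls_def)

lemma laurent_to_fls_uminus: "laurent_to_fls (- P) = - laurent_to_fls P"
  using laurent_to_fls_add[of P "- P"] by (simp add: laurent_to_fls_def minus_unique)

lemma laurent_to_fls_mult: "laurent_to_fls (P * Q) = laurent_to_fls P * laurent_to_fls Q"
proof (induction P rule: poly_mapping_add_induct)
  case (single d c)
  show ?case
  proof (induction Q rule: poly_mapping_add_induct)
    case (single d' c')
    show ?case
      by (simp only: mult_single laurent_to_fls_single fst_add snd_add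
          fls_X_intpow_times_fls_X_intpow[symmetric] fls_const_mult_const[symmetric] mult_ac)
  next
    case (add P Q)
    then show ?case by (simp add: distrib_left laurent_to_fls_add)
  qed
next
  case (add P Q)
  then show ?case by (simp add: distrib_right laurent_to_fls_add)
qed

lemma fls_const_times_X_intpow_nth: "fls_nth (fls_const c * fls_X_intpow s) j = (if j =
    s then c else 0)"
  for c :: "'a::semiring_1"
  by (simp add: fls_X_intpow_times_conv_shift(2))

lemma laurent_to_fls_nth: "fls_nth (fls_nth (laurent_to_fls P) j) i = Poly_Mapping.lookup P (i, j)"
proof (induction P rule: poly_mapping_add_induct)
  case (single d c)
  show ?case
    by (cases d) (simp add: laurent_to_fls_single fls_const_times_X_intpow_nth lookup_single when_def)
next
  case (add P Q)
  then show ?case by (simp add: laurent_to_fls_add lookup_add)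
qed

lemma laurent_to_fls_eqI:
  assumes "\<And>i j. Poly_Mapping.lookup P (i, j) = fls_nth (fls_nth F j) i"
  shows "laurent_to_fls P = F"
  by (intro fls_eqI) (simp add: laurent_to_fls_nth assms)

lemma laurent_to_fls_one: "laurent_to_fls 1 = 1"
  unfolding single_one[symmetric] laurent_to_fls_single by simp

lemma laurent_to_fls_rdet:
  assumes "finite T"
  shows "laurent_to_fls (rdet C is T) = rdet (\<lambda>i j. laurent_to_fls (C i j)) is T"
  using assms
proof (induction "is" arbitrary: T)
  case (Cons i "is")
  have zero: "laurent_to_fls 0 = 0" by (simp add: laurent_to_fls_def)
  have "laurent_to_fls ((- 1) ^ n) = (- 1) ^ n" for n
    by (induction n) (simp_all add: laurent_to_fls_uminus laurent_to_fls_one)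
  moreover have "laurent_to_fls (\<Sum>j\<in>T. f j) = (\<Sum>j\<in>T. laurent_to_fls (f j))" for f
    by (induction T rule: infinite_finite_induct) (simp_all add: laurent_to_fls_add zero)
  ultimately show ?case using Cons by (simp add: laurent_to_fls_mult)
qed (simp add: laurent_to_fls_one)

lemma fps_to_fls_rdet:
  fixes C :: "'f \<Rightarrow> 'i::linorder \<Rightarrow> 'a::comm_ring_1 fps"
  assumes "finite T"
  shows "fps_to_fls (rdet C is T) = rdet (\<lambda>i j. fps_to_fls (C i j)) is T"
  using assms
proof (induction "is" arbitrary: T)
  case (Cons i "is")
  have "fps_to_fls (\<Sum>j\<in>T. f j) = (\<Sum>j\<in>T. fps_to_fls (f j))" for f :: "'i \<Rightarrow> 'a fps"
    by (induction T rule: infinite_finite_induct) simp_all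
  then show ?case using Cons by (simp add: fls_times_fps_to_fls fps_to_fls_power)
qed simp

text \<open>The coefficient of degree \<open>t\<close> of a determinant involves only coefficients
  of degree at most \<open>t\<close> of its finitely many entries.\<close>

lemma eventually_rdet_nth:
  fixes D :: "nat \<Rightarrow> 'f \<Rightarrow> 'i::linorder \<Rightarrow> 'a::comm_ring_1 fps"
  assumes "finite T" "\<And>i j t. \<forall>\<^sub>F K in sequentially. fps_nth (D K i j) t = fps_nth (C i j) t"
  shows "\<forall>\<^sub>F K in sequentially. fps_nth (rdet (D K) is T) t = fps_nth (rdet C is T) t"
  using assms(1)
proof (induction "is" arbitrary: T t)
  case (Cons i "is")
  have mult: "\<forall>\<^sub>F K in sequentially. fps_nth (F K * G K) t = fps_nth (F' * G') t"
    if "\<And>t. \<forall>\<^sub>F K in sequentially. fps_nth (F K) t = fps_nth F' t"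
      "\<And>t. \<forall>\<^sub>F K in sequentially. fps_nth (G K) t = fps_nth G' t" for F G :: "nat \<Rightarrow> 'a fps" and F' G' t
  proof -
    have "\<forall>\<^sub>F K in sequentially. \<forall>u\<in>{0..t}. fps_nth (F K) u =
        fps_nth F' u \<and> fps_nth (G K) (t - u) = fps_nth G' (t - u)"
      using that by (intro eventually_ball_finite ballI eventually_conj) auto
    then show ?thesis by eventually_elim (simp add: fps_mult_nth)
  qed
  have "\<forall>\<^sub>F K in sequentially. \<forall>j\<in>T.
      fps_nth ((-1) ^ card {j'\<in>T. j' < j} * D K i j * rdet (D K) is (T - {j})) t =
      fps_nth ((-1) ^ card {j'\<in>T. j' < j} * C i j * rdet C is (T - {j})) t"
    using Cons assms(2) by (intro eventually_ball_finite ballI mult) auto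
  then show ?case
  proof eventually_elim
    case (elim K)
    have "fps_nth (\<Sum>j\<in>T. f j) t = (\<Sum>j\<in>T. fps_nth (f j) t)" for f :: "'i \<Rightarrow> 'a fps"
      by (rule fps_sum_nth)
    then show ?case using elim by simp
  qed
qed simp

section \<open>The contraction of two factors as an expansion of f\<close>

lemma gbinomial_negative: "(of_int (- int x - 1) gchoose m) = (- 1) ^ m * (of_nat ((x +
    m) choose m) :: complex)"
proof -
  have *: "(of_int (- int x - 1) :: complex) = - 1 - of_nat x" by simp
  show ?thesis
    unfolding * binomial_gbinomial using gbinomial_negated_upper[of "- 1 - of_nat x :: complex" m]
    by (simp add: algebra_simps)
qed

text \<open>Up to the common sign (-1)^m, both sides equal the multinomial coefficient (j + n + m)!
  / (j! n! m!). The left side comes from the modes of index \<open>j + n\<close> and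
  \<open>- (j + n) - 1\<close>, the right side from the expansion of f.\<close>

lemma iota_coefficient:
  "(of_int (- int (j + n) - 1) gchoose m) * (of_nat (j + n) gchoose n) =
    (of_int (- int n - 1) gchoose m) * (of_nat ((m + n + 1 + j - 1) choose j) :: complex)"
proof -
  have "((j + n + m) choose m) * ((j + n) choose n) * (fact m * fact n * fact j) = (fact (j + n +
      m) :: nat)"
    using binomial_fact_lemma[of m "j + n + m"] binomial_fact_lemma[of n "j + n"]
    by (simp add: algebra_simps) (metis mult.assoc mult.commute)
  moreover have "((n + m) choose m) * ((j + n + m) choose j) * (fact m * fact n * fact j) =
      (fact (j + n + m) :: nat)"
    using binomial_fact_lemma[of m "n + m"] binomial_fact_lemma[of j "j + n + m"]
    by (simp add: algebra_simps) (metis mult.assoc mult.commute)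
  ultimately have "((j + n + m) choose m) * ((j + n) choose n) = ((n + m) choose m) * ((j + n +
      m) choose j)"
    by (metis fact_nonzero mult_right_cancel mult_eq_0_iff)
  then have "(of_nat ((j + n + m) choose m) * of_nat ((j + n) choose n) :: complex) =
      of_nat ((n + m) choose m) * of_nat ((j + n + m) choose j)"
    by (metis of_nat_mult)
  moreover have "m + n + 1 + j - 1 = j + n + m" by simp
  ultimately show ?thesis
    unfolding gbinomial_negative binomial_gbinomial[of "j + n" n, symmetric]
    by (simp add: add.commute add.left_commute)
qed

lemma iota_xy_f_nth: "fps_nth (scalar_xy c * iota_xy_f m n) j =
    fls_const (c * (of_int (- int (j + n) - 1) gchoose m) * (of_nat (j + n) gchoose n)) *
    fls_X_intpow (- int (j + n) - int m - 1)"
proof -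
  have "fps_nth (scalar_xy c * iota_xy_f m n) j =
      fls_const (c * ((of_int (- int n - 1) gchoose m) * of_nat ((m + n + 1 + j - 1) choose j))) *
      fls_X_intpow (- int (m + n + 1) - int j)"
    unfolding scalar_xy_def iota_xy_f_def iota_xy_power_def fps_mult_left_const_nth fps_nth_Abs_fps
    by (simp only: fls_const_mult_const[symmetric] mult.assoc)
  moreover have "- int (m + n + 1) - int j = - int (j + n) - int m - 1" by simp
  ultimately show ?thesis unfolding iota_coefficient[symmetric] by (simp only: mult.assoc)
qed

definition truncated_contraction :: "nat \<Rightarrow> ('h::complex_bilinear_space, formal_variable) factor \<Rightarrow>
    ('h, formal_variable) factor \<Rightarrow> laurent"
  where "truncated_contraction K f g = (\<Sum>n\<in>{- int K..int K}. factor_weight f n *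
    (\<Sum>n'\<in>{- int K..int K}. factor_weight g n' * Poly_Mapping.single 0 (mode_form (fst f, n) (fst g, n'))))"

text \<open>The power \<open>y^j\<close> is produced by the modes of index \<open>j + n\<close> and
  \<open>- (j + n) - 1\<close>; the second lies in \<open>{- K..K}\<close> exactly when
  \<open>j + n < K\<close>.\<close>

definition truncated_iota :: "nat \<Rightarrow> complex \<Rightarrow> nat \<Rightarrow> nat \<Rightarrow> complex fls fps"
  where "truncated_iota K c m n = Abs_fps (\<lambda>j. if j +
      n < K then fps_nth (scalar_xy c * iota_xy_f m n) j else 0)"

lemma laurent_to_fls_truncated_contraction:
  "laurent_to_fls (truncated_contraction K (a, m, Var_x) (b, n, Var_y)) =
    fps_to_fls (truncated_iota K (form a b) m n)"
proof (rule laurent_to_fls_eqI)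
  fix i j :: int
  let ?N = "{- int K..int K}"
  let ?c = "\<lambda>t. (of_int (- t - 1) gchoose m) * (of_int t gchoose n) * form a b"
  let ?t = "j + int n"
  have "Poly_Mapping.lookup (truncated_contraction K (a, m, Var_x) (b, n, Var_y)) (i, j) =
    (\<Sum>t\<in>?N. \<Sum>t'\<in>?N. Poly_Mapping.lookup (factor_weight (a, m, Var_x) t *
      (factor_weight (b, n, Var_y) t' * Poly_Mapping.single 0 (mode_form (a, t) (b, t')))) (i, j))"
    by (simp add: truncated_contraction_def sum_distrib_left lookup_sum)
  \<comment> \<open>The relation \<open>t + t' + 1 = 0\<close> from \<open>mode_form\<close> and the
    exponent of y together determine both indices.\<close>
  also have "\<dots> = (\<Sum>t\<in>?N. \<Sum>t'\<in>?N. if t = ?t \<and> t' = - ?t - 1 then (if 0 \<le> ?t \<and> i =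
      - ?t - int m - 1 then ?c ?t else 0) else 0)"
    by (intro sum.cong refl) (auto simp: factor_weight_def mult_single lookup_single when_def mode_form_def)
  also have "\<dots> = (if ?t \<in> ?N \<and> - ?t - 1 \<in> ?N \<and> 0 \<le> ?t \<and> i = - ?t - int m - 1 then ?c ?t else 0)"
  proof -
    have "(\<Sum>t\<in>?N. \<Sum>t'\<in>?N. if t = p \<and> t' = q then x else 0) = (if p \<in> ?N \<and> q \<in> ?N then x else 0)"
      for p q and x :: complex
    proof -
      have "(\<Sum>t'\<in>?N. if t = p \<and> t' = q then x else 0) = (if t =
          p then if q \<in> ?N then x else 0 else 0)" for t
        by (cases "t = p") (simp_all add: sum.delta)
      then show ?thesis by (simp add: sum.delta)
    qed
    then show ?thesis by auto
  qed
  also have "\<dots> = fls_nth (fls_nth (fps_to_fls (truncated_iota K (form a b) m n)) j) i"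
  proof (cases "j < 0")
    case True
    \<comment> \<open>Negative powers of y do not occur, since the binomial coefficient of
      \<open>t\<close> over \<open>n\<close> vanishes for \<open>0 \<le> t < n\<close>.\<close>
    have "?c ?t = 0" if "0 \<le> ?t"
    proof -
      obtain u where u: "?t = int u" using \<open>0 \<le> ?t\<close> by (rule nonneg_int_cases)
      then have "u < n" using True by linarith
      then have "(of_nat u gchoose n :: complex) = 0" by (simp flip: binomial_gbinomial)
      then show ?thesis using u by simp
    qed
    then show ?thesis using True by simp
  next
    case False
    then obtain u where u: "j = int u" using nonneg_int_cases[of j] by auto
    have t: "?t = int (u + n)" using u by simp
    have "fls_nth (fls_nth (fps_to_fls (truncated_iota K (form a b) m n)) j) i =
        (if u + n < K \<and> i = - int (u + n) - int m - 1
         then form a b * (of_int (- int (u + n) - 1) gchoose m) * (of_nat (u + n) gchoose n) else 0)"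
      unfolding u truncated_iota_def
      by (simp only: fps_to_fls_nth fps_nth_Abs_fps iota_xy_f_nth nat_int of_nat_less_0_iff if_False
          fls_const_times_X_intpow_nth if_distrib[of "\<lambda>F. fls_nth F i"] fls_zero_nth) auto
    moreover have "?t \<in> ?N \<and> - ?t - 1 \<in> ?N \<and> 0 \<le> ?t \<longleftrightarrow> u + n < K" unfolding t by auto
    ultimately show ?thesis unfolding t by (auto simp: mult_ac simp del: of_nat_add)
  qed
  finally show "Poly_Mapping.lookup (truncated_contraction K (a, m, Var_x) (b, n, Var_y)) (i, j) =
      fls_nth (fls_nth (fps_to_fls (truncated_iota K (form a b) m n)) j) i" .
qed

lemma eventually_truncated_iota_nth:
  "\<forall>\<^sub>F K in sequentially. fps_nth (truncated_iota K c m n) j = fps_nth (scalar_xy c * iota_xy_f m n) j"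
  by (rule eventually_sequentiallyI[of "j + n + 1"]) (simp add: truncated_iota_def)

lemma finite_fls_support: "finite {i. i \<le> N \<and> fls_nth F i \<noteq> 0}"
proof (rule finite_subset)
  show "{i. i \<le> N \<and> fls_nth F i \<noteq> 0} \<subseteq> {fls_subdegree F..N}"
    by (auto intro: fls_subdegree_leI)
qed simp

text \<open>Both sides are sums over a finite set of pairs \<open>(i, j)\<close> that does not depend on \<open>K\<close>: the
  truncated and the full normal-ordered product vanish below the same exponents.\<close>

lemma eventually_series_times:
  fixes P :: "nat \<Rightarrow> laurent"
  assumes P: "\<And>K. laurent_to_fls (P K) = fps_to_fls (Q K)"
    and Q: "\<And>j. \<forall>\<^sub>F K in sequentially. fps_nth (Q K) j = fps_nth F j"
  shows "\<forall>\<^sub>F K in sequentially. laurent_scale (P K) (truncated_product K fs v) (k, l) =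
    series_times F (normal_ordered_product fs) (monomial_xy k l) v"
proof -
  obtain N where v: "v \<in> bounded_states N" using bounded_states_exhaust by blast
  \<comment> \<open>A factor with index below \<open>N\<close> has exponent at least
    \<open>- N - m\<close>, so \<open>- \<beta>\<close> is a lower bound for the exponents of x and
    of y on \<open>v\<close>.\<close>
  define \<beta> where "\<beta> = (\<Sum>i<length fs. int N + int (fst (snd (fs ! i))))"
  let ?Z = "SIGMA j:{..nat (l + \<beta>)}. {i. i \<le> k + \<beta> \<and> fls_nth (fps_nth F j) i \<noteq> 0}"
  have Z: "finite ?Z" using finite_fls_support by auto
  let ?A = "\<lambda>i j. normal_ordered_product fs (monomial_xy (k - i) (l - int j)) v"
  have A: "?A i j = 0" if "\<not> (j \<le> nat (l + \<beta>) \<and> i \<le> k + \<beta>)" for i j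
  proof (cases "i \<le> k + \<beta>")
    case True
    then show ?thesis
      using that by (intro normal_ordered_product_eq_0[OF v, of _ Var_y]) (auto simp: \<beta>_def)
  next
    case False
    then show ?thesis
      by (intro normal_ordered_product_eq_0[OF v, of _ Var_x]) (auto simp: \<beta>_def)
  qed
  have "series_times F (normal_ordered_product fs) (monomial_xy k l) v =
      (\<Sum>(i, j)\<in>prod.swap ` ?Z. fls_nth (fps_nth F j) i *\<^sub>C ?A i j)"
    unfolding series_times_def
  proof (rule trans[OF Sum_any.expand_superset])
    show "finite (prod.swap ` ?Z)" using Z by simp
    show "{x. (case x of (i, j) \<Rightarrow> fls_nth (fps_nth F j) i *\<^sub>C normal_ordered_product fs
        (monomial_xy (monomial_xy k l Var_x - i) (monomial_xy k l Var_y - int j)) v) \<noteq> 0} \<subseteq> prod.swap ` ?Z"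
    proof
      fix x
      assume x: "x \<in> {x. (case x of (i, j) \<Rightarrow> fls_nth (fps_nth F j) i *\<^sub>C normal_ordered_product fs
        (monomial_xy (monomial_xy k l Var_x - i) (monomial_xy k l Var_y - int j)) v) \<noteq> 0}"
      obtain i j where ij: "x = (i, j)" by (cases x)
      with x have "fls_nth (fps_nth F j) i \<noteq> 0" "?A i j \<noteq> 0" by auto
      with A[of j i] have "(j, i) \<in> ?Z" by auto
      then show "x \<in> prod.swap ` ?Z" by (force simp: ij)
    qed
  qed simp
  also have "\<dots> = (\<Sum>(j, i)\<in>?Z. fls_nth (fps_nth F j) i *\<^sub>C ?A i j)"
    by (subst sum.reindex) (auto simp: case_prod_beta)
  finally have series: "series_times F (normal_ordered_product fs) (monomial_xy k l) v =
    (\<Sum>(j, i)\<in>?Z. fls_nth (fps_nth F j) i *\<^sub>C ?A i j)" .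
  have "\<forall>\<^sub>F K in sequentially. \<forall>j\<in>{..nat (l + \<beta>)}. fps_nth (Q K) j = fps_nth F j"
    using Q by (intro eventually_ball_finite) auto
  moreover have "\<forall>\<^sub>F K in sequentially. \<forall>x\<in>?Z. truncated_product K fs v (k - snd x, l - int (fst x)) = ?A (snd x) (fst x)"
    using Z eventually_truncated_product by (intro eventually_ball_finite) auto
  ultimately show ?thesis
  proof eventually_elim
    case (elim K)
    let ?T = "truncated_product K fs v"
    have lookup: "Poly_Mapping.lookup (P K) (i, j) =
        (if j < 0 then 0 else fls_nth (fps_nth (Q K) (nat j)) i)" for i j
      by (simp add: P flip: laurent_to_fls_nth)
    have "laurent_scale (P K) ?T (k, l) =
        (\<Sum>d\<in>Poly_Mapping.keys (P K). Poly_Mapping.lookup (P K) d *\<^sub>C ?T ((k, l) - d))"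
      by (simp add: laurent_scale_def linear_extension_def)
    also have "\<dots> = (\<Sum>d\<in>(\<lambda>(j, i). (i, int j)) ` ?Z. Poly_Mapping.lookup (P K) d *\<^sub>C ?T ((k, l) - d))"
    proof (rule sum.mono_neutral_cong)
      fix d assume d: "d \<in> Poly_Mapping.keys (P K) - (\<lambda>(j, i). (i, int j)) ` ?Z"
      obtain i j where ij: "d = (i, j)" by (cases d)
      show "Poly_Mapping.lookup (P K) d *\<^sub>C ?T ((k, l) - d) = 0"
      \<comment> \<open>Within these bounds the coefficient of \<open>P K\<close> is that of
        \<open>F\<close>, which is zero off \<open>?Z\<close>. Beyond them either y has a negative
        power, absent from \<open>P K\<close>, or the truncated product vanishes.\<close>
      proof (cases "0 \<le> j \<and> j \<le> l + \<beta> \<and> i \<le> k + \<beta>")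
        case True
        then have "(nat j, i) \<notin> ?Z" using d ij by (force simp: image_iff)
        then show ?thesis using True elim(1) by (auto simp: ij lookup)
      next
        case False
        have "?T (k - i, l - j) = 0" if "\<not> (j \<le> l + \<beta> \<and> i \<le> k + \<beta>)"
          using that by (intro truncated_product_eq_0[OF v]) (auto simp: \<beta>_def)
        then show ?thesis using False by (auto simp: ij lookup)
      qed
    qed (use Z in \<open>auto simp: in_keys_iff\<close>)
    also have "\<dots> = (\<Sum>(j, i)\<in>?Z. Poly_Mapping.lookup (P K) (i, int j) *\<^sub>C ?T (k - i, l - int j))"
      by (subst sum.reindex) (auto simp: case_prod_beta inj_on_def)
    also have "\<dots> = (\<Sum>(j, i)\<in>?Z. fls_nth (fps_nth F j) i *\<^sub>C ?A i j)"
      using elim by (intro sum.cong refl) (auto simp: lookup)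
    finally show ?case by (simp add: series)
  qed
qed

section \<open>The product formula\<close>

lemma lift_sum_append: "laurent.lift_sum w N (A @ B) F =
    laurent.lift_sum w N A (\<lambda>X. laurent.lift_sum w N B (\<lambda>Y. F (X @ Y)))"
  by (induction A arbitrary: F) simp_all

text \<open>Wick's theorem for modes, expanded multilinearly, takes the same form for truncated
  series; only the contraction coefficients become sums over modes.\<close>

lemma lift_sum_wick:
  "laurent.lift_sum factor_weight {- int K..int K} A (\<lambda>X.
      laurent.lift_sum factor_weight {- int K..int K} B (\<lambda>Y. const_series
        (nord (map (\<lambda>(f, n). (fst f, n)) X) (nord (map (\<lambda>(f, n). (fst f, n)) Y) v)))) =
    laurent.contr (truncated_contraction K) A (\<lambda>X Y. truncated_product K (X @ Y) v) B"
proof -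
  let ?p = "\<lambda>(f :: 'b \<times> nat \<times> formal_variable, n :: int). (fst f, n)"
  have "const_series (nord (map ?p X) (nord (map ?p Y) v)) =
      laurent.contr (\<lambda>x y. Poly_Mapping.single 0 (mode_form (?p x) (?p y))) X
        (\<lambda>X Y. const_series (nord (map ?p (X @ Y)) v)) Y" for X Y
    by (simp add: nord_nord complex_contraction.contr_map const_series_contr)
  then show ?thesis
    by (simp add: laurent.lift_sum_contr truncated_product_def lift_sum_append truncated_contraction_def[abs_def]
        case_prod_beta)
qed

section \<open>Index tuples and index sets\<close>

lemma index_tuples_bij: "bij_betw set (index_tuples \<rho> r) {S. S \<subseteq> {1..r} \<and> card S = \<rho>}"
proof (rule bij_betw_byWitness[where f' = sorted_list_of_set])
  show "\<forall>is\<in>index_tuples \<rho> r. sorted_list_of_set (set is) = is"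
    by (auto simp: index_tuples_def strict_sorted_iff intro: sorted_list_of_set.idem_if_sorted_distinct)
  show "\<forall>S\<in>{S. S \<subseteq> {1..r} \<and> card S = \<rho>}. set (sorted_list_of_set S) = S"
    using finite_subset[of _ "{1..r}"] by auto
  show "set ` index_tuples \<rho> r \<subseteq> {S. S \<subseteq> {1..r} \<and> card S = \<rho>}"
    by (auto simp: index_tuples_def strict_sorted_iff distinct_card)
  show "sorted_list_of_set ` {S. S \<subseteq> {1..r} \<and> card S = \<rho>} \<subseteq> index_tuples \<rho> r"
    using finite_subset[of _ "{1..r}"] by (fastforce simp: index_tuples_def strict_sorted_list_of_set)
qed

lemma sum_index_tuples: "(\<Sum>is\<in>index_tuples \<rho> r. f (set is)) = (\<Sum>S | S \<subseteq> {1..r} \<and> card S = \<rho>. f S)"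
  by (rule sum.reindex_bij_betw[OF index_tuples_bij])

lemma index_tuplesD:
  assumes "is \<in> index_tuples \<rho> r"
  shows "set is \<subseteq> {1..r}" "card (set is) = \<rho>" "length is = \<rho>" "sorted_list_of_set (set is) = is"
    "sum_list is = set_position {1..r} (set is) + \<rho>"
    "sorted_list_of_set ({1..r} - set is) = filter (\<lambda>i. i \<notin> set is) [1..<r + 1]"
proof -
  have "is": "length is = \<rho>" "sorted_wrt (<) is" "set is \<subseteq> {1..r}"
    using assms by (auto simp: index_tuples_def)
  then show "set is \<subseteq> {1..r}" "card (set is) = \<rho>" "length is = \<rho>" "sorted_list_of_set (set is) = is"
    by (auto simp: strict_sorted_iff distinct_card intro: sorted_list_of_set.idem_if_sorted_distinct)
  have "card {i'\<in>{1..r}. i' < i} + 1 = i" if "i \<in> set is" for i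
  proof -
    have "{i'\<in>{1..r}. i' < i} = {1..<i}" using that "is"(3) by auto
    moreover have "1 \<le> i" using that "is"(3) by auto
    ultimately show ?thesis by simp
  qed
  then have "(\<Sum>i\<in>set is. i) = (\<Sum>i\<in>set is. card {i'\<in>{1..r}. i' < i} + 1)" by simp
  then have "(\<Sum>i\<in>set is. i) = set_position {1..r} (set is) + \<rho>"
    using \<open>card (set is) = \<rho>\<close> by (simp add: set_position_def sum_Suc)
  then show "sum_list is = set_position {1..r} (set is) + \<rho>"
    using "is" by (simp add: strict_sorted_iff distinct_sum_list_conv_Sum)
  have "set (filter (\<lambda>i. i \<notin> set is) [1..<r + 1]) = {1..r} - set is" by auto
  moreover have "sorted_list_of_set (set (filter (\<lambda>i. i \<notin> set is) [1..<r + 1])) =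
      filter (\<lambda>i. i \<notin> set is) [1..<r + 1]"
    by (rule sorted_list_of_set.idem_if_sorted_distinct)
      (auto simp: sorted_wrt_filter simp del: upt_Suc filter_append)
  ultimately show "sorted_list_of_set ({1..r} - set is) = filter (\<lambda>i. i \<notin> set is) [1..<r + 1]" by simp
qed

text \<open>Pairs of index sets are grouped by their common cardinality. The empty pair is split off
  because it gives the normal-ordered product without contractions.\<close>

lemma sum_subset_pairs:
  fixes f :: "nat set \<Rightarrow> nat set \<Rightarrow> 'v::comm_monoid_add"
  shows "(\<Sum>S\<in>Pow {1..r}. \<Sum>T | T \<subseteq> {1..s} \<and> card T = card S. f S T) =
    f {} {} + (\<Sum>\<rho> = 1..min r s. \<Sum>is\<in>index_tuples \<rho> r. \<Sum>js\<in>index_tuples \<rho> s. f (set is) (set js))"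
proof -
  let ?P = "\<lambda>\<rho> r. {S. S \<subseteq> {1..r} \<and> card S = \<rho>} :: nat set set"
  let ?g = "\<lambda>S. \<Sum>T\<in>?P (card S) s. f S T"
  have card: "card S \<le> r" if "S \<subseteq> {1..r}" for S r
    using card_mono[OF _ that] by simp
  have "(\<Sum>S\<in>Pow {1..r}. ?g S) = (\<Sum>\<rho>\<in>{0..r}. \<Sum>S\<in>{S \<in> Pow {1..r}. card S = \<rho>}. ?g S)"
    by (rule sum.group[symmetric]) (use card in auto)
  also have "\<dots> = (\<Sum>\<rho>\<in>{0..r}. \<Sum>S\<in>?P \<rho> r. \<Sum>T\<in>?P \<rho> s. f S T)"
    by (intro sum.cong) auto
  also have "\<dots> = (\<Sum>\<rho>\<in>{0..min r s}. \<Sum>S\<in>?P \<rho> r. \<Sum>T\<in>?P \<rho> s. f S T)"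
  proof (rule sum.mono_neutral_right)
    show "\<forall>\<rho>\<in>{0..r} - {0..min r s}. (\<Sum>S\<in>?P \<rho> r. \<Sum>T\<in>?P \<rho> s. f S T) = 0"
    proof
      fix \<rho> assume "\<rho> \<in> {0..r} - {0..min r s}"
      then have "?P \<rho> s = {}" using card[of _ s] by force
      then show "(\<Sum>S\<in>?P \<rho> r. \<Sum>T\<in>?P \<rho> s. f S T) = 0" by (simp only: sum.empty sum.neutral_const)
    qed
  qed auto
  also have "\<dots> = (\<Sum>S\<in>?P 0 r. \<Sum>T\<in>?P 0 s. f S T) + (\<Sum>\<rho> = 1..min r s. \<Sum>S\<in>?P \<rho> r. \<Sum>T\<in>?P \<rho> s. f S T)"
    by (simp add: sum.atLeast_Suc_atMost)
  finally have "(\<Sum>S\<in>Pow {1..r}. ?g S) = (\<Sum>S\<in>?P 0 r. \<Sum>T\<in>?P 0 s. f S T) +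
      (\<Sum>\<rho> = 1..min r s. \<Sum>S\<in>?P \<rho> r. \<Sum>T\<in>?P \<rho> s. f S T)" .
  moreover have "?P 0 r = {{}}" for r
    using finite_subset[of _ "{1..r}"] by (auto simp: card_eq_0_iff)
  moreover have "(\<Sum>is\<in>index_tuples \<rho> r. \<Sum>js\<in>index_tuples \<rho> s. f (set is) (set js)) =
      (\<Sum>S\<in>?P \<rho> r. \<Sum>T\<in>?P \<rho> s. f S T)" for \<rho>
    using sum_index_tuples[of "\<lambda>S. \<Sum>js\<in>index_tuples \<rho> s. f S (set js)" \<rho> r]
    by (simp only: sum_index_tuples[of "f S" for S])
  ultimately show ?thesis by simp
qed

lemma laurent_scale_sign: "laurent_scale ((-1) ^ n * P) A e = (-1) ^ n *\<^sub>C laurent_scale P A e"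
proof (cases "even n")
  case True
  then show ?thesis by (simp add: scaleC_one)
next
  case False
  then show ?thesis by (simp add: scaleC_one)
qed

theorem corollary4p5:
  fixes p q :: "'h::complex_bilinear_space set" and M :: nat
    and a b :: "nat \<Rightarrow> 'h" and m n :: "nat \<Rightarrow> nat" and r s :: nat
    and k l :: int and v :: "'h fock_space"
  assumes "\<exists>B :: 'h set. finite B \<and> complex_vector.span B = UNIV"
    and "complex_vector.dim (UNIV :: 'h set) = 2 * M"
    and "maximal_isotropic p" and "maximal_isotropic q"
    and "complex_vector.dim p = M" and "complex_vector.dim q = M"
    and "{u + w | u w. u \<in> p \<and> w \<in> q} = UNIV" and "p \<inter> q = {0}"
  shows
    "vertex_operator (state (map (\<lambda>i. (a i, m i)) [1..<r + 1])) k
       (vertex_operator (state (map (\<lambda>j. (b j, n j)) [1..<s + 1])) l v) =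
     normal_ordered_product
       (map (\<lambda>i. (a i, m i, Var_x)) [1..<r + 1] @ map (\<lambda>j. (b j, n j, Var_y)) [1..<s + 1])
       (monomial_xy k l) v +
     (\<Sum>\<rho> = 1..min r s. \<Sum>is \<in> index_tuples \<rho> r. \<Sum>js \<in> index_tuples \<rho> s.
       ((-1) ^ (sum_list is + sum_list js) * (-1) ^ (r * \<rho> + (\<rho> * (\<rho> + 1)) div 2)) *\<^sub>C
       series_times
         (det (mat \<rho> \<rho> (\<lambda>(g, h). scalar_xy (form (a (is ! g)) (b (js ! h))) *
           iota_xy_f (m (is ! g)) (n (js ! h)))))
         (normal_ordered_product
           (map (\<lambda>i. (a i, m i, Var_x)) (filter (\<lambda>i. i \<notin> set is) [1..<r + 1]) @
            map (\<lambda>j. (b j, n j, Var_y)) (filter (\<lambda>j. j \<notin> set js) [1..<s + 1])))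
         (monomial_xy k l) v)"
  proof -
  let ?A = "map (\<lambda>i. (a i, m i, Var_x))" and ?B = "map (\<lambda>j. (b j, n j, Var_y))"
  let ?I = "[1..<r + 1]" and ?J = "[1..<s + 1]"
  let ?C = "\<lambda>i j. scalar_xy (form (a i) (b j)) * iota_xy_f (m i) (n j)"
  let ?C' = "\<lambda>K i j. truncated_contraction K (a i, m i, Var_x) (b j, n j, Var_y)"
  let ?e = "\<lambda>S T. set_position {1..r} S + set_position {1..s} T + r * card S + card S * (card S +
      1) div 2"
  let ?X = "\<lambda>S T. ?A (sorted_list_of_set ({1..r} - S)) @ ?B (sorted_list_of_set ({1..s} - T))"
  let ?t = "\<lambda>S T. (-1) ^ ?e S T *\<^sub>C
    series_times (rdet ?C (sorted_list_of_set S) T) (normal_ordered_product (?X S T)) (monomial_xy k l) v"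
  let ?t' = "\<lambda>K S T. (-1) ^ ?e S T *\<^sub>C
    laurent_scale (rdet (?C' K) (sorted_list_of_set S) T) (truncated_product K (?X S T) v) (k, l)"
  have unit: "(\<lambda>y. if y = Var_x then k else 0) = monomial_xy k 0"
    "(\<lambda>y. if y = Var_y then l else 0) = monomial_xy 0 l"
    by (auto simp: fun_eq_iff split: formal_variable.split)
  have lhs: "vertex_operator (state (map (\<lambda>i. (a i, m i)) ?I)) k
       (vertex_operator (state (map (\<lambda>j. (b j, n j)) ?J)) l v) =
     normal_ordered_product (?A ?I) (monomial_xy k 0) (normal_ordered_product (?B ?J) (monomial_xy 0 l) v)"
    unfolding vertex_operator_state
      normal_ordered_product_unit_var[where x = Var_x and k = k]
      normal_ordered_product_unit_var[where x = Var_y and k = l] unit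
    by (simp add: o_def)
  have scalar: "\<forall>\<^sub>F K in sequentially. laurent_scale (rdet (?C' K) is T) (truncated_product K fs v) (k, l) =
      series_times (rdet ?C is T) (normal_ordered_product fs) (monomial_xy k l) v" if "finite T" for "is" T fs
  proof (rule eventually_series_times)
    let ?D = "\<lambda>K i j. truncated_iota K (form (a i) (b j)) (m i) (n j)"
    show "laurent_to_fls (rdet (?C' K) is T) = fps_to_fls (rdet (?D K) is T)" for K
      by (simp add: laurent_to_fls_rdet[OF that] fps_to_fls_rdet[OF that] laurent_to_fls_truncated_contraction)
    show "\<forall>\<^sub>F K in sequentially. fps_nth (rdet (?D K) is T) t = fps_nth (rdet ?C is T) t" for t
      by (rule eventually_rdet_nth[OF that eventually_truncated_iota_nth])
  qed
  \<comment> \<open>There are only finitely many terms, so one bound on \<open>K\<close> serves all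
    of them.\<close>
  have "\<forall>\<^sub>F K in sequentially. \<forall>\<rho>\<in>{1..min r s}. \<forall>is\<in>index_tuples \<rho> r. \<forall>js\<in>index_tuples \<rho> s.
      ?t' K (set is) (set js) = ?t (set is) (set js)"
  proof (intro eventually_ball_finite ballI)
    have fin: "finite (index_tuples \<rho> r)" for \<rho> r
      using index_tuples_bij[of \<rho> r] by (rule bij_betw_finite[THEN iffD2])
        (rule finite_subset[of _ "Pow {1..r}"], auto)
    show "finite (index_tuples \<rho> r)" "finite (index_tuples \<rho> s)" for \<rho> by (rule fin)+
    fix \<rho> "is" js
    show "\<forall>\<^sub>F K in sequentially. ?t' K (set is) (set js) = ?t (set is) (set js)"
      using scalar[OF finite_set] by eventually_elim simp
  qed simp
  moreover have "\<forall>\<^sub>F K in sequentially. truncated_product K (?A ?I @ ?B ?J) v (k, l) =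
      normal_ordered_product (?A ?I @ ?B ?J) (monomial_xy k l) v"
    by (rule eventually_truncated_product)
  moreover have "\<forall>\<^sub>F K in sequentially. laurent.contr (truncated_contraction K) (?A ?I)
        (\<lambda>X Y. truncated_product K (X @ Y) v) (?B ?J) (k, l) =
      normal_ordered_product (?A ?I) (monomial_xy k 0) (normal_ordered_product (?B ?J) (monomial_xy 0 l) v)"
    unfolding lift_sum_wick[symmetric] by (rule eventually_iterated_product) auto
  ultimately have "\<forall>\<^sub>F K in sequentially.
    normal_ordered_product (?A ?I) (monomial_xy k 0) (normal_ordered_product (?B ?J) (monomial_xy 0 l) v) =
    normal_ordered_product (?A ?I @ ?B ?J) (monomial_xy k l) v +
    (\<Sum>\<rho> = 1..min r s. \<Sum>is\<in>index_tuples \<rho> r. \<Sum>js\<in>index_tuples \<rho> s. ?t (set is) (set js))"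
  proof eventually_elim
    case (elim K)
    have I: "?I = sorted_list_of_set {1..r}" and J: "?J = sorted_list_of_set {1..s}"
      using sorted_list_of_set_range[of 1 "r + 1"] sorted_list_of_set_range[of 1 "s + 1"]
      by (simp_all add: atLeastLessThanSuc_atLeastAtMost)
    have "laurent.contr (truncated_contraction K) (?A ?I) (\<lambda>X Y. truncated_product K (X @ Y) v) (?B ?J) (k, l) =
        (\<Sum>S\<in>Pow {1..r}. \<Sum>T | T \<subseteq> {1..s} \<and> card T = card S. ?t' K S T)"
      unfolding laurent.contr_map I J laurent.contr_sorted_list_of_set[OF finite_atLeastAtMost finite_atLeastAtMost]
        sum_fun_apply laurent_scale_sign
      by (simp only: card_atLeastAtMost diff_Suc_1)
    also have "\<dots> = ?t' K {} {} +
        (\<Sum>\<rho> = 1..min r s. \<Sum>is\<in>index_tuples \<rho> r. \<Sum>js\<in>index_tuples \<rho> s. ?t' K (set is) (set js))"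
      by (rule sum_subset_pairs)
    also have "?t' K {} {} = truncated_product K (?A ?I @ ?B ?J) v (k, l)"
      unfolding I J by (simp add: set_position_def scaleC_one)
    finally show ?case using elim by simp
  qed
  \<comment> \<open>The equation no longer contains \<open>K\<close>, so it holds as soon as it
    holds eventually.\<close>
  then have "normal_ordered_product (?A ?I) (monomial_xy k 0) (normal_ordered_product (?B ?J) (monomial_xy 0 l) v) =
    normal_ordered_product (?A ?I @ ?B ?J) (monomial_xy k l) v +
    (\<Sum>\<rho> = 1..min r s. \<Sum>is\<in>index_tuples \<rho> r. \<Sum>js\<in>index_tuples \<rho> s. ?t (set is) (set js))"
    by (simp add: eventually_const_iff)
  moreover have "?t (set is) (set js) =
      ((-1) ^ (sum_list is + sum_list js) * (-1) ^ (r * \<rho> + (\<rho> * (\<rho> + 1)) div 2)) *\<^sub>C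
       series_times
         (det (mat \<rho> \<rho> (\<lambda>(g, h). scalar_xy (form (a (is ! g)) (b (js ! h))) *
           iota_xy_f (m (is ! g)) (n (js ! h)))))
         (normal_ordered_product (?A (filter (\<lambda>i. i \<notin> set is) ?I) @ ?B (filter (\<lambda>j. j \<notin> set js) ?J)))
         (monomial_xy k l) v"
    if "is \<in> index_tuples \<rho> r" "js \<in> index_tuples \<rho> s" for \<rho> "is" js
  proof -
    note i = index_tuplesD[OF that(1)] and j = index_tuplesD[OF that(2)]
    \<comment> \<open>The tuples count from 1 and \<open>set_position\<close> from 0, so each of the
      two index sums is larger by \<open>\<rho>\<close>.\<close>
    have "sum_list is + sum_list js + (r * \<rho> + (\<rho> * (\<rho> + 1)) div 2) = ?e (set is) (set js) + 2 * \<rho>"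
      unfolding i(2,5) j(5) by simp
    then have "(-1 :: complex) ^ ?e (set is) (set js) =
        (-1) ^ (sum_list is + sum_list js) * (-1) ^ (r * \<rho> + (\<rho> * (\<rho> + 1)) div 2)"
      by (simp only: power_add[symmetric]) (simp add: power_add power_mult)
    moreover have "rdet ?C is (set js) = det (mat \<rho> \<rho> (\<lambda>(g, h). ?C (is ! g) (js ! h)))"
      using rdet_eq_det[of "set js" "is" ?C] i j by simp
    ultimately show ?thesis by (simp only: i(4,6) j(6))
  qed
  ultimately show ?thesis unfolding lhs by simp
qed

end
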